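(* The commutative monoids construction $\mathcal C\mapsto\mathbf{cMon}(\mathcal C)$ gives the coreflection of $\mathbf{fpCat}$ in $\mathbf{Add}$, i.e. it is right adjoint to the (full) inclusion $\mathbf{Add}\to\mathbf{fpCat}$. Thus, the additive categories are exactly (up to equivalence) those of the form $\mathbf{cMon}(\mathcal C)$, for a finite product category $\mathcal C$.
   Context: $\mathbf{fpCat}$ is the category of categories with finite products and finite product preserving functors (equivalently, of representable cartesian multicategories). A preadditive category is a category enriched in commutative monoids (not necessarily abelian groups), and an additive category is a preadditive category with finite products (equivalently, finite biproducts). $\mathbf{Add}$ is the category of additive categories and additive (i.e. commutative-monoid-enriched) functors. $\mathbf{cMon}(\mathcal C)$ is the category of commutative monoid objects in $\mathcal C$ (with respect to finite products) and their morphisms. Its preadditive structure is as follows: the sum of monoid morphisms $f_1,\dots,f_n:M\to N$ is the composite $M\to N\times\cdots\times N\to N$ of $(f_1,\dots,f_n)$ with the $n$-fold multiplication of $N$. *)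

theory Defs
  imports "HOL-Algebra.Group"
begin

section \<open>Categories, functors, equivalences, adjunctions\<close>

text \<open>
  Categories, functors and enrichments are required to be undefined outside their domains of
  definition (as with \<^const>\<open>extensional\<close>), so that HOL equality of such records is
  equality of the mathematical structures. Composition is written in the usual order:
  \<open>g \<cdot> f\<close> is \<open>g\<close> after \<open>f\<close>.
\<close>

record ('o, 'm) cat =
  Obj :: "'o set"
  Arr :: "'m set"
  Dom :: "'m \<Rightarrow> 'o"
  Cod :: "'m \<Rightarrow> 'o"
  Ident :: "'o \<Rightarrow> 'm"
  Comp :: "'m \<Rightarrow> 'm \<Rightarrow> 'm"  (infixr "\<cdot>\<index>" 75)

definition Hom :: "('o, 'm, 'z) cat_scheme \<Rightarrow> 'o \<Rightarrow> 'o \<Rightarrow> 'm set" where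
  "Hom C a b = {f \<in> Arr C. Dom C f = a \<and> Cod C f = b}"

locale category =
  fixes C :: "('o, 'm, 'z) cat_scheme"  (structure)
  assumes Dom_Obj: "f \<in> Arr C \<Longrightarrow> Dom C f \<in> Obj C"
    and Cod_Obj: "f \<in> Arr C \<Longrightarrow> Cod C f \<in> Obj C"
    and Ident_Hom: "a \<in> Obj C \<Longrightarrow> Ident C a \<in> Hom C a a"
    and Comp_Hom: "\<lbrakk>f \<in> Hom C a b; g \<in> Hom C b c\<rbrakk> \<Longrightarrow> g \<cdot> f \<in> Hom C a c"
    and Comp_Ident_left: "f \<in> Hom C a b \<Longrightarrow> Ident C b \<cdot> f = f"
    and Comp_Ident_right: "f \<in> Hom C a b \<Longrightarrow> f \<cdot> Ident C a = f"
    and Comp_assoc: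
      "\<lbrakk>f \<in> Hom C a b; g \<in> Hom C b c; h \<in> Hom C c d\<rbrakk> \<Longrightarrow> (h \<cdot> g) \<cdot> f = h \<cdot> (g \<cdot> f)"
    and Dom_ext: "Dom C \<in> extensional (Arr C)"
    and Cod_ext: "Cod C \<in> extensional (Arr C)"
    and Ident_ext: "Ident C \<in> extensional (Obj C)"
    and Comp_ext: "\<not> (f \<in> Arr C \<and> g \<in> Arr C \<and> Cod C f = Dom C g) \<Longrightarrow> g \<cdot> f = undefined"

definition is_iso :: "('o, 'm, 'z) cat_scheme \<Rightarrow> 'o \<Rightarrow> 'o \<Rightarrow> 'm \<Rightarrow> bool" where
  "is_iso C a b f \<longleftrightarrow> f \<in> Hom C a b \<and>
     (\<exists>g \<in> Hom C b a. g \<cdot>\<^bsub>C\<^esub> f = Ident C a \<and> f \<cdot>\<^bsub>C\<^esub> g = Ident C b)"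

record ('o, 'm, 'p, 'n) func =
  omap :: "'o \<Rightarrow> 'p"
  amap :: "'m \<Rightarrow> 'n"

locale cat_functor = src: category A + tgt: category B
  for A :: "('o, 'm, 'y) cat_scheme" and B :: "('p, 'n, 'z) cat_scheme" +
  fixes F :: "('o, 'm, 'p, 'n) func"
  assumes omap_Obj: "a \<in> Obj A \<Longrightarrow> omap F a \<in> Obj B"
    and amap_Hom: "f \<in> Hom A a b \<Longrightarrow> amap F f \<in> Hom B (omap F a) (omap F b)"
    and amap_Ident: "a \<in> Obj A \<Longrightarrow> amap F (Ident A a) = Ident B (omap F a)"
    and amap_Comp: "\<lbrakk>f \<in> Hom A a b; g \<in> Hom A b c\<rbrakk> \<Longrightarrow>
          amap F (g \<cdot>\<^bsub>A\<^esub> f) = amap F g \<cdot>\<^bsub>B\<^esub> amap F f"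
    and omap_ext: "omap F \<in> extensional (Obj A)"
    and amap_ext: "amap F \<in> extensional (Arr A)"

definition id_func :: "('o, 'm, 'z) cat_scheme \<Rightarrow> ('o, 'm, 'o, 'm) func" where
  "id_func A = \<lparr>omap = (\<lambda>a\<in>Obj A. a), amap = (\<lambda>f\<in>Arr A. f)\<rparr>"

definition comp_func ::
  "('o, 'm, 'z) cat_scheme \<Rightarrow> ('p, 'n, 'q, 'k) func \<Rightarrow> ('o, 'm, 'p, 'n) func \<Rightarrow> ('o, 'm, 'q, 'k) func"
where
  "comp_func A G F =
     \<lparr>omap = (\<lambda>a\<in>Obj A. omap G (omap F a)), amap = (\<lambda>f\<in>Arr A. amap G (amap F f))\<rparr>"

definition full_functor ::
  "('o, 'm, 'y) cat_scheme \<Rightarrow> ('p, 'n, 'z) cat_scheme \<Rightarrow> ('o, 'm, 'p, 'n) func \<Rightarrow> bool" where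
  "full_functor A B F \<longleftrightarrow>
     (\<forall>a\<in>Obj A. \<forall>b\<in>Obj A. Hom B (omap F a) (omap F b) \<subseteq> amap F ` Hom A a b)"

definition faithful_functor :: "('o, 'm, 'y) cat_scheme \<Rightarrow> ('o, 'm, 'p, 'n) func \<Rightarrow> bool" where
  "faithful_functor A F \<longleftrightarrow> (\<forall>a\<in>Obj A. \<forall>b\<in>Obj A. inj_on (amap F) (Hom A a b))"

definition naturally_isomorphic ::
  "('o, 'm, 'y) cat_scheme \<Rightarrow> ('p, 'n, 'z) cat_scheme \<Rightarrow>
     ('o, 'm, 'p, 'n) func \<Rightarrow> ('o, 'm, 'p, 'n) func \<Rightarrow> bool" where
  "naturally_isomorphic A B F G \<longleftrightarrow> (\<exists>\<tau>.
     (\<forall>a\<in>Obj A. is_iso B (omap F a) (omap G a) (\<tau> a)) \<and>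
     (\<forall>a\<in>Obj A. \<forall>b\<in>Obj A. \<forall>f\<in>Hom A a b. \<tau> b \<cdot>\<^bsub>B\<^esub> amap F f = amap G f \<cdot>\<^bsub>B\<^esub> \<tau> a))"

definition equivalent_categories ::
  "('o, 'm, 'y) cat_scheme \<Rightarrow> ('p, 'n, 'z) cat_scheme \<Rightarrow> bool" where
  "equivalent_categories A B \<longleftrightarrow> (\<exists>F G. cat_functor A B F \<and> cat_functor B A G \<and>
     naturally_isomorphic A A (comp_func A G F) (id_func A) \<and>
     naturally_isomorphic B B (comp_func B F G) (id_func B))"

text \<open>The functor \<open>R : Y \<rightarrow> X\<close> is right adjoint to \<open>L : X \<rightarrow> Y\<close>.\<close>

definition right_adjoint ::
  "('o, 'm, 'y) cat_scheme \<Rightarrow> ('p, 'n, 'z) cat_scheme \<Rightarrow>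
     ('o, 'm, 'p, 'n) func \<Rightarrow> ('p, 'n, 'o, 'm) func \<Rightarrow> bool" where
  "right_adjoint X Y L R \<longleftrightarrow> cat_functor X Y L \<and> cat_functor Y X R \<and> (\<exists>\<phi>.
     (\<forall>x\<in>Obj X. \<forall>y\<in>Obj Y. bij_betw (\<phi> x y) (Hom Y (omap L x) y) (Hom X x (omap R y))) \<and>
     (\<forall>x\<in>Obj X. \<forall>x'\<in>Obj X. \<forall>y\<in>Obj Y. \<forall>y'\<in>Obj Y.
        \<forall>f\<in>Hom X x' x. \<forall>g\<in>Hom Y y y'. \<forall>h\<in>Hom Y (omap L x) y.
          \<phi> x' y' (g \<cdot>\<^bsub>Y\<^esub> h \<cdot>\<^bsub>Y\<^esub> amap L f) = amap R g \<cdot>\<^bsub>X\<^esub> \<phi> x y h \<cdot>\<^bsub>X\<^esub> f))"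


section \<open>Finite products\<close>

text \<open>Finite families are lists; the empty list gives terminal objects.\<close>

definition is_cone :: "('o, 'm, 'z) cat_scheme \<Rightarrow> 'o list \<Rightarrow> 'o \<Rightarrow> 'm list \<Rightarrow> bool" where
  "is_cone C xs c fs \<longleftrightarrow>
     c \<in> Obj C \<and> length fs = length xs \<and> (\<forall>i<length xs. fs ! i \<in> Hom C c (xs ! i))"

definition is_product :: "('o, 'm, 'z) cat_scheme \<Rightarrow> 'o list \<Rightarrow> 'o \<Rightarrow> 'm list \<Rightarrow> bool" where
  "is_product C xs p ps \<longleftrightarrow> set xs \<subseteq> Obj C \<and> is_cone C xs p ps \<and>
     (\<forall>c fs. is_cone C xs c fs \<longrightarrow>
        (\<exists>!h. h \<in> Hom C c p \<and> (\<forall>i<length xs. (ps ! i) \<cdot>\<^bsub>C\<^esub> h = fs ! i)))"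

definition mediator ::
  "('o, 'm, 'z) cat_scheme \<Rightarrow> 'o \<Rightarrow> 'm list \<Rightarrow> 'o \<Rightarrow> 'm list \<Rightarrow> 'm" where
  "mediator C p ps c fs =
     (THE h. h \<in> Hom C c p \<and> (\<forall>i<length ps. (ps ! i) \<cdot>\<^bsub>C\<^esub> h = fs ! i))"

locale fp_category = category C for C :: "('o, 'm, 'z) cat_scheme"  (structure) +
  assumes has_products: "set xs \<subseteq> Obj C \<Longrightarrow> \<exists>p ps. is_product C xs p ps"

locale fp_functor = cat_functor A B F + src: fp_category A + tgt: fp_category B
  for A :: "('o, 'm, 'y) cat_scheme" and B :: "('p, 'n, 'z) cat_scheme"
    and F :: "('o, 'm, 'p, 'n) func" +
  assumes preserves_products:
    "is_product A xs p ps \<Longrightarrow> is_product B (map (omap F) xs) (omap F p) (map (amap F) ps)"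

text \<open>
  Finite products are a property of a category, not part of its structure, and functors preserve
  them up to isomorphism. Wherever a particular product is needed, one is chosen:
\<close>

definition chosen_product :: "('o, 'm, 'z) cat_scheme \<Rightarrow> 'o list \<Rightarrow> 'o \<times> 'm list" where
  "chosen_product C xs = (SOME (p, ps). is_product C xs p ps)"

definition prod_ob :: "('o, 'm, 'z) cat_scheme \<Rightarrow> 'o list \<Rightarrow> 'o" where
  "prod_ob C xs = fst (chosen_product C xs)"

definition projs :: "('o, 'm, 'z) cat_scheme \<Rightarrow> 'o list \<Rightarrow> 'm list" where
  "projs C xs = snd (chosen_product C xs)"

definition tuple :: "('o, 'm, 'z) cat_scheme \<Rightarrow> 'o list \<Rightarrow> 'o \<Rightarrow> 'm list \<Rightarrow> 'm" where
  "tuple C xs c fs = mediator C (prod_ob C xs) (projs C xs) c fs"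


section \<open>Preadditive and additive categories\<close>

record ('o, 'm) acat = "('o, 'm) cat" +
  HAdd :: "'m \<Rightarrow> 'm \<Rightarrow> 'm"
  HZero :: "'o \<Rightarrow> 'o \<Rightarrow> 'm"

definition hom_monoid :: "('o, 'm, 'z) acat_scheme \<Rightarrow> 'o \<Rightarrow> 'o \<Rightarrow> 'm monoid" where
  "hom_monoid A a b = \<lparr>carrier = Hom A a b, mult = HAdd A, one = HZero A a b\<rparr>"

locale preadditive_category = category A for A :: "('o, 'm, 'z) acat_scheme"  (structure) +
  assumes hom_comm_monoid: "\<lbrakk>a \<in> Obj A; b \<in> Obj A\<rbrakk> \<Longrightarrow> comm_monoid (hom_monoid A a b)"
    and Comp_HAdd_left: "\<lbrakk>f \<in> Hom A a b; g \<in> Hom A b c; h \<in> Hom A b c\<rbrakk> \<Longrightarrow>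
          HAdd A g h \<cdot> f = HAdd A (g \<cdot> f) (h \<cdot> f)"
    and Comp_HAdd_right: "\<lbrakk>f \<in> Hom A a b; g \<in> Hom A a b; h \<in> Hom A b c\<rbrakk> \<Longrightarrow>
          h \<cdot> HAdd A f g = HAdd A (h \<cdot> f) (h \<cdot> g)"
    and Comp_HZero_left: "\<lbrakk>f \<in> Hom A a b; c \<in> Obj A\<rbrakk> \<Longrightarrow> HZero A b c \<cdot> f = HZero A a c"
    and Comp_HZero_right: "\<lbrakk>a \<in> Obj A; h \<in> Hom A b c\<rbrakk> \<Longrightarrow> h \<cdot> HZero A a b = HZero A a c"
    and HAdd_ext: "\<not> (f \<in> Arr A \<and> g \<in> Arr A \<and> Dom A f = Dom A g \<and> Cod A f = Cod A g) \<Longrightarrow>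
          HAdd A f g = undefined"
    and HZero_ext: "\<not> (a \<in> Obj A \<and> b \<in> Obj A) \<Longrightarrow> HZero A a b = undefined"

locale additive_category = preadditive_category A + fp_category A
  for A :: "('o, 'm, 'z) acat_scheme"  (structure)

locale additive_functor =
  cat_functor A B F + src: preadditive_category A + tgt: preadditive_category B
  for A :: "('o, 'm, 'y) acat_scheme" and B :: "('p, 'n, 'z) acat_scheme"
    and F :: "('o, 'm, 'p, 'n) func" +
  assumes amap_HAdd: "\<lbrakk>f \<in> Hom A a b; g \<in> Hom A a b\<rbrakk> \<Longrightarrow>
          amap F (HAdd A f g) = HAdd B (amap F f) (amap F g)"
    and amap_HZero: "\<lbrakk>a \<in> Obj A; b \<in> Obj A\<rbrakk> \<Longrightarrow>
          amap F (HZero A a b) = HZero B (omap F a) (omap F b)"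

definition additively_equivalent ::
  "('o, 'm, 'y) acat_scheme \<Rightarrow> ('p, 'n, 'z) acat_scheme \<Rightarrow> bool" where
  "additively_equivalent A B \<longleftrightarrow> (\<exists>F G. additive_functor A B F \<and> additive_functor B A G \<and>
     naturally_isomorphic A A (comp_func A G F) (id_func A) \<and>
     naturally_isomorphic B B (comp_func B F G) (id_func B))"


section \<open>The categories fpCat and Add\<close>

text \<open>
  The objects of fpCat and of Add are small categories in a common universe. A universe here is
  a type of the form \<open>'a univ\<close>, with \<open>'a\<close> arbitrary; objects and arrows of small
  categories are its elements. It is closed under forming triples, so it also contains commutative
  monoid objects and their morphisms. Any given category, on whatever types, has an isomorphic copy
  in such a universe.
\<close>

datatype 'a univ = Atom 'a | Triple (t1: "'a univ") (t2: "'a univ") (t3: "'a univ")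

type_synonym 'a ucat = "('a univ, 'a univ) cat"
type_synonym 'a uacat = "('a univ, 'a univ) acat"
type_synonym 'a ufunc = "('a univ, 'a univ, 'a univ, 'a univ) func"

text \<open>
  The category whose objects are the categories in \<open>K\<close> and whose arrows are the triples
  \<open>(A, F, B)\<close> where \<open>F\<close> is a functor from \<open>A\<close> to \<open>B\<close> satisfying
  \<open>P A B F\<close>.
\<close>

definition category_of_categories ::
  "('o, 'm, 'z) cat_scheme set \<Rightarrow>
   (('o, 'm, 'z) cat_scheme \<Rightarrow> ('o, 'm, 'z) cat_scheme \<Rightarrow> ('o, 'm, 'o, 'm) func \<Rightarrow> bool) \<Rightarrow>
   (('o, 'm, 'z) cat_scheme,
    ('o, 'm, 'z) cat_scheme \<times> ('o, 'm, 'o, 'm) func \<times> ('o, 'm, 'z) cat_scheme) cat" where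
  "category_of_categories K P =
    (let arrs = {(A, F, B). A \<in> K \<and> B \<in> K \<and> P A B F} in
     \<lparr>Obj = K,
      Arr = arrs,
      Dom = (\<lambda>(A, F, B)\<in>arrs. A),
      Cod = (\<lambda>(A, F, B)\<in>arrs. B),
      Ident = (\<lambda>A\<in>K. (A, id_func A, A)),
      Comp = (\<lambda>(B', G, C) (A, F, B).
        if (B', G, C) \<in> arrs \<and> (A, F, B) \<in> arrs \<and> B = B' then (A, comp_func A G F, C)
        else undefined)\<rparr>)"

definition fpCat :: "('a ucat, 'a ucat \<times> 'a ufunc \<times> 'a ucat) cat" where
  "fpCat = category_of_categories {C. fp_category C} fp_functor"

definition AddCat :: "('a uacat, 'a uacat \<times> 'a ufunc \<times> 'a uacat) cat" where
  "AddCat = category_of_categories {A. additive_category A} additive_functor"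

text \<open>The inclusion forgets the enrichment.\<close>

definition inclusion ::
  "('a uacat, 'a uacat \<times> 'a ufunc \<times> 'a uacat, 'a ucat, 'a ucat \<times> 'a ufunc \<times> 'a ucat) func"
where
  "inclusion =
     \<lparr>omap = (\<lambda>A\<in>Obj AddCat. cat.truncate A),
      amap = (\<lambda>(A, F, B)\<in>Arr AddCat. (cat.truncate A, F, cat.truncate B))\<rparr>"


section \<open>Commutative monoid objects\<close>

text \<open>
  For a multiplication \<open>m : X \<times> X \<rightarrow> X\<close> and a unit \<open>e : 1 \<rightarrow> X\<close>, the product
  of two generalized elements \<open>f, g : c \<rightarrow> X\<close>, and the generalized element at
  \<open>c\<close> given by the unit.
\<close>

definition gmult :: "('o, 'm, 'z) cat_scheme \<Rightarrow> 'o \<Rightarrow> 'm \<Rightarrow> 'o \<Rightarrow> 'm \<Rightarrow> 'm \<Rightarrow> 'm" where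
  "gmult C X m c f g = m \<cdot>\<^bsub>C\<^esub> tuple C [X, X] c [f, g]"

definition gunit :: "('o, 'm, 'z) cat_scheme \<Rightarrow> 'm \<Rightarrow> 'o \<Rightarrow> 'm" where
  "gunit C e c = e \<cdot>\<^bsub>C\<^esub> tuple C [] c []"

definition comm_monoid_object :: "('o, 'm, 'z) cat_scheme \<Rightarrow> 'o \<Rightarrow> 'm \<Rightarrow> 'm \<Rightarrow> bool" where
  "comm_monoid_object C X m e \<longleftrightarrow>
     X \<in> Obj C \<and> m \<in> Hom C (prod_ob C [X, X]) X \<and> e \<in> Hom C (prod_ob C []) X \<and>
     (let c = prod_ob C [X, X, X]; x = projs C [X, X, X] ! 0;
          y = projs C [X, X, X] ! 1; z = projs C [X, X, X] ! 2
      in gmult C X m c (gmult C X m c x y) z = gmult C X m c x (gmult C X m c y z)) \<and>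
     (let c = prod_ob C [X, X]; x = projs C [X, X] ! 0; y = projs C [X, X] ! 1
      in gmult C X m c x y = gmult C X m c y x) \<and>
     gmult C X m X (gunit C e X) (Ident C X) = Ident C X \<and>
     gmult C X m X (Ident C X) (gunit C e X) = Ident C X"

definition monoid_morphism ::
  "('o, 'm, 'z) cat_scheme \<Rightarrow> 'o \<Rightarrow> 'm \<Rightarrow> 'm \<Rightarrow> 'o \<Rightarrow> 'm \<Rightarrow> 'm \<Rightarrow> 'm \<Rightarrow> bool" where
  "monoid_morphism C X m e Y n u f \<longleftrightarrow>
     f \<in> Hom C X Y \<and>
     f \<cdot>\<^bsub>C\<^esub> m = gmult C Y n (prod_ob C [X, X])
       (f \<cdot>\<^bsub>C\<^esub> (projs C [X, X] ! 0)) (f \<cdot>\<^bsub>C\<^esub> (projs C [X, X] ! 1)) \<and>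
     f \<cdot>\<^bsub>C\<^esub> e = u"

text \<open>
  The category of commutative monoids, with its preadditive structure. Its objects are
  \<open>Triple X m e\<close> (carrier, multiplication, unit); its arrows are \<open>Triple M f N\<close>
  (source, underlying arrow, target).
\<close>

definition cMon_Obj :: "'a ucat \<Rightarrow> 'a univ set" where
  "cMon_Obj C = {Triple X m e | X m e. comm_monoid_object C X m e}"

definition cMon_Arr :: "'a ucat \<Rightarrow> 'a univ set" where
  "cMon_Arr C = {Triple M f N | M f N. M \<in> cMon_Obj C \<and> N \<in> cMon_Obj C \<and>
     monoid_morphism C (t1 M) (t2 M) (t3 M) (t1 N) (t2 N) (t3 N) f}"

definition cMon :: "'a ucat \<Rightarrow> 'a uacat" where
  "cMon C =
     \<lparr>Obj = cMon_Obj C,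
      Arr = cMon_Arr C,
      Dom = (\<lambda>f\<in>cMon_Arr C. t1 f),
      Cod = (\<lambda>f\<in>cMon_Arr C. t3 f),
      Ident = (\<lambda>M\<in>cMon_Obj C. Triple M (Ident C (t1 M)) M),
      Comp = (\<lambda>g f. if f \<in> cMon_Arr C \<and> g \<in> cMon_Arr C \<and> t3 f = t1 g
        then Triple (t1 f) (t2 g \<cdot>\<^bsub>C\<^esub> t2 f) (t3 g) else undefined),
      HAdd = (\<lambda>f g. if f \<in> cMon_Arr C \<and> g \<in> cMon_Arr C \<and> t1 f = t1 g \<and> t3 f = t3 g
        then Triple (t1 f) (gmult C (t1 (t3 f)) (t2 (t3 f)) (t1 (t1 f)) (t2 f) (t2 g)) (t3 f)
        else undefined),
      HZero = (\<lambda>M N. if M \<in> cMon_Obj C \<and> N \<in> cMon_Obj C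
        then Triple M (gunit C (t3 N) (t1 M)) N else undefined)\<rparr>"

text \<open>
  For a product preserving \<open>F : C \<rightarrow> D\<close>, the inverse of the canonical comparison
  \<open>F (x\<^sub>1 \<times> \<dots> \<times> x\<^sub>n) \<rightarrow> F x\<^sub>1 \<times> \<dots> \<times> F x\<^sub>n\<close> between the image
  of the chosen product and the chosen product of the images. It transports the operations of a
  monoid object along \<open>F\<close>.
\<close>

definition comparison_inv ::
  "('o, 'm, 'y) cat_scheme \<Rightarrow> ('p, 'n, 'z) cat_scheme \<Rightarrow> ('o, 'm, 'p, 'n) func \<Rightarrow> 'o list \<Rightarrow> 'n"
where
  "comparison_inv C D F xs =
     mediator D (omap F (prod_ob C xs)) (map (amap F) (projs C xs))
       (prod_ob D (map (omap F) xs)) (projs D (map (omap F) xs))"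

definition cMon_map :: "'a ucat \<Rightarrow> 'a ucat \<Rightarrow> 'a ufunc \<Rightarrow> 'a ufunc" where
  "cMon_map C D F =
    (let ob = (\<lambda>M. Triple (omap F (t1 M))
                 (amap F (t2 M) \<cdot>\<^bsub>D\<^esub> comparison_inv C D F [t1 M, t1 M])
                 (amap F (t3 M) \<cdot>\<^bsub>D\<^esub> comparison_inv C D F [])) in
     \<lparr>omap = (\<lambda>M\<in>cMon_Obj C. ob M),
      amap = (\<lambda>f\<in>cMon_Arr C. Triple (ob (t1 f)) (amap F (t2 f)) (ob (t3 f)))\<rparr>)"

definition cMon_functor ::
  "('a ucat, 'a ucat \<times> 'a ufunc \<times> 'a ucat, 'a uacat, 'a uacat \<times> 'a ufunc \<times> 'a uacat) func"
where
  "cMon_functor =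
     \<lparr>omap = (\<lambda>C\<in>Obj fpCat. cMon C),
      amap = (\<lambda>(C, F, D)\<in>Arr fpCat. (cMon C, cMon_map C D F, cMon D))\<rparr>"

end

theory Submission
  imports Defs
begin

text \<open>
  Generalized elements turn a commutative monoid object into a commutative monoid structure on each
  \<open>Hom c X\<close>, natural in \<open>c\<close>; this makes \<open>cMon C\<close> additive, with products
  created by the forgetful functor \<open>cMon C \<rightarrow> C\<close>. In an additive category every object
  carries exactly one commutative monoid structure (Eckmann-Hilton), and every arrow respects it, so
  \<open>X \<mapsto> (X, p\<^sub>0 + p\<^sub>1, 0)\<close> is an isomorphism \<open>A \<cong> cMon A\<close>, strictly
  inverse to the forgetful functor. Finite products in a preadditive category are biproducts and hence
  equational, so for functors between additive categories being additive and preserving finite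
  products agree. The adjunction sends a product preserving \<open>F : A \<rightarrow> C\<close> to
  \<open>A \<cong> cMon A \<rightarrow> cMon C\<close>, the second functor being \<open>cMon F\<close>; its inverse is
  composition with the forgetful functor.
\<close>

section \<open>Categories and products\<close>

text \<open>Chosen products come from a choice operator, so a product preserving functor sends them
  to products that need not be the chosen ones. Computations with explicit comparison arrows are
  kept short by testing structure on elements: by Yoneda a multiplication is determined by its
  operation at the projections of any one product diagram (\<open>mult_eqI\<close>), and
  \<open>transport_unique\<close> concludes that a monoid in \<open>D\<close> with the right values
  at the images of the projections is the transported one. This yields the functoriality of
  \<open>cMon_map\<close> and the description of additive functors into \<open>cMon C\<close> as
  equations between extensional functors, so no coherence isomorphisms arise in the adjunction.
  Naturality of its bijection is then cheap, since an additive functor into \<open>cMon C\<close> is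
  recovered from its composite with the forgetful functor. The characterization up to equivalence
  meets one more obstacle: an equivalence with a bare category carries no enrichment, which has to
  be pulled back along bijections of hom sets (\<open>pullback_enrichment\<close>).\<close>

lemma truncate_sel [simp]:
  "Obj (cat.truncate A) = Obj A" "Arr (cat.truncate A) = Arr A"
  "Dom (cat.truncate A) = Dom A" "Cod (cat.truncate A) = Cod A"
  "Ident (cat.truncate A) = Ident A" "Comp (cat.truncate A) = Comp A"
  by (simp_all add: cat.truncate_def)

lemma Hom_truncate [simp]: "Hom (cat.truncate A) = Hom A"
  by (simp add: Hom_def fun_eq_iff)

lemma is_product_truncate [simp]: "is_product (cat.truncate A) = is_product A"
  by (simp add: is_product_def is_cone_def fun_eq_iff)

lemma category_truncate [simp]: "category (cat.truncate A) = category A"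
  by (simp add: category_def)

lemma fp_category_truncate [simp]: "fp_category (cat.truncate A) = fp_category A"
  by (simp add: fp_category_def fp_category_axioms_def)

lemma cat_functor_truncate [simp]:
  "cat_functor (cat.truncate A) B F = cat_functor A B F"
  "cat_functor A (cat.truncate B) F = cat_functor A B F"
  by (simp_all add: cat_functor_def cat_functor_axioms_def)

lemma fp_functor_truncate [simp]:
  "fp_functor (cat.truncate A) B F = fp_functor A B F"
  "fp_functor A (cat.truncate B) F = fp_functor A B F"
  by (simp_all add: fp_functor_def fp_functor_axioms_def)

lemma less_two_iff: "i < Suc (Suc 0) \<longleftrightarrow> i = 0 \<or> i = Suc 0"
  by auto

lemma less_three_iff: "i < Suc (Suc (Suc 0)) \<longleftrightarrow> i = 0 \<or> i = Suc 0 \<or> i = Suc (Suc 0)"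
  by auto

section \<open>Universal property of products\<close>

context category
begin

lemma HomD: "f \<in> Hom C a b \<Longrightarrow> f \<in> Arr C \<and> Dom C f = a \<and> Cod C f = b \<and> a \<in> Obj C \<and> b \<in> Obj C"
  using Dom_Obj Cod_Obj by (auto simp: Hom_def)

lemma Hom_Obj: "f \<in> Hom C a b \<Longrightarrow> a \<in> Obj C" "f \<in> Hom C a b \<Longrightarrow> b \<in> Obj C"
  using HomD by auto

lemma Arr_Hom: "f \<in> Arr C \<Longrightarrow> f \<in> Hom C (Dom C f) (Cod C f)"
  by (auto simp: Hom_def)

lemma is_productD:
  assumes "is_product C xs p ps"
  shows "set xs \<subseteq> Obj C" "p \<in> Obj C" "length ps = length xs"
    "\<And>i. i < length xs \<Longrightarrow> ps ! i \<in> Hom C p (xs ! i)"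
  using assms by (auto simp: is_product_def is_cone_def)

lemma mediator_unique:
  assumes "is_product C xs p ps" "is_cone C xs c fs"
  shows "mediator C p ps c fs \<in> Hom C c p"
    and "\<And>i. i < length xs \<Longrightarrow> ps ! i \<cdot> mediator C p ps c fs = fs ! i"
proof -
  let ?P = "\<lambda>h. h \<in> Hom C c p \<and> (\<forall>i<length ps. ps ! i \<cdot> h = fs ! i)"
  have l: "length ps = length xs" using assms(1) by (rule is_productD)
  have "\<exists>!h. ?P h" using assms unfolding is_product_def l by blast
  then have "?P (mediator C p ps c fs)" unfolding mediator_def by (rule theI')
  then show "mediator C p ps c fs \<in> Hom C c p"
    "\<And>i. i < length xs \<Longrightarrow> ps ! i \<cdot> mediator C p ps c fs = fs ! i"
    using l by auto
qed

text \<open>The composites of the projections with \<open>h\<close> form a cone, and both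
  \<open>h\<close> and \<open>h'\<close> mediate it.\<close>

lemma product_ext:
  assumes "is_product C xs p ps" "h \<in> Hom C c p" "h' \<in> Hom C c p"
    and "\<And>i. i < length xs \<Longrightarrow> ps ! i \<cdot> h = ps ! i \<cdot> h'"
  shows "h = h'"
proof -
  have l: "length ps = length xs" using assms(1) by (rule is_productD)
  have "is_cone C xs c (map (\<lambda>q. q \<cdot> h) ps)"
    using assms(1,2) is_productD[OF assms(1)] by (auto simp: is_cone_def Hom_Obj intro: Comp_Hom)
  then have "\<exists>!k. k \<in> Hom C c p \<and> (\<forall>i<length xs. ps ! i \<cdot> k = map (\<lambda>q. q \<cdot> h) ps ! i)"
    using assms(1) unfolding is_product_def by blast
  then show ?thesis using assms(2-4) l by auto
qed

lemma is_productI: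
  assumes "set xs \<subseteq> Obj C" "p \<in> Obj C" "length ps = length xs"
    and "\<And>i. i < length xs \<Longrightarrow> ps ! i \<in> Hom C p (xs ! i)"
    and "\<And>c fs. is_cone C xs c fs \<Longrightarrow> \<exists>h. h \<in> Hom C c p \<and> (\<forall>i<length xs. ps ! i \<cdot> h = fs ! i)"
    and "\<And>c h h'. \<lbrakk>h \<in> Hom C c p; h' \<in> Hom C c p; \<And>i. i < length xs \<Longrightarrow> ps ! i \<cdot> h = ps ! i \<cdot> h'\<rbrakk> \<Longrightarrow> h = h'"
  shows "is_product C xs p ps"
  unfolding is_product_def
proof (intro conjI allI impI)
  show "is_cone C xs p ps" using assms(2-4) by (auto simp: is_cone_def)
  fix c fs assume c: "is_cone C xs c fs"
  obtain h where h: "h \<in> Hom C c p" "\<forall>i<length xs. ps ! i \<cdot> h = fs ! i" using assms(5)[OF c] by auto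
  show "\<exists>!h. h \<in> Hom C c p \<and> (\<forall>i<length xs. ps ! i \<cdot> h = fs ! i)"
  proof (rule ex1I[of _ h])
    fix k assume k: "k \<in> Hom C c p \<and> (\<forall>i<length xs. ps ! i \<cdot> k = fs ! i)"
    show "k = h" by (rule assms(6)[of k c h]) (simp_all add: h k)
  qed (use h in simp)
qed fact

lemma terminal_unique:
  assumes "is_product C [] t ps" "f \<in> Hom C c t" "g \<in> Hom C c t"
  shows "f = g"
  using product_ext[OF assms] by simp

lemma product_iso:
  assumes P: "is_product C xs p ps" and Q: "is_product C xs q qs"
  shows "\<exists>i j. i \<in> Hom C p q \<and> j \<in> Hom C q p \<and> j \<cdot> i = Ident C p \<and> i \<cdot> j = Ident C q \<and>
    (\<forall>k<length xs. qs ! k \<cdot> i = ps ! k)"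
proof -
  have cp: "is_cone C xs p ps" and cq: "is_cone C xs q qs" using P Q by (auto simp: is_product_def)
  obtain i where i: "i \<in> Hom C p q" "\<And>k. k < length xs \<Longrightarrow> qs ! k \<cdot> i = ps ! k"
    using mediator_unique[OF Q cp] by blast
  obtain j where j: "j \<in> Hom C q p" "\<And>k. k < length xs \<Longrightarrow> ps ! k \<cdot> j = qs ! k"
    using mediator_unique[OF P cq] by blast
  note D = is_productD[OF P] is_productD[OF Q]
  have "j \<cdot> i = Ident C p"
  proof (rule product_ext[OF P Comp_Hom[OF i(1) j(1)] Ident_Hom[OF D(2)]])
    fix k assume k: "k < length xs"
    show "ps ! k \<cdot> (j \<cdot> i) = ps ! k \<cdot> Ident C p"
      using Comp_assoc[OF i(1) j(1) D(4)[OF k]] Comp_Ident_right[OF D(4)[OF k]] i(2)[OF k] j(2)[OF k] by simp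
  qed
  moreover have "i \<cdot> j = Ident C q"
  proof (rule product_ext[OF Q Comp_Hom[OF j(1) i(1)] Ident_Hom[OF D(6)]])
    fix k assume k: "k < length xs"
    show "qs ! k \<cdot> (i \<cdot> j) = qs ! k \<cdot> Ident C q"
      using Comp_assoc[OF j(1) i(1) D(8)[OF k]] Comp_Ident_right[OF D(8)[OF k]] i(2)[OF k] j(2)[OF k] by simp
  qed
  ultimately show ?thesis using i j by blast
qed

text \<open>Composition with \<open>j\<close> turns mediating arrows into \<open>q\<close> into
  mediating arrows into \<open>p\<close>; cancelling \<open>i\<close> against its inverse gives
  uniqueness.\<close>

lemma is_product_iso:
  assumes P: "is_product C xs q qs" and i: "i \<in> Hom C p q" "j \<in> Hom C q p"
    "j \<cdot> i = Ident C p" "i \<cdot> j = Ident C q"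
    and ps: "length ps = length xs" "\<And>k. k < length xs \<Longrightarrow> ps ! k = qs ! k \<cdot> i"
  shows "is_product C xs p ps"
proof (rule is_productI)
  note D = is_productD[OF P]
  show "set xs \<subseteq> Obj C" by fact
  show "p \<in> Obj C" using i by (auto dest: Hom_Obj)
  show "ps ! k \<in> Hom C p (xs ! k)" if "k < length xs" for k
    using ps D(4)[OF that] i that by (auto intro: Comp_Hom)
  have psh: "ps ! k \<cdot> h = qs ! k \<cdot> (i \<cdot> h)" if "k < length xs" "h \<in> Hom C c p" for k h c
    using ps(2)[OF that(1)] Comp_assoc[OF that(2) i(1) D(4)[OF that(1)]] by simp
  fix c
  show "\<exists>h. h \<in> Hom C c p \<and> (\<forall>i<length xs. ps ! i \<cdot> h = fs ! i)" if c: "is_cone C xs c fs" for fs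
  proof -
    let ?m = "mediator C q qs c fs"
    note m = mediator_unique[OF P c]
    have jm: "j \<cdot> ?m \<in> Hom C c p" using m i by (auto intro: Comp_Hom)
    have "i \<cdot> (j \<cdot> ?m) = ?m"
      using Comp_assoc[OF m(1) i(2,1)] i(4) Comp_Ident_left[OF m(1)] by simp
    then show ?thesis using jm m psh[OF _ jm] by (intro exI[of _ "j \<cdot> ?m"]) auto
  qed
  show "h = h'" if h: "h \<in> Hom C c p" "h' \<in> Hom C c p"
    and e: "\<And>i. i < length xs \<Longrightarrow> ps ! i \<cdot> h = ps ! i \<cdot> h'" for h h'
  proof -
    have "i \<cdot> h = i \<cdot> h'"
      by (rule product_ext[OF P]) (use h i e psh in \<open>auto intro: Comp_Hom\<close>)
    then have "j \<cdot> (i \<cdot> h) = j \<cdot> (i \<cdot> h')" by simp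
    then show ?thesis
      using Comp_assoc[OF h(1) i(1,2)] Comp_assoc[OF h(2) i(1,2)] i(3) Comp_Ident_left h by simp
  qed
qed fact

end

section \<open>Tuples into the chosen products\<close>

context fp_category
begin

lemma chosen_is_product:
  assumes "set xs \<subseteq> Obj C"
  shows "is_product C xs (prod_ob C xs) (projs C xs)"
proof -
  have "\<exists>q. case q of (p, ps) \<Rightarrow> is_product C xs p ps" using has_products[OF assms] by auto
  then have "case chosen_product C xs of (p, ps) \<Rightarrow> is_product C xs p ps"
    unfolding chosen_product_def by (rule someI_ex)
  then show ?thesis by (simp add: prod_ob_def projs_def split: prod.splits)
qed

lemma tuple_unique:
  assumes "set xs \<subseteq> Obj C" "is_cone C xs c fs"
  shows "tuple C xs c fs \<in> Hom C c (prod_ob C xs)"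
    and "\<And>i. i < length xs \<Longrightarrow> projs C xs ! i \<cdot> tuple C xs c fs = fs ! i"
  using mediator_unique[OF chosen_is_product[OF assms(1)] assms(2)] by (auto simp: tuple_def)

lemma cone2I: "\<lbrakk>f \<in> Hom C c X; g \<in> Hom C c Y\<rbrakk> \<Longrightarrow> is_cone C [X, Y] c [f, g]"
  using Hom_Obj by (auto simp: is_cone_def less_two_iff)

lemma cone3I: "\<lbrakk>f \<in> Hom C c X; g \<in> Hom C c Y; h \<in> Hom C c Z\<rbrakk> \<Longrightarrow> is_cone C [X, Y, Z] c [f, g, h]"
  using Hom_Obj by (auto simp: is_cone_def less_three_iff)

lemma cone0I: "c \<in> Obj C \<Longrightarrow> is_cone C [] c []"
  by (auto simp: is_cone_def)

lemma pair_Hom: "\<lbrakk>f \<in> Hom C c X; g \<in> Hom C c Y\<rbrakk> \<Longrightarrow> tuple C [X, Y] c [f, g] \<in> Hom C c (prod_ob C [X, Y])"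
  using tuple_unique(1)[OF _ cone2I, of X Y f c g] Hom_Obj by auto

lemma pair_proj:
  assumes "f \<in> Hom C c X" "g \<in> Hom C c Y"
  shows "projs C [X, Y] ! 0 \<cdot> tuple C [X, Y] c [f, g] = f"
    and "projs C [X, Y] ! Suc 0 \<cdot> tuple C [X, Y] c [f, g] = g"
  using tuple_unique(2)[OF _ cone2I[OF assms], of 0] tuple_unique(2)[OF _ cone2I[OF assms], of 1]
    Hom_Obj assms by auto

lemma proj2_Hom:
  assumes "X \<in> Obj C" "Y \<in> Obj C"
  shows "projs C [X, Y] ! 0 \<in> Hom C (prod_ob C [X, Y]) X"
    and "projs C [X, Y] ! Suc 0 \<in> Hom C (prod_ob C [X, Y]) Y"
  using is_productD(4)[OF chosen_is_product, of "[X, Y]" 0] is_productD(4)[OF chosen_is_product, of "[X, Y]" 1]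
    assms by auto

lemma proj3_Hom:
  assumes "X \<in> Obj C" "Y \<in> Obj C" "Z \<in> Obj C"
  shows "projs C [X, Y, Z] ! 0 \<in> Hom C (prod_ob C [X, Y, Z]) X"
    and "projs C [X, Y, Z] ! Suc 0 \<in> Hom C (prod_ob C [X, Y, Z]) Y"
    and "projs C [X, Y, Z] ! Suc (Suc 0) \<in> Hom C (prod_ob C [X, Y, Z]) Z"
  using is_productD(4)[OF chosen_is_product, of "[X, Y, Z]" 0]
    is_productD(4)[OF chosen_is_product, of "[X, Y, Z]" 1]
    is_productD(4)[OF chosen_is_product, of "[X, Y, Z]" "Suc (Suc 0)"] assms by auto

lemma pair_ext:
  assumes "X \<in> Obj C" "Y \<in> Obj C" "h \<in> Hom C c (prod_ob C [X, Y])" "h' \<in> Hom C c (prod_ob C [X, Y])"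
    and "projs C [X, Y] ! 0 \<cdot> h = projs C [X, Y] ! 0 \<cdot> h'"
    and "projs C [X, Y] ! Suc 0 \<cdot> h = projs C [X, Y] ! Suc 0 \<cdot> h'"
  shows "h = h'"
  by (rule product_ext[OF chosen_is_product assms(3,4)]) (use assms in \<open>auto simp: less_two_iff\<close>)

lemma pair_comp:
  assumes "f \<in> Hom C c X" "g \<in> Hom C c Y" "h \<in> Hom C d c"
  shows "tuple C [X, Y] c [f, g] \<cdot> h = tuple C [X, Y] d [f \<cdot> h, g \<cdot> h]"
proof -
  have O: "X \<in> Obj C" "Y \<in> Obj C" using assms by (auto dest: Hom_Obj)
  have H: "f \<cdot> h \<in> Hom C d X" "g \<cdot> h \<in> Hom C d Y" using assms by (auto intro: Comp_Hom)
  note t = pair_Hom[OF assms(1,2)]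
  show ?thesis
    using Comp_assoc[OF assms(3) t proj2_Hom(1)[OF O], symmetric]
      Comp_assoc[OF assms(3) t proj2_Hom(2)[OF O], symmetric]
    by (intro pair_ext[OF O Comp_Hom[OF assms(3) t] pair_Hom[OF H]])
      (simp_all add: pair_proj[OF H] pair_proj[OF assms(1,2)])
qed

lemma pair_projs:
  assumes "X \<in> Obj C" "Y \<in> Obj C"
  shows "tuple C [X, Y] (prod_ob C [X, Y]) [projs C [X, Y] ! 0, projs C [X, Y] ! Suc 0] = Ident C (prod_ob C [X, Y])"
proof -
  note p = proj2_Hom[OF assms]
  have I: "Ident C (prod_ob C [X, Y]) \<in> Hom C (prod_ob C [X, Y]) (prod_ob C [X, Y])"
    using p by (auto intro: Ident_Hom dest: Hom_Obj)
  show ?thesis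
    by (rule pair_ext[OF assms pair_Hom[OF p] I])
      (simp_all only: pair_proj[OF p] Comp_Ident_right[OF p(1)] Comp_Ident_right[OF p(2)])
qed

lemma terminal_Hom: "c \<in> Obj C \<Longrightarrow> tuple C [] c [] \<in> Hom C c (prod_ob C [])"
  using tuple_unique(1)[OF _ cone0I] by auto

lemma terminal_ext: "\<lbrakk>f \<in> Hom C c (prod_ob C []); g \<in> Hom C c (prod_ob C [])\<rbrakk> \<Longrightarrow> f = g"
  by (rule product_ext[OF chosen_is_product]) auto

end

section \<open>Commutative monoid objects through generalized elements\<close>

context fp_category
begin

lemma gmult_Hom:
  assumes "m \<in> Hom C (prod_ob C [X, X]) X" "f \<in> Hom C c X" "g \<in> Hom C c X"
  shows "gmult C X m c f g \<in> Hom C c X"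
  unfolding gmult_def using assms by (auto intro: Comp_Hom pair_Hom)

text \<open>Naturality in the stage \<open>c\<close>, one half of the Yoneda correspondence between
  multiplications on \<open>X\<close> and operations on its generalized elements.\<close>

lemma gmult_comp:
  assumes "m \<in> Hom C (prod_ob C [X, X]) X" "f \<in> Hom C c X" "g \<in> Hom C c X" "h \<in> Hom C d c"
  shows "gmult C X m c f g \<cdot> h = gmult C X m d (f \<cdot> h) (g \<cdot> h)"
  unfolding gmult_def
  using Comp_assoc[OF assms(4) pair_Hom[OF assms(2,3)] assms(1)] pair_comp[OF assms(2,3,4)] by simp

lemma gunit_Hom:
  assumes "e \<in> Hom C (prod_ob C []) X" "c \<in> Obj C"
  shows "gunit C e c \<in> Hom C c X"
  unfolding gunit_def using assms by (auto intro: Comp_Hom terminal_Hom)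

lemma gunit_comp:
  assumes "e \<in> Hom C (prod_ob C []) X" "h \<in> Hom C d c"
  shows "gunit C e c \<cdot> h = gunit C e d"
proof -
  have O: "c \<in> Obj C" "d \<in> Obj C" using assms by (auto dest: Hom_Obj)
  have "tuple C [] c [] \<cdot> h = tuple C [] d []"
    using O assms by (intro terminal_ext) (auto intro: Comp_Hom terminal_Hom)
  then show ?thesis
    unfolding gunit_def using Comp_assoc[OF assms(2) terminal_Hom[OF O(1)] assms(1)] by simp
qed

text \<open>The projections are the generic pair of elements: their tuple is the identity.\<close>

lemma gmult_projs:
  assumes "m \<in> Hom C (prod_ob C [X, X]) X"
  shows "gmult C X m (prod_ob C [X, X]) (projs C [X, X] ! 0) (projs C [X, X] ! Suc 0) = m"
  unfolding gmult_def using pair_projs[of X X] Comp_Ident_right[OF assms] Hom_Obj[OF assms] by simp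

lemma gunit_terminal:
  assumes "e \<in> Hom C (prod_ob C []) X"
  shows "gunit C e (prod_ob C []) = e"
proof -
  have "prod_ob C [] \<in> Obj C" using assms by (auto dest: Hom_Obj)
  then have "tuple C [] (prod_ob C []) [] = Ident C (prod_ob C [])"
    by (intro terminal_ext) (auto intro: terminal_Hom Ident_Hom)
  then show ?thesis unfolding gunit_def using Comp_Ident_right[OF assms] by simp
qed

text \<open>The axioms of \<open>comm_monoid_object\<close> are the laws at particular elements,
  namely projections, identity and unit; the right unit law is the left one read through
  commutativity.\<close>

lemma comm_monoid_objectI:
  assumes "X \<in> Obj C" "m \<in> Hom C (prod_ob C [X, X]) X" "e \<in> Hom C (prod_ob C []) X"
    and "\<And>c f g h. \<lbrakk>f \<in> Hom C c X; g \<in> Hom C c X; h \<in> Hom C c X\<rbrakk> \<Longrightarrow>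
      gmult C X m c (gmult C X m c f g) h = gmult C X m c f (gmult C X m c g h)"
    and comm: "\<And>c f g. \<lbrakk>f \<in> Hom C c X; g \<in> Hom C c X\<rbrakk> \<Longrightarrow> gmult C X m c f g = gmult C X m c g f"
    and unit: "\<And>c f. f \<in> Hom C c X \<Longrightarrow> gmult C X m c (gunit C e c) f = f"
  shows "comm_monoid_object C X m e"
proof -
  have I: "Ident C X \<in> Hom C X X" using assms by (auto intro: Ident_Hom)
  have "gmult C X m X (Ident C X) (gunit C e X) = Ident C X"
    using comm[OF I gunit_Hom[OF assms(3,1)]] unit[OF I] by simp
  then show ?thesis
    unfolding comm_monoid_object_def Let_def
    using assms I proj2_Hom proj3_Hom by (simp add: numeral_2_eq_2)
qed

text \<open>The laws at the projections, or at the identity for the unit, are the universal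
  instances. Composing with the tuple of the given elements, or with the single element itself,
  moves them to any stage.\<close>

lemma comm_monoid_objectD:
  assumes M: "comm_monoid_object C X m e"
  shows "X \<in> Obj C" and "m \<in> Hom C (prod_ob C [X, X]) X" and "e \<in> Hom C (prod_ob C []) X"
    and "\<And>c f g h. \<lbrakk>f \<in> Hom C c X; g \<in> Hom C c X; h \<in> Hom C c X\<rbrakk> \<Longrightarrow>
      gmult C X m c (gmult C X m c f g) h = gmult C X m c f (gmult C X m c g h)"
    and "\<And>c f g. \<lbrakk>f \<in> Hom C c X; g \<in> Hom C c X\<rbrakk> \<Longrightarrow> gmult C X m c f g = gmult C X m c g f"
    and "\<And>c f. f \<in> Hom C c X \<Longrightarrow> gmult C X m c (gunit C e c) f = f"
    and "\<And>c f. f \<in> Hom C c X \<Longrightarrow> gmult C X m c f (gunit C e c) = f"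
proof -
  show X: "X \<in> Obj C" and m: "m \<in> Hom C (prod_ob C [X, X]) X" and e: "e \<in> Hom C (prod_ob C []) X"
    using M by (auto simp: comm_monoid_object_def)
  note p2 = proj2_Hom[OF X X] and p3 = proj3_Hom[OF X X X]
  show comm: "gmult C X m c f g = gmult C X m c g f" if fg: "f \<in> Hom C c X" "g \<in> Hom C c X" for c f g
  proof -
    have "gmult C X m (prod_ob C [X, X]) (projs C [X, X] ! 0) (projs C [X, X] ! Suc 0) =
        gmult C X m (prod_ob C [X, X]) (projs C [X, X] ! Suc 0) (projs C [X, X] ! 0)"
      using M by (simp add: comm_monoid_object_def Let_def)
    then show ?thesis
      using gmult_comp[OF m p2 pair_Hom[OF fg]] gmult_comp[OF m p2(2,1) pair_Hom[OF fg]]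
      by (simp add: pair_proj[OF fg])
  qed
  show "gmult C X m c (gmult C X m c f g) h = gmult C X m c f (gmult C X m c g h)"
    if fgh: "f \<in> Hom C c X" "g \<in> Hom C c X" "h \<in> Hom C c X" for c f g h
  proof -
    let ?P = "prod_ob C [X, X, X]" and ?p = "projs C [X, X, X]"
    let ?t = "tuple C [X, X, X] c [f, g, h]"
    have t: "?t \<in> Hom C c ?P" "?p ! 0 \<cdot> ?t = f" "?p ! Suc 0 \<cdot> ?t = g" "?p ! Suc (Suc 0) \<cdot> ?t = h"
      using tuple_unique[OF _ cone3I[OF fgh]] X
        tuple_unique(2)[OF _ cone3I[OF fgh], of 0]
        tuple_unique(2)[OF _ cone3I[OF fgh], of 1]
        tuple_unique(2)[OF _ cone3I[OF fgh], of 2] by (auto simp: numeral_2_eq_2)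
    have "gmult C X m ?P (gmult C X m ?P (?p ! 0) (?p ! Suc 0)) (?p ! Suc (Suc 0)) =
        gmult C X m ?P (?p ! 0) (gmult C X m ?P (?p ! Suc 0) (?p ! Suc (Suc 0)))"
      using M by (simp add: comm_monoid_object_def Let_def numeral_2_eq_2)
    then show ?thesis
      using gmult_comp[OF m gmult_Hom[OF m p3(1,2)] p3(3) t(1)]
        gmult_comp[OF m p3(1) gmult_Hom[OF m p3(2,3)] t(1)]
      by (simp add: gmult_comp[OF m p3(1,2) t(1)] gmult_comp[OF m p3(2,3) t(1)] t)
  qed
  show unit: "gmult C X m c (gunit C e c) f = f" if f: "f \<in> Hom C c X" for c f
  proof -
    have "gmult C X m X (gunit C e X) (Ident C X) = Ident C X"
      using M by (simp add: comm_monoid_object_def)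
    then show ?thesis
      using gmult_comp[OF m gunit_Hom[OF e X] Ident_Hom[OF X] f] gunit_comp[OF e f] Comp_Ident_left[OF f]
      by simp
  qed
  show "gmult C X m c f (gunit C e c) = f" if f: "f \<in> Hom C c X" for c f
    using comm[OF f gunit_Hom[OF e]] unit[OF f] Hom_Obj[OF f] by simp
qed

text \<open>Yoneda for operations: composing with a tuple takes the value at the projections to the
  value at its components. Multiplications can thus be built by describing them on elements.\<close>

lemma gmult_representable:
  assumes "X \<in> Obj C"
    and op: "\<And>c f g. \<lbrakk>f \<in> Hom C c X; g \<in> Hom C c X\<rbrakk> \<Longrightarrow> op c f g \<in> Hom C c X"
    and nat: "\<And>c d f g h. \<lbrakk>f \<in> Hom C c X; g \<in> Hom C c X; h \<in> Hom C d c\<rbrakk> \<Longrightarrow>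
      op c f g \<cdot> h = op d (f \<cdot> h) (g \<cdot> h)"
    and m: "m = op (prod_ob C [X, X]) (projs C [X, X] ! 0) (projs C [X, X] ! Suc 0)"
  shows "m \<in> Hom C (prod_ob C [X, X]) X"
    and "\<And>c f g. \<lbrakk>f \<in> Hom C c X; g \<in> Hom C c X\<rbrakk> \<Longrightarrow> gmult C X m c f g = op c f g"
  unfolding m gmult_def
  using nat[OF proj2_Hom pair_Hom] op[OF proj2_Hom] assms(1) by (auto simp: pair_proj)

lemma gunit_representable:
  assumes z: "\<And>c. c \<in> Obj C \<Longrightarrow> z c \<in> Hom C c X"
    and nat: "\<And>c d h. h \<in> Hom C d c \<Longrightarrow> z c \<cdot> h = z d"
    and e: "e = z (prod_ob C [])"
  shows "e \<in> Hom C (prod_ob C []) X"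
    and "\<And>c. c \<in> Obj C \<Longrightarrow> gunit C e c = z c"
  unfolding e gunit_def using nat[OF terminal_Hom] z is_productD(2)[OF chosen_is_product, of "[]"] by auto

text \<open>The projections of any product diagram are generic: the chosen ones factor through them
  by the mediating arrow. The freedom in \<open>P\<close> matters because a functor sends chosen
  products to products that need not be chosen.\<close>

lemma mult_eqI:
  assumes "m \<in> Hom C (prod_ob C [X, X]) X" "m' \<in> Hom C (prod_ob C [X, X]) X"
    and P: "is_product C [X, X] P qs"
    and eq: "gmult C X m P (qs ! 0) (qs ! Suc 0) = gmult C X m' P (qs ! 0) (qs ! Suc 0)"
  shows "m = m'"
proof -
  have X: "X \<in> Obj C" using assms by (auto dest: Hom_Obj)
  note p = proj2_Hom[OF X X]
  note q = is_productD(4)[OF P, of 0, simplified] is_productD(4)[OF P, of "Suc 0", simplified]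
  let ?h = "mediator C P qs (prod_ob C [X, X]) [projs C [X, X] ! 0, projs C [X, X] ! Suc 0]"
  note h = mediator_unique[OF P cone2I[OF p]]
  have "m = gmult C X m P (qs ! 0) (qs ! Suc 0) \<cdot> ?h"
    using gmult_comp[OF assms(1) q h(1)] h(2)[of 0] h(2)[of 1] gmult_projs[OF assms(1)] by simp
  also have "\<dots> = m'"
    using gmult_comp[OF assms(2) q h(1)] h(2)[of 0] h(2)[of 1] gmult_projs[OF assms(2)] eq by simp
  finally show ?thesis .
qed

lemma unit_eqI:
  assumes "e \<in> Hom C (prod_ob C []) X" "e' \<in> Hom C (prod_ob C []) X"
    and P: "is_product C [] T qs"
    and eq: "gunit C e T = gunit C e' T"
  shows "e = e'"
proof -
  have "prod_ob C [] \<in> Obj C" using assms by (auto dest: Hom_Obj)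
  note h = mediator_unique(1)[OF P cone0I[OF this]]
  show ?thesis
    using gunit_comp[OF assms(1) h] gunit_comp[OF assms(2) h]
    unfolding eq gunit_terminal[OF assms(1)] gunit_terminal[OF assms(2)] by (rule trans[OF sym])
qed

lemma monoid_morphismI:
  assumes "m \<in> Hom C (prod_ob C [X, X]) X" "e \<in> Hom C (prod_ob C []) X"
    "n \<in> Hom C (prod_ob C [Y, Y]) Y" "u \<in> Hom C (prod_ob C []) Y"
    and f: "f \<in> Hom C X Y"
    and "\<And>c a b. \<lbrakk>a \<in> Hom C c X; b \<in> Hom C c X\<rbrakk> \<Longrightarrow>
      f \<cdot> gmult C X m c a b = gmult C Y n c (f \<cdot> a) (f \<cdot> b)"
    and "\<And>c. c \<in> Obj C \<Longrightarrow> f \<cdot> gunit C e c = gunit C u c"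
  shows "monoid_morphism C X m e Y n u f"
proof -
  have "X \<in> Obj C" "prod_ob C [] \<in> Obj C" using assms(1,2) by (auto dest: Hom_Obj)
  then show ?thesis
    unfolding monoid_morphism_def
    using f assms(6)[OF proj2_Hom[of X X]] assms(7)[of "prod_ob C []"]
      gmult_projs[OF assms(1)] gunit_terminal[OF assms(2)] gunit_terminal[OF assms(4)]
    by simp
qed

text \<open>Compatibility with \<open>m\<close> is compatibility at the projections; composing with
  the tuple of \<open>a\<close> and \<open>b\<close> moves it to any stage.\<close>

lemma monoid_morphismD:
  assumes "monoid_morphism C X m e Y n u f"
    and m: "m \<in> Hom C (prod_ob C [X, X]) X" "e \<in> Hom C (prod_ob C []) X"
    "n \<in> Hom C (prod_ob C [Y, Y]) Y" "u \<in> Hom C (prod_ob C []) Y"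
  shows "f \<in> Hom C X Y"
    and "\<And>c a b. \<lbrakk>a \<in> Hom C c X; b \<in> Hom C c X\<rbrakk> \<Longrightarrow>
      f \<cdot> gmult C X m c a b = gmult C Y n c (f \<cdot> a) (f \<cdot> b)"
    and "\<And>c. c \<in> Obj C \<Longrightarrow> f \<cdot> gunit C e c = gunit C u c"
proof -
  show f: "f \<in> Hom C X Y" using assms by (auto simp: monoid_morphism_def)
  have X: "X \<in> Obj C" using f by (auto dest: Hom_Obj)
  let ?p = "projs C [X, X] ! 0" and ?q = "projs C [X, X] ! Suc 0"
  note p = proj2_Hom[OF X X]
  show "f \<cdot> gmult C X m c a b = gmult C Y n c (f \<cdot> a) (f \<cdot> b)"
    if ab: "a \<in> Hom C c X" "b \<in> Hom C c X" for c a b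
  proof -
    let ?t = "tuple C [X, X] c [a, b]"
    note t = pair_Hom[OF ab]
    have "f \<cdot> gmult C X m c a b = (f \<cdot> m) \<cdot> ?t"
      unfolding gmult_def using Comp_assoc[OF t m(1) f] by simp
    also have "f \<cdot> m = gmult C Y n (prod_ob C [X, X]) (f \<cdot> ?p) (f \<cdot> ?q)"
      using assms(1) by (simp add: monoid_morphism_def)
    also have "\<dots> \<cdot> ?t = gmult C Y n c ((f \<cdot> ?p) \<cdot> ?t) ((f \<cdot> ?q) \<cdot> ?t)"
      using p f t by (intro gmult_comp[OF m(3)]) (auto intro: Comp_Hom)
    finally show ?thesis
      using Comp_assoc[OF t p(1) f] Comp_assoc[OF t p(2) f] by (simp add: pair_proj[OF ab])
  qed
  show "f \<cdot> gunit C e c = gunit C u c" if c: "c \<in> Obj C" for c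
    using Comp_assoc[OF terminal_Hom[OF c] m(2) f] assms(1) by (simp add: gunit_def monoid_morphism_def)
qed

end

section \<open>The category of commutative monoids is additive\<close>

abbreviation gm :: "'a ucat \<Rightarrow> 'a univ \<Rightarrow> 'a univ \<Rightarrow> 'a univ \<Rightarrow> 'a univ \<Rightarrow> 'a univ" where
  "gm C M c f g \<equiv> gmult C (t1 M) (t2 M) c f g"

abbreviation gu :: "'a ucat \<Rightarrow> 'a univ \<Rightarrow> 'a univ \<Rightarrow> 'a univ" where
  "gu C M c \<equiv> gunit C (t3 M) c"

text \<open>Monoid morphisms in terms of elements, the form used in the computations below;
  \<open>monoid_morphism_iff_mhom\<close> gives the agreement with \<open>monoid_morphism\<close>
  between monoid objects.\<close>

definition mhom :: "'a ucat \<Rightarrow> 'a univ \<Rightarrow> 'a univ \<Rightarrow> 'a univ set" where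
  "mhom C M N = {f \<in> Hom C (t1 M) (t1 N).
     (\<forall>c a b. a \<in> Hom C c (t1 M) \<longrightarrow> b \<in> Hom C c (t1 M) \<longrightarrow>
        f \<cdot>\<^bsub>C\<^esub> gm C M c a b = gm C N c (f \<cdot>\<^bsub>C\<^esub> a) (f \<cdot>\<^bsub>C\<^esub> b)) \<and>
     (\<forall>c\<in>Obj C. f \<cdot>\<^bsub>C\<^esub> gu C M c = gu C N c)}"

lemma cMon_sel [simp]:
  "Obj (cMon C) = cMon_Obj C" "Arr (cMon C) = cMon_Arr C"
  "Ident (cMon C) = (\<lambda>M\<in>cMon_Obj C. Triple M (Ident C (t1 M)) M)"
  "Dom (cMon C) = (\<lambda>f\<in>cMon_Arr C. t1 f)" "Cod (cMon C) = (\<lambda>f\<in>cMon_Arr C. t3 f)"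
  by (simp_all add: cMon_def)

text \<open>Both carrier types are the universe, since \<open>cMon\<close> encodes its objects and
  arrows there as triples.\<close>

locale ufp_category = fp_category C for C :: "'a ucat" (structure)
begin

lemma cMon_ObjD: "M \<in> cMon_Obj C \<Longrightarrow> comm_monoid_object C (t1 M) (t2 M) (t3 M)"
  by (auto simp: cMon_Obj_def)

lemma cMon_ObjI: "comm_monoid_object C X m e \<Longrightarrow> Triple X m e \<in> cMon_Obj C"
  by (auto simp: cMon_Obj_def)

lemma cMon_Obj_eqI:
  "\<lbrakk>M \<in> cMon_Obj C; N \<in> cMon_Obj C; t1 M = t1 N; t2 M = t2 N; t3 M = t3 N\<rbrakk> \<Longrightarrow> M = N"
  by (auto simp: cMon_Obj_def)

lemmas cMon_Obj_laws = comm_monoid_objectD[OF cMon_ObjD]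

lemma gm_Hom: "\<lbrakk>M \<in> cMon_Obj C; f \<in> Hom C c (t1 M); g \<in> Hom C c (t1 M)\<rbrakk> \<Longrightarrow> gm C M c f g \<in> Hom C c (t1 M)"
  by (rule gmult_Hom[OF cMon_Obj_laws(2)])

lemma gu_Hom: "\<lbrakk>M \<in> cMon_Obj C; c \<in> Obj C\<rbrakk> \<Longrightarrow> gu C M c \<in> Hom C c (t1 M)"
  by (rule gunit_Hom[OF cMon_Obj_laws(3)])

lemma gm_comp: "\<lbrakk>M \<in> cMon_Obj C; f \<in> Hom C c (t1 M); g \<in> Hom C c (t1 M); h \<in> Hom C d c\<rbrakk> \<Longrightarrow>
    gm C M c f g \<cdot> h = gm C M d (f \<cdot> h) (g \<cdot> h)"
  by (rule gmult_comp[OF cMon_Obj_laws(2)])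

lemma gu_comp: "\<lbrakk>M \<in> cMon_Obj C; h \<in> Hom C d c\<rbrakk> \<Longrightarrow> gu C M c \<cdot> h = gu C M d"
  by (rule gunit_comp[OF cMon_Obj_laws(3)])

text \<open>Middle four interchange, the point where commutativity makes pointwise sums of morphisms
  into morphisms.\<close>

lemma gm_interchange:
  assumes "M \<in> cMon_Obj C" "a \<in> Hom C c (t1 M)" "b \<in> Hom C c (t1 M)" "x \<in> Hom C c (t1 M)" "y \<in> Hom C c (t1 M)"
  shows "gm C M c (gm C M c a b) (gm C M c x y) = gm C M c (gm C M c a x) (gm C M c b y)"
proof -
  note M = assms(1) and H = gm_Hom[OF assms(1)] and assoc = cMon_Obj_laws(4)[OF assms(1)] and comm = cMon_Obj_laws(5)[OF assms(1)]
  have "gm C M c (gm C M c a b) (gm C M c x y) = gm C M c a (gm C M c (gm C M c b x) y)"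
    using assms by (simp add: assoc H)
  also have "\<dots> = gm C M c a (gm C M c (gm C M c x b) y)"
    using comm[OF assms(3,4)] by simp
  also have "\<dots> = gm C M c (gm C M c a x) (gm C M c b y)"
    using assms by (simp add: assoc H)
  finally show ?thesis .
qed

lemma mhomD:
  assumes "f \<in> mhom C M N"
  shows "f \<in> Hom C (t1 M) (t1 N)"
    and "\<And>c a b. \<lbrakk>a \<in> Hom C c (t1 M); b \<in> Hom C c (t1 M)\<rbrakk> \<Longrightarrow>
      f \<cdot> gm C M c a b = gm C N c (f \<cdot> a) (f \<cdot> b)"
    and "\<And>c. c \<in> Obj C \<Longrightarrow> f \<cdot> gu C M c = gu C N c"
  using assms by (auto simp: mhom_def)

lemma mhomI:
  assumes "f \<in> Hom C (t1 M) (t1 N)"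
    and "\<And>c a b. \<lbrakk>a \<in> Hom C c (t1 M); b \<in> Hom C c (t1 M)\<rbrakk> \<Longrightarrow>
      f \<cdot> gm C M c a b = gm C N c (f \<cdot> a) (f \<cdot> b)"
    and "\<And>c. c \<in> Obj C \<Longrightarrow> f \<cdot> gu C M c = gu C N c"
  shows "f \<in> mhom C M N"
  using assms by (auto simp: mhom_def)

lemma monoid_morphism_iff_mhom:
  assumes "M \<in> cMon_Obj C" "N \<in> cMon_Obj C"
  shows "monoid_morphism C (t1 M) (t2 M) (t3 M) (t1 N) (t2 N) (t3 N) f \<longleftrightarrow> f \<in> mhom C M N"
proof
  note m = cMon_Obj_laws(2,3)[OF assms(1)] cMon_Obj_laws(2,3)[OF assms(2)]
  show "f \<in> mhom C M N" if "monoid_morphism C (t1 M) (t2 M) (t3 M) (t1 N) (t2 N) (t3 N) f"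
    using monoid_morphismD[OF that m] by (intro mhomI)
  show "monoid_morphism C (t1 M) (t2 M) (t3 M) (t1 N) (t2 N) (t3 N) f" if "f \<in> mhom C M N"
    using mhomD[OF that] by (intro monoid_morphismI[OF m])
qed

lemma cMon_Arr_iff:
  "F \<in> cMon_Arr C \<longleftrightarrow> t1 F \<in> cMon_Obj C \<and> t3 F \<in> cMon_Obj C \<and> t2 F \<in> mhom C (t1 F) (t3 F) \<and>
     F = Triple (t1 F) (t2 F) (t3 F)"
  unfolding cMon_Arr_def by (cases F) (auto simp: monoid_morphism_iff_mhom)

lemma Hom_cMon: "F \<in> Hom (cMon C) M N \<longleftrightarrow>
    M \<in> cMon_Obj C \<and> N \<in> cMon_Obj C \<and> t2 F \<in> mhom C M N \<and> F = Triple M (t2 F) N"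
  unfolding Hom_def by (cases F) (auto simp: cMon_Arr_iff)

lemma Hom_cMonI: "\<lbrakk>M \<in> cMon_Obj C; N \<in> cMon_Obj C; f \<in> mhom C M N\<rbrakk> \<Longrightarrow> Triple M f N \<in> Hom (cMon C) M N"
  by (simp add: Hom_cMon)

lemma Hom_cMonE:
  assumes "F \<in> Hom (cMon C) M N"
  obtains f where "F = Triple M f N" "f \<in> mhom C M N" "M \<in> cMon_Obj C" "N \<in> cMon_Obj C"
    "f \<in> Hom C (t1 M) (t1 N)"
  using assms mhomD(1) unfolding Hom_cMon by metis

lemma cMon_Comp:
  "\<lbrakk>F \<in> Hom (cMon C) L M; G \<in> Hom (cMon C) M N\<rbrakk> \<Longrightarrow> G \<cdot>\<^bsub>cMon C\<^esub> F = Triple L (t2 G \<cdot> t2 F) N"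
  unfolding Hom_def by (auto simp: cMon_def)

lemma cMon_HAdd:
  assumes "F \<in> Hom (cMon C) M N" "G \<in> Hom (cMon C) M N"
  shows "HAdd (cMon C) F G = Triple M (gm C N (t1 M) (t2 F) (t2 G)) N"
  using assms by (elim Hom_cMonE) (simp add: cMon_def cMon_Arr_iff)

lemma cMon_HZero: "\<lbrakk>M \<in> cMon_Obj C; N \<in> cMon_Obj C\<rbrakk> \<Longrightarrow> HZero (cMon C) M N = Triple M (gu C N (t1 M)) N"
  by (simp add: cMon_def)

section \<open>Closure properties of monoid morphisms, and the preadditive category they
  form\<close>

lemma mhom_Ident:
  assumes "M \<in> cMon_Obj C"
  shows "Ident C (t1 M) \<in> mhom C M M"
proof (rule mhomI)
  show "Ident C (t1 M) \<in> Hom C (t1 M) (t1 M)" using cMon_Obj_laws(1)[OF assms] by (rule Ident_Hom)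
qed (simp_all add: Comp_Ident_left[OF gm_Hom[OF assms]] Comp_Ident_left[OF gu_Hom[OF assms]] Comp_Ident_left)

lemma mhom_Comp:
  assumes f: "f \<in> mhom C L M" and g: "g \<in> mhom C M N" and "L \<in> cMon_Obj C"
  shows "g \<cdot> f \<in> mhom C L N"
proof (rule mhomI)
  note F = mhomD[OF f] and G = mhomD[OF g]
  show "g \<cdot> f \<in> Hom C (t1 L) (t1 N)" by (rule Comp_Hom[OF F(1) G(1)])
  show "(g \<cdot> f) \<cdot> gm C L c a b = gm C N c ((g \<cdot> f) \<cdot> a) ((g \<cdot> f) \<cdot> b)"
    if ab: "a \<in> Hom C c (t1 L)" "b \<in> Hom C c (t1 L)" for c a b
    using ab Comp_Hom[OF _ F(1)] Comp_assoc[OF _ F(1) G(1)] gm_Hom[OF assms(3) ab]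
    by (simp add: F(2) G(2))
  show "(g \<cdot> f) \<cdot> gu C L c = gu C N c" if "c \<in> Obj C" for c
    using Comp_assoc[OF gu_Hom[OF assms(3) that] F(1) G(1)] F(3)[OF that] G(3)[OF that] by simp
qed

lemma mhom_gm:
  assumes f: "f \<in> mhom C M N" and g: "g \<in> mhom C M N" and M: "M \<in> cMon_Obj C" and N: "N \<in> cMon_Obj C"
  shows "gm C N (t1 M) f g \<in> mhom C M N"
proof (rule mhomI)
  note F = mhomD[OF f] and G = mhomD[OF g]
  note comp = gm_comp[OF N F(1) G(1)]
  show "gm C N (t1 M) f g \<in> Hom C (t1 M) (t1 N)" using F(1) G(1) by (rule gm_Hom[OF N])
  show "gm C N (t1 M) f g \<cdot> gm C M c a b = gm C N c (gm C N (t1 M) f g \<cdot> a) (gm C N (t1 M) f g \<cdot> b)"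
    if ab: "a \<in> Hom C c (t1 M)" "b \<in> Hom C c (t1 M)" for c a b
    using ab gm_Hom[OF M ab] Comp_Hom[OF _ F(1)] Comp_Hom[OF _ G(1)]
    by (simp add: comp F(2) G(2) gm_interchange[OF N])
  show "gm C N (t1 M) f g \<cdot> gu C M c = gu C N c" if c: "c \<in> Obj C" for c
    using comp[OF gu_Hom[OF M c]] F(3)[OF c] G(3)[OF c] cMon_Obj_laws(6)[OF N gu_Hom[OF N c]] by simp
qed

lemma mhom_gu:
  assumes M: "M \<in> cMon_Obj C" and N: "N \<in> cMon_Obj C"
  shows "gu C N (t1 M) \<in> mhom C M N"
proof (rule mhomI)
  show "gu C N (t1 M) \<in> Hom C (t1 M) (t1 N)" using cMon_Obj_laws(1)[OF M] by (rule gu_Hom[OF N])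
  show "gu C N (t1 M) \<cdot> gm C M c a b = gm C N c (gu C N (t1 M) \<cdot> a) (gu C N (t1 M) \<cdot> b)"
    if ab: "a \<in> Hom C c (t1 M)" "b \<in> Hom C c (t1 M)" for c a b
    using ab gm_Hom[OF M ab] gu_Hom[OF N] Hom_Obj(1)[OF ab(1)] by (simp add: gu_comp[OF N] cMon_Obj_laws(6)[OF N])
  show "gu C N (t1 M) \<cdot> gu C M c = gu C N c" if c: "c \<in> Obj C" for c
    using gu_comp[OF N gu_Hom[OF M c]] .
qed

lemma category_cMon: "category (cMon C)"
proof
  show "Dom (cMon C) f \<in> Obj (cMon C)" "Cod (cMon C) f \<in> Obj (cMon C)" if "f \<in> Arr (cMon C)" for f
    using that by (auto simp: cMon_Arr_iff)
  show "Ident (cMon C) a \<in> Hom (cMon C) a a" if "a \<in> Obj (cMon C)" for a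
    using that by (simp add: Hom_cMonI mhom_Ident)
  show "g \<cdot>\<^bsub>cMon C\<^esub> f \<in> Hom (cMon C) a c" if "f \<in> Hom (cMon C) a b" "g \<in> Hom (cMon C) b c" for f g a b c
    using that unfolding cMon_Comp[OF that] by (intro Hom_cMonI) (auto simp: Hom_cMon intro: mhom_Comp)
  note comp = this
  show "(h \<cdot>\<^bsub>cMon C\<^esub> g) \<cdot>\<^bsub>cMon C\<^esub> f = h \<cdot>\<^bsub>cMon C\<^esub> (g \<cdot>\<^bsub>cMon C\<^esub> f)"
    if fgh: "f \<in> Hom (cMon C) a b" "g \<in> Hom (cMon C) b c" "h \<in> Hom (cMon C) c d" for f g h a b c d
  proof -
    have "t2 f \<in> Hom C (t1 a) (t1 b)" "t2 g \<in> Hom C (t1 b) (t1 c)" "t2 h \<in> Hom C (t1 c) (t1 d)"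
      using fgh by (auto elim!: Hom_cMonE)
    then show ?thesis
      unfolding cMon_Comp[OF fgh(1) comp[OF fgh(2,3)]] cMon_Comp[OF comp[OF fgh(1,2)] fgh(3)]
      unfolding cMon_Comp[OF fgh(1,2)] cMon_Comp[OF fgh(2,3)]
      by (simp add: Comp_assoc)
  qed
  show "Ident (cMon C) b \<cdot>\<^bsub>cMon C\<^esub> f = f" if "f \<in> Hom (cMon C) a b" for f a b
  proof -
    have "Ident (cMon C) b \<in> Hom (cMon C) b b" using that by (simp add: Hom_cMon mhom_Ident)
    from cMon_Comp[OF that this] that show ?thesis by (auto elim!: Hom_cMonE simp: Comp_Ident_left)
  qed
  show "f \<cdot>\<^bsub>cMon C\<^esub> Ident (cMon C) a = f" if "f \<in> Hom (cMon C) a b" for f a b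
  proof -
    have "Ident (cMon C) a \<in> Hom (cMon C) a a" using that by (simp add: Hom_cMon mhom_Ident)
    from cMon_Comp[OF this that] that show ?thesis by (auto elim!: Hom_cMonE simp: Comp_Ident_right)
  qed
  show "g \<cdot>\<^bsub>cMon C\<^esub> f = undefined"
    if "\<not> (f \<in> Arr (cMon C) \<and> g \<in> Arr (cMon C) \<and> Cod (cMon C) f = Dom (cMon C) g)" for f g
    using that by (auto simp: cMon_def)
qed simp_all

sublocale cM: category "cMon C" by (rule category_cMon)

text \<open>Hom sets inherit the laws of the target monoid at the stage \<open>t1 a\<close>. Sums
  are compatible with precomposition by naturality in the stage (\<open>gm_comp\<close>), and with
  postcomposition because arrows are monoid morphisms.\<close>

lemma preadditive_cMon: "preadditive_category (cMon C)"
proof (intro preadditive_category.intro preadditive_category_axioms.intro category_cMon)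
  have add: "HAdd (cMon C) f g \<in> Hom (cMon C) a b" if "f \<in> Hom (cMon C) a b" "g \<in> Hom (cMon C) a b" for f g a b
    using that by (simp add: cMon_HAdd) (auto elim!: Hom_cMonE intro!: Hom_cMonI mhom_gm)
  have zero: "HZero (cMon C) a b \<in> Hom (cMon C) a b" if "a \<in> cMon_Obj C" "b \<in> cMon_Obj C" for a b
    using that by (simp add: cMon_HZero Hom_cMonI mhom_gu)
  show "comm_monoid (hom_monoid (cMon C) a b)" if "a \<in> Obj (cMon C)" "b \<in> Obj (cMon C)" for a b
  proof (rule comm_monoidI)
    have ab: "a \<in> cMon_Obj C" "b \<in> cMon_Obj C" using that by simp_all
    fix x y z
    assume "x \<in> carrier (hom_monoid (cMon C) a b)" "y \<in> carrier (hom_monoid (cMon C) a b)"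
    then have x: "x \<in> Hom (cMon C) a b" and y: "y \<in> Hom (cMon C) a b" by (simp_all add: hom_monoid_def)
    show "x \<otimes>\<^bsub>hom_monoid (cMon C) a b\<^esub> y \<in> carrier (hom_monoid (cMon C) a b)"
      using add x y by (simp add: hom_monoid_def)
    show "x \<otimes>\<^bsub>hom_monoid (cMon C) a b\<^esub> y = y \<otimes>\<^bsub>hom_monoid (cMon C) a b\<^esub> x"
      using x y by (auto simp: hom_monoid_def cMon_HAdd elim!: Hom_cMonE intro: cMon_Obj_laws(5))
    assume "z \<in> carrier (hom_monoid (cMon C) a b)"
    then have z: "z \<in> Hom (cMon C) a b" by (simp add: hom_monoid_def)
    show "x \<otimes>\<^bsub>hom_monoid (cMon C) a b\<^esub> y \<otimes>\<^bsub>hom_monoid (cMon C) a b\<^esub> z =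
        x \<otimes>\<^bsub>hom_monoid (cMon C) a b\<^esub> (y \<otimes>\<^bsub>hom_monoid (cMon C) a b\<^esub> z)"
      using x y z add[OF x y] add[OF y z]
      by (auto simp: hom_monoid_def cMon_HAdd[of _ a b] elim!: Hom_cMonE intro: cMon_Obj_laws(4))
  next
    have ab: "a \<in> cMon_Obj C" "b \<in> cMon_Obj C" using that by simp_all
    show "\<one>\<^bsub>hom_monoid (cMon C) a b\<^esub> \<in> carrier (hom_monoid (cMon C) a b)"
      using zero[OF ab] by (simp add: hom_monoid_def)
    fix x assume "x \<in> carrier (hom_monoid (cMon C) a b)"
    then have x: "x \<in> Hom (cMon C) a b" by (simp add: hom_monoid_def)
    show "\<one>\<^bsub>hom_monoid (cMon C) a b\<^esub> \<otimes>\<^bsub>hom_monoid (cMon C) a b\<^esub> x = x"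
      using x cMon_HAdd[OF zero[OF ab] x] by (auto simp: hom_monoid_def cMon_HZero elim!: Hom_cMonE intro: cMon_Obj_laws(6))
  qed
  show "HAdd (cMon C) g h \<cdot>\<^bsub>cMon C\<^esub> f = HAdd (cMon C) (g \<cdot>\<^bsub>cMon C\<^esub> f) (h \<cdot>\<^bsub>cMon C\<^esub> f)"
    if "f \<in> Hom (cMon C) a b" "g \<in> Hom (cMon C) b c" "h \<in> Hom (cMon C) b c" for f g h a b c
    using that add[OF that(2,3)] cM.Comp_Hom[OF that(1,2)] cM.Comp_Hom[OF that(1,3)]
    by (simp add: cMon_Comp[of _ a b] cMon_HAdd[of _ b c] cMon_HAdd[of _ a c])
      (auto elim!: Hom_cMonE intro: gm_comp)
  show "h \<cdot>\<^bsub>cMon C\<^esub> HAdd (cMon C) f g = HAdd (cMon C) (h \<cdot>\<^bsub>cMon C\<^esub> f) (h \<cdot>\<^bsub>cMon C\<^esub> g)"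
    if "f \<in> Hom (cMon C) a b" "g \<in> Hom (cMon C) a b" "h \<in> Hom (cMon C) b c" for f g h a b c
    using that add[OF that(1,2)] cM.Comp_Hom[OF that(1,3)] cM.Comp_Hom[OF that(2,3)]
    by (simp add: cMon_Comp[of _ a b] cMon_HAdd[of _ a b] cMon_HAdd[of _ a c])
      (auto elim!: Hom_cMonE intro: mhomD(2))
  show "HZero (cMon C) b c \<cdot>\<^bsub>cMon C\<^esub> f = HZero (cMon C) a c"
    if "f \<in> Hom (cMon C) a b" "c \<in> Obj (cMon C)" for f a b c
    using that cMon_Comp[OF that(1) zero, of c] by (simp add: Hom_cMon cMon_HZero gu_comp[OF _ mhomD(1)])
  show "h \<cdot>\<^bsub>cMon C\<^esub> HZero (cMon C) a b = HZero (cMon C) a c"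
    if "a \<in> Obj (cMon C)" "h \<in> Hom (cMon C) b c" for h a b c
    using that cMon_Comp[OF zero that(2), of a] by (simp add: Hom_cMon cMon_HZero mhomD(3)[OF _ cMon_Obj_laws(1)])
  show "HAdd (cMon C) f g = undefined"
    if "\<not> (f \<in> Arr (cMon C) \<and> g \<in> Arr (cMon C) \<and> Dom (cMon C) f = Dom (cMon C) g \<and> Cod (cMon C) f = Cod (cMon C) g)"
    for f g
    using that by (auto simp: cMon_def)
  show "HZero (cMon C) a b = undefined" if "\<not> (a \<in> Obj (cMon C) \<and> b \<in> Obj (cMon C))" for a b
    using that by (auto simp: cMon_def)
qed

text \<open>The product of the carriers receives the componentwise structure. The conclusion also
  records the underlying product diagram in \<open>C\<close>, which is what makes the forgetful
  functor preserve products.\<close>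

lemma cMon_product:
  assumes Ms: "set Ms \<subseteq> cMon_Obj C"
  obtains N Qs where "is_product (cMon C) Ms N Qs" "is_product C (map t1 Ms) (t1 N) (map t2 Qs)"
proof -
  let ?xs = "map t1 Ms" and ?n = "length Ms"
  let ?P = "prod_ob C ?xs" and ?q = "projs C ?xs"
  have xs: "set ?xs \<subseteq> Obj C" using Ms cMon_Obj_laws(1) by auto
  have Mi: "Ms ! i \<in> cMon_Obj C" if "i < ?n" for i using that Ms by auto
  note P = chosen_is_product[OF xs]
  have q: "?q ! i \<in> Hom C ?P (t1 (Ms ! i))" if "i < ?n" for i using is_productD(4)[OF P, of i] that by simp
  have lq: "length ?q = ?n" using is_productD(3)[OF P] by simp
  note qc = Comp_Hom[OF _ q]
  \<comment> \<open>Componentwise operations at every stage; their naturality \<open>opc\<close>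
    makes them representable.\<close>
  define op where "op c f g = tuple C ?xs c (map (\<lambda>i. gm C (Ms ! i) c (?q ! i \<cdot> f) (?q ! i \<cdot> g)) [0..<?n])" for c f g
  define z where "z c = tuple C ?xs c (map (\<lambda>M. gu C M c) Ms)" for c
  have op: "op c f g \<in> Hom C c ?P \<and> (\<forall>i<?n. ?q ! i \<cdot> op c f g = gm C (Ms ! i) c (?q ! i \<cdot> f) (?q ! i \<cdot> g))"
    if "f \<in> Hom C c ?P" "g \<in> Hom C c ?P" for c f g
  proof -
    have "is_cone C ?xs c (map (\<lambda>i. gm C (Ms ! i) c (?q ! i \<cdot> f) (?q ! i \<cdot> g)) [0..<?n])"
      using that by (auto simp: is_cone_def Hom_Obj intro!: gm_Hom Mi qc)
    from tuple_unique[OF xs this] show ?thesis unfolding op_def by simp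
  qed
  have z: "z c \<in> Hom C c ?P \<and> (\<forall>i<?n. ?q ! i \<cdot> z c = gu C (Ms ! i) c)" if "c \<in> Obj C" for c
  proof -
    have "is_cone C ?xs c (map (\<lambda>M. gu C M c) Ms)"
      using that by (auto simp: is_cone_def intro!: gu_Hom Mi)
    from tuple_unique[OF xs this] show ?thesis unfolding z_def by simp
  qed
  have ext: "h = h'" if "h \<in> Hom C c ?P" "h' \<in> Hom C c ?P" "\<And>i. i < ?n \<Longrightarrow> ?q ! i \<cdot> h = ?q ! i \<cdot> h'" for h h' c
    using product_ext[OF P that(1,2)] that(3) by simp
  have opc: "op c f g \<cdot> h = op d (f \<cdot> h) (g \<cdot> h)"
    if fgh: "f \<in> Hom C c ?P" "g \<in> Hom C c ?P" "h \<in> Hom C d c" for c d f g h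
  proof (rule ext)
    note o1 = op[OF fgh(1,2)] and o2 = op[OF Comp_Hom[OF fgh(3,1)] Comp_Hom[OF fgh(3,2)]]
    show "op c f g \<cdot> h \<in> Hom C d ?P" "op d (f \<cdot> h) (g \<cdot> h) \<in> Hom C d ?P" using o1 o2 fgh by (auto intro: Comp_Hom)
    fix i assume i: "i < ?n"
    have "?q ! i \<cdot> (op c f g \<cdot> h) = gm C (Ms ! i) c (?q ! i \<cdot> f) (?q ! i \<cdot> g) \<cdot> h"
      using Comp_assoc[OF fgh(3) _ q[OF i], of "op c f g"] o1 i by simp
    also have "\<dots> = gm C (Ms ! i) d ((?q ! i \<cdot> f) \<cdot> h) ((?q ! i \<cdot> g) \<cdot> h)"
      using fgh i by (intro gm_comp Mi qc)
    also have "\<dots> = ?q ! i \<cdot> op d (f \<cdot> h) (g \<cdot> h)"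
      using o2 i by (simp add: Comp_assoc[OF fgh(3,1) q[OF i]] Comp_assoc[OF fgh(3,2) q[OF i]])
    finally show "?q ! i \<cdot> (op c f g \<cdot> h) = ?q ! i \<cdot> op d (f \<cdot> h) (g \<cdot> h)" .
  qed
  have zc: "z c \<cdot> h = z d" if h: "h \<in> Hom C d c" for c d h
  proof (rule ext)
    note O = Hom_Obj[OF h]
    show "z c \<cdot> h \<in> Hom C d ?P" "z d \<in> Hom C d ?P" using z O h by (auto intro: Comp_Hom)
    fix i assume i: "i < ?n"
    show "?q ! i \<cdot> (z c \<cdot> h) = ?q ! i \<cdot> z d"
      using Comp_assoc[OF h _ q[OF i], of "z c"] z[OF O(1)] z[OF O(2)] i gu_comp[OF Mi[OF i] h] by simp
  qed
  have PO: "?P \<in> Obj C" using is_productD(2)[OF P] .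
  \<comment> \<open>By Yoneda the structure arrows are the values at the generic pair of elements
    and at the chosen terminal object.\<close>
  define N where "N = Triple ?P (op (prod_ob C [?P, ?P]) (projs C [?P, ?P] ! 0) (projs C [?P, ?P] ! Suc 0)) (z (prod_ob C []))"
  have tN: "t1 N = ?P" by (simp add: N_def)
  have op': "op c f g \<in> Hom C c ?P" if "f \<in> Hom C c ?P" "g \<in> Hom C c ?P" for c f g using op[OF that] by simp
  have z': "z c \<in> Hom C c ?P" if "c \<in> Obj C" for c using z[OF that] by simp
  note m = gmult_representable[of ?P op, OF PO op' opc, where m = "t2 N"]
  have m1: "t2 N \<in> Hom C (prod_ob C [?P, ?P]) ?P" by (rule m(1)) (auto simp: N_def)
  have m2: "gm C N c f g = op c f g" if "f \<in> Hom C c ?P" "g \<in> Hom C c ?P" for c f g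
    unfolding tN by (rule m(2)) (use that in \<open>auto simp: N_def\<close>)
  note u = gunit_representable[of z ?P, OF z' zc, where e = "t3 N"]
  have u1: "t3 N \<in> Hom C (prod_ob C []) ?P" by (rule u(1)) (auto simp: N_def)
  have u2: "gu C N c = z c" if "c \<in> Obj C" for c by (rule u(2)) (use that in \<open>auto simp: N_def\<close>)
  have "comm_monoid_object C (t1 N) (t2 N) (t3 N)"
  proof (rule comm_monoid_objectI, unfold tN)
    show "gmult C ?P (t2 N) c (gmult C ?P (t2 N) c f g) h = gmult C ?P (t2 N) c f (gmult C ?P (t2 N) c g h)"
      if fgh: "f \<in> Hom C c ?P" "g \<in> Hom C c ?P" "h \<in> Hom C c ?P" for c f g h
    proof -
      note fg = op'[OF fgh(1,2)] and gh = op'[OF fgh(2,3)]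
      have "op c (op c f g) h = op c f (op c g h)"
      proof (rule ext[OF op'[OF fg fgh(3)] op'[OF fgh(1) gh]])
        fix i assume i: "i < ?n"
        show "?q ! i \<cdot> op c (op c f g) h = ?q ! i \<cdot> op c f (op c g h)"
          using op[OF fgh(1,2)] op[OF fgh(2,3)] op[OF fg fgh(3)] op[OF fgh(1) gh] i
            cMon_Obj_laws(4)[OF Mi[OF i] qc[OF fgh(1) i] qc[OF fgh(2) i] qc[OF fgh(3) i]] by simp
      qed
      then show ?thesis using m2 fgh fg gh by (simp add: tN)
    qed
    show "gmult C ?P (t2 N) c f g = gmult C ?P (t2 N) c g f"
      if fg: "f \<in> Hom C c ?P" "g \<in> Hom C c ?P" for c f g
    proof -
      have "op c f g = op c g f"
      proof (rule ext[OF op'[OF fg] op'[OF fg(2,1)]])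
        fix i assume i: "i < ?n"
        show "?q ! i \<cdot> op c f g = ?q ! i \<cdot> op c g f"
          using op[OF fg] op[OF fg(2,1)] i cMon_Obj_laws(5)[OF Mi[OF i] qc[OF fg(1) i] qc[OF fg(2) i]] by simp
      qed
      then show ?thesis using m2 fg by (simp add: tN)
    qed
    show "gmult C ?P (t2 N) c (gunit C (t3 N) c) f = f" if f: "f \<in> Hom C c ?P" for c f
    proof -
      note cO = Hom_Obj(1)[OF f]
      have "op c (z c) f = f"
      proof (rule ext[OF op'[OF z'[OF cO] f] f])
        fix i assume i: "i < ?n"
        show "?q ! i \<cdot> op c (z c) f = ?q ! i \<cdot> f"
          using op[OF z'[OF cO] f] z[OF cO] i cMon_Obj_laws(6)[OF Mi[OF i] qc[OF f i]] by simp
      qed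
      then show ?thesis using m2 f z'[OF cO] u2[OF cO] by (simp add: tN)
    qed
  qed (use PO m1 u1 in auto)
  then have N: "N \<in> cMon_Obj C" using cMon_ObjI by (simp add: N_def)
  \<comment> \<open>The projections are morphisms by the characterizing equations of
    \<open>op\<close> and \<open>z\<close>.\<close>
  have qm: "?q ! i \<in> mhom C N (Ms ! i)" if i: "i < ?n" for i
    by (rule mhomI) (use q[OF i] op z i m2 u2 in \<open>simp_all add: tN\<close>)
  define Qs where "Qs = map (\<lambda>i. Triple N (?q ! i) (Ms ! i)) [0..<?n]"
  have Qs: "Qs ! i \<in> Hom (cMon C) N (Ms ! i)" if i: "i < ?n" for i
    using i qm[OF i] Mi[OF i] N by (simp add: Qs_def Hom_cMonI)
  have "is_product (cMon C) Ms N Qs"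
  proof (rule cM.is_productI)
    show "set Ms \<subseteq> Obj (cMon C)" "N \<in> Obj (cMon C)" "length Qs = length Ms"
      "\<And>i. i < length Ms \<Longrightarrow> Qs ! i \<in> Hom (cMon C) N (Ms ! i)"
      using Ms N Qs by (simp_all add: Qs_def)
    fix c
    show "\<exists>h. h \<in> Hom (cMon C) c N \<and> (\<forall>i<length Ms. Qs ! i \<cdot>\<^bsub>cMon C\<^esub> h = fs ! i)"
      if "is_cone (cMon C) Ms c fs" for fs
    proof -
      have c: "c \<in> cMon_Obj C" and l: "length fs = ?n"
        and fs: "\<And>i. i < ?n \<Longrightarrow> fs ! i \<in> Hom (cMon C) c (Ms ! i)"
        using that by (auto simp: is_cone_def)
      have fs': "t2 (fs ! i) \<in> mhom C c (Ms ! i)" "fs ! i = Triple c (t2 (fs ! i)) (Ms ! i)" if "i < ?n" for i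
        using fs[OF that] unfolding Hom_cMon by auto
      note fsH = mhomD[OF fs'(1)]
      have "is_cone C ?xs (t1 c) (map t2 fs)" using cMon_Obj_laws(1)[OF c] l fsH(1) by (simp add: is_cone_def)
      note tu = tuple_unique[OF xs this]
      let ?h = "tuple C ?xs (t1 c) (map t2 fs)"
      have h: "?h \<in> Hom C (t1 c) ?P" and qh: "\<And>i. i < ?n \<Longrightarrow> ?q ! i \<cdot> ?h = t2 (fs ! i)"
        using tu l by simp_all
      have qha: "?q ! i \<cdot> (?h \<cdot> a) = t2 (fs ! i) \<cdot> a" if "i < ?n" "a \<in> Hom C d (t1 c)" for i a d
        using Comp_assoc[OF that(2) h q[OF that(1)]] qh[OF that(1)] by simp
      \<comment> \<open>After each projection the two sides agree because every
        \<open>fs ! i\<close> is a monoid morphism.\<close>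
      have hm: "?h \<in> mhom C c N"
      proof (rule mhomI)
        show "?h \<in> Hom C (t1 c) (t1 N)" using h tN by simp
        show "?h \<cdot> gm C c d a b = gm C N d (?h \<cdot> a) (?h \<cdot> b)"
          if ab: "a \<in> Hom C d (t1 c)" "b \<in> Hom C d (t1 c)" for d a b
        proof -
          note ha = Comp_Hom[OF ab(1) h] and hb = Comp_Hom[OF ab(2) h]
          have "?h \<cdot> gm C c d a b = op d (?h \<cdot> a) (?h \<cdot> b)"
          proof (rule ext)
            show "?h \<cdot> gm C c d a b \<in> Hom C d ?P" using gm_Hom[OF c ab] h by (rule Comp_Hom)
            show "op d (?h \<cdot> a) (?h \<cdot> b) \<in> Hom C d ?P" using ha hb by (rule op')
            fix i assume i: "i < ?n"
            show "?q ! i \<cdot> (?h \<cdot> gm C c d a b) = ?q ! i \<cdot> op d (?h \<cdot> a) (?h \<cdot> b)"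
              using op[OF ha hb] i qha[OF i] ab gm_Hom[OF c ab] fsH(2)[OF i ab] by simp
          qed
          then show ?thesis using m2[OF ha hb] by simp
        qed
        show "?h \<cdot> gu C c d = gu C N d" if d: "d \<in> Obj C" for d
        proof -
          have "?h \<cdot> gu C c d = z d"
          proof (rule ext)
            show "?h \<cdot> gu C c d \<in> Hom C d ?P" using gu_Hom[OF c d] h by (rule Comp_Hom)
            show "z d \<in> Hom C d ?P" using d by (rule z')
            fix i assume i: "i < ?n"
            show "?q ! i \<cdot> (?h \<cdot> gu C c d) = ?q ! i \<cdot> z d"
              using z[OF d] i qha[OF i gu_Hom[OF c d]] fsH(3)[OF i d] by simp
          qed
          then show ?thesis using u2[OF d] by simp
        qed
      qed
      have hH: "Triple c ?h N \<in> Hom (cMon C) c N" using c N hm by (rule Hom_cMonI)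
      moreover have "Qs ! i \<cdot>\<^bsub>cMon C\<^esub> Triple c ?h N = fs ! i" if "i < ?n" for i
        unfolding cMon_Comp[OF hH Qs[OF that]]
        using that qh[OF that] fs'(2)[OF that] by (simp add: Qs_def)
      ultimately show ?thesis by (intro exI[of _ "Triple c ?h N"]) simp
    qed
    show "h = h'" if h: "h \<in> Hom (cMon C) c N" "h' \<in> Hom (cMon C) c N"
      and eq: "\<And>i. i < length Ms \<Longrightarrow> Qs ! i \<cdot>\<^bsub>cMon C\<^esub> h = Qs ! i \<cdot>\<^bsub>cMon C\<^esub> h'" for h h'
    proof -
      \<comment> \<open>An arrow with given ends is determined by its underlying arrow.\<close>
      have "t2 h = t2 h'"
      proof (rule ext)
        show "t2 h \<in> Hom C (t1 c) ?P" "t2 h' \<in> Hom C (t1 c) ?P"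
          using h tN by (auto elim!: Hom_cMonE)
        fix i assume i: "i < ?n"
        show "?q ! i \<cdot> t2 h = ?q ! i \<cdot> t2 h'"
          using eq[OF i] unfolding cMon_Comp[OF h(1) Qs[OF i]] cMon_Comp[OF h(2) Qs[OF i]]
          using i by (simp add: Qs_def)
      qed
      then show ?thesis using h by (auto simp: Hom_cMon)
    qed
  qed
  moreover have "map t2 Qs = ?q" using lq by (intro nth_equalityI) (simp_all add: Qs_def)
  ultimately show ?thesis using P by (intro that[of N Qs]) (simp_all add: tN)
qed

lemma additive_cMon: "additive_category (cMon C)"
proof -
  interpret pre: preadditive_category "cMon C" by (rule preadditive_cMon)
  show ?thesis
  proof
    show "\<exists>p ps. is_product (cMon C) xs p ps" if "set xs \<subseteq> Obj (cMon C)" for xs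
      using that cMon_product[of xs] unfolding cMon_sel by metis
  qed
qed

end

section \<open>Functors\<close>

lemma func_eqI:
  fixes F G :: "('o, 'm, 'p, 'n) func"
  assumes "omap F \<in> extensional X" "omap G \<in> extensional X" "amap F \<in> extensional Y" "amap G \<in> extensional Y"
    and "\<And>a. a \<in> X \<Longrightarrow> omap F a = omap G a" "\<And>f. f \<in> Y \<Longrightarrow> amap F f = amap G f"
  shows "F = G"
proof -
  have "omap F = omap G" "amap F = amap G" using assms extensionalityI by blast+
  then show ?thesis by (cases F, cases G) simp
qed

text \<open>Functors are undefined off their source, so agreement on the source is equality. The
  functor identities below are equations in this strict sense.\<close>

lemma functor_eqI:
  assumes "cat_functor A B F" "cat_functor A B' G"
    and "\<And>a. a \<in> Obj A \<Longrightarrow> omap F a = omap G a"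
    and "\<And>f a b. f \<in> Hom A a b \<Longrightarrow> amap F f = amap G f"
  shows "F = G"
proof (rule func_eqI)
  show "omap F \<in> extensional (Obj A)" "amap F \<in> extensional (Arr A)"
    using assms(1) by (auto simp: cat_functor_def cat_functor_axioms_def)
  show "omap G \<in> extensional (Obj A)" "amap G \<in> extensional (Arr A)"
    using assms(2) by (auto simp: cat_functor_def cat_functor_axioms_def)
  show "amap F f = amap G f" if "f \<in> Arr A" for f
    using assms(4)[of f "Dom A f" "Cod A f"] that by (simp add: Hom_def)
qed fact

lemma (in category) id_func_apply:
  "a \<in> Obj C \<Longrightarrow> omap (id_func C) a = a" "f \<in> Hom C a b \<Longrightarrow> amap (id_func C) f = f"
  by (simp_all add: id_func_def Hom_def)

lemma (in category) comp_func_apply: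
  "a \<in> Obj C \<Longrightarrow> omap (comp_func C G F) a = omap G (omap F a)"
  "f \<in> Hom C a b \<Longrightarrow> amap (comp_func C G F) f = amap G (amap F f)"
  by (simp_all add: comp_func_def Hom_def)

lemma id_func_functor:
  assumes "category A"
  shows "cat_functor A A (id_func A)"
proof -
  interpret category A by fact
  show ?thesis
  proof
    show "amap (id_func A) (g \<cdot>\<^bsub>A\<^esub> f) = amap (id_func A) g \<cdot>\<^bsub>A\<^esub> amap (id_func A) f"
      if "f \<in> Hom A a b" "g \<in> Hom A b c" for f g a b c
      using that Comp_Hom[OF that] HomD by (simp add: id_func_def)
  qed (use Ident_Hom Dom_Obj Cod_Obj in \<open>auto simp: id_func_def Hom_def\<close>)
qed

lemma comp_func_functor:
  assumes "cat_functor A B F" "cat_functor B C G"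
  shows "cat_functor A C (comp_func A G F)"
proof -
  interpret F: cat_functor A B F by fact
  interpret G: cat_functor B C G by fact
  have arr: "f \<in> Arr A" if "f \<in> Hom A a b" for f a b using F.src.HomD[OF that] by simp
  show ?thesis
  proof
    show "omap (comp_func A G F) a \<in> Obj C" if "a \<in> Obj A" for a
      using that by (simp add: comp_func_def F.omap_Obj G.omap_Obj)
    show "amap (comp_func A G F) f \<in> Hom C (omap (comp_func A G F) a) (omap (comp_func A G F) b)"
      if "f \<in> Hom A a b" for f a b
      using that F.src.HomD[OF that] by (simp add: comp_func_def F.amap_Hom G.amap_Hom)
    show "amap (comp_func A G F) (Ident A a) = Ident C (omap (comp_func A G F) a)" if "a \<in> Obj A" for a
      using that arr[OF F.src.Ident_Hom[OF that]] by (simp add: comp_func_def F.amap_Ident G.amap_Ident F.omap_Obj)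
    show "amap (comp_func A G F) (g \<cdot>\<^bsub>A\<^esub> f) = amap (comp_func A G F) g \<cdot>\<^bsub>C\<^esub> amap (comp_func A G F) f"
      if fg: "f \<in> Hom A a b" "g \<in> Hom A b c" for f g a b c
      using arr[OF fg(1)] arr[OF fg(2)] arr[OF F.src.Comp_Hom[OF fg]]
        F.amap_Comp[OF fg] G.amap_Comp[OF F.amap_Hom[OF fg(1)] F.amap_Hom[OF fg(2)]]
      by (simp add: comp_func_def)
  qed (simp_all add: comp_func_def)
qed

section \<open>Preservation of products\<close>

context cat_functor
begin

lemma amap_pair_is_iso:
  assumes "i \<in> Hom A a b" "j \<in> Hom A b a" "j \<cdot>\<^bsub>A\<^esub> i = Ident A a"
  shows "amap F j \<cdot>\<^bsub>B\<^esub> amap F i = Ident B (omap F a)"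
  using amap_Comp[OF assms(1,2)] amap_Ident[of a] src.Hom_Obj(1)[OF assms(1)] assms(3) by simp

text \<open>Two product diagrams of one family differ by an isomorphism over the projections.
  \<open>F\<close> preserves it, and along it the product property of the image of \<open>q\<close>
  passes to the image of \<open>p\<close>.\<close>

lemma preserves_product_if_preserves_some:
  assumes P: "is_product A xs p ps" and Q: "is_product A xs q qs"
    and FQ: "is_product B (map (omap F) xs) (omap F q) (map (amap F) qs)"
  shows "is_product B (map (omap F) xs) (omap F p) (map (amap F) ps)"
proof -
  obtain i j where ij: "i \<in> Hom A p q" "j \<in> Hom A q p" "j \<cdot>\<^bsub>A\<^esub> i = Ident A p" "i \<cdot>\<^bsub>A\<^esub> j = Ident A q"
    and k: "\<And>k. k < length xs \<Longrightarrow> qs ! k \<cdot>\<^bsub>A\<^esub> i = ps ! k"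
    using src.product_iso[OF P Q] by blast
  show ?thesis
  proof (rule tgt.is_product_iso[OF FQ amap_Hom[OF ij(1)] amap_Hom[OF ij(2)]
        amap_pair_is_iso[OF ij(1,2,3)] amap_pair_is_iso[OF ij(2,1,4)]])
    note l = src.is_productD(3)[OF P] src.is_productD(3)[OF Q]
    show "length (map (amap F) ps) = length (map (omap F) xs)" using l by simp
    fix n assume "n < length (map (omap F) xs)"
    then show "map (amap F) ps ! n = map (amap F) qs ! n \<cdot>\<^bsub>B\<^esub> amap F i"
      using l k[of n] amap_Comp[OF ij(1) src.is_productD(4)[OF Q, of n]] by simp
  qed
qed

lemma fp_functorI:
  assumes "fp_category A" "fp_category B"
    and ex: "\<And>xs. set xs \<subseteq> Obj A \<Longrightarrow> \<exists>q qs. is_product A xs q qs \<and>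
      is_product B (map (omap F) xs) (omap F q) (map (amap F) qs)"
  shows "fp_functor A B F"
proof -
  interpret fA: fp_category A by fact
  interpret fB: fp_category B by fact
  show ?thesis
    using ex src.is_productD(1) preserves_product_if_preserves_some
    by unfold_locales blast
qed

end

lemma id_func_fp_functor:
  assumes "fp_category A"
  shows "fp_functor A A (id_func A)"
proof -
  interpret fp_category A by fact
  interpret cat_functor A A "id_func A" by (rule id_func_functor) unfold_locales
  show ?thesis
  proof
    fix xs p ps assume P: "is_product A xs p ps"
    note D = is_productD[OF P]
    have "map (omap (id_func A)) xs = xs" using D(1) by (intro map_idI) (auto simp: id_func_def)
    moreover have "map (amap (id_func A)) ps = ps"
    proof (rule map_idI)
      fix q assume "q \<in> set ps"
      then show "amap (id_func A) q = q" using D(3,4) HomD by (auto simp: id_func_def in_set_conv_nth)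
    qed
    ultimately show "is_product A (map (omap (id_func A)) xs) (omap (id_func A) p) (map (amap (id_func A)) ps)"
      using P D(2) by (simp add: id_func_def)
  qed
qed

lemma comp_func_fp_functor:
  assumes "fp_functor A B F" "fp_functor B C G"
  shows "fp_functor A C (comp_func A G F)"
proof -
  interpret F: fp_functor A B F by fact
  interpret G: fp_functor B C G by fact
  interpret cat_functor A C "comp_func A G F"
    by (rule comp_func_functor) unfold_locales
  show ?thesis
  proof
    fix xs p ps assume P: "is_product A xs p ps"
    note D = F.src.is_productD[OF P]
    have "map (omap (comp_func A G F)) xs = map (omap G) (map (omap F) xs)"
      using D(1) by (auto simp: comp_func_def)
    moreover have "map (amap (comp_func A G F)) ps = map (amap G) (map (amap F) ps)"
    proof -
      have "amap (comp_func A G F) q = amap G (amap F q)" if "q \<in> set ps" for q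
        using that D(3,4) F.src.HomD by (auto simp: comp_func_def in_set_conv_nth)
      then show ?thesis by simp
    qed
    moreover have "omap (comp_func A G F) p = omap G (omap F p)" using D(2) by (simp add: comp_func_def)
    ultimately show "is_product C (map (omap (comp_func A G F)) xs) (omap (comp_func A G F) p)
        (map (amap (comp_func A G F)) ps)"
      using G.preserves_products[OF F.preserves_products[OF P]] by (simp only:)
  qed
qed

section \<open>Identities and composites of additive functors\<close>

lemma (in preadditive_category) HAdd_Hom:
  assumes "f \<in> Hom A a b" "g \<in> Hom A a b"
  shows "HAdd A f g \<in> Hom A a b"
  using comm_monoid.axioms(1)[OF hom_comm_monoid[of a b]] monoid.m_closed[of "hom_monoid A a b" f g]
    assms Hom_Obj[OF assms(1)] by (simp add: hom_monoid_def)

lemma (in preadditive_category) HZero_Hom: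
  assumes "a \<in> Obj A" "b \<in> Obj A"
  shows "HZero A a b \<in> Hom A a b"
  using comm_monoid.axioms(1)[OF hom_comm_monoid[OF assms]] monoid.one_closed[of "hom_monoid A a b"]
  by (simp add: hom_monoid_def)

lemma id_func_additive:
  assumes "preadditive_category A"
  shows "additive_functor A A (id_func A)"
proof -
  interpret preadditive_category A by fact
  interpret cat_functor A A "id_func A" by (rule id_func_functor) unfold_locales
  note add = HAdd_Hom and zero = HZero_Hom
  show ?thesis
  proof
    show "amap (id_func A) (HAdd A f g) = HAdd A (amap (id_func A) f) (amap (id_func A) g)"
      if "f \<in> Hom A a b" "g \<in> Hom A a b" for f g a b
      using add[OF that] that by (simp add: id_func_def Hom_def)
    show "amap (id_func A) (HZero A a b) = HZero A (omap (id_func A) a) (omap (id_func A) b)"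
      if "a \<in> Obj A" "b \<in> Obj A" for a b
      using zero[OF that] that by (simp add: id_func_def Hom_def)
  qed
qed

lemma comp_func_additive:
  assumes "additive_functor A B F" "additive_functor B C G"
  shows "additive_functor A C (comp_func A G F)"
proof -
  interpret F: additive_functor A B F by fact
  interpret G: additive_functor B C G by fact
  interpret cat_functor A C "comp_func A G F"
    by (rule comp_func_functor) unfold_locales
  show ?thesis
  proof
    show "amap (comp_func A G F) (HAdd A f g) = HAdd C (amap (comp_func A G F) f) (amap (comp_func A G F) g)"
      if fg: "f \<in> Hom A a b" "g \<in> Hom A a b" for f g a b
      using F.src.HAdd_Hom[OF fg] fg F.amap_HAdd[OF fg] G.amap_HAdd[OF F.amap_Hom[OF fg(1)] F.amap_Hom[OF fg(2)]]
      by (simp add: comp_func_def Hom_def)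
    show "amap (comp_func A G F) (HZero A a b) = HZero C (omap (comp_func A G F) a) (omap (comp_func A G F) b)"
      if ab: "a \<in> Obj A" "b \<in> Obj A" for a b
      using F.src.HZero_Hom[OF ab] ab F.amap_HZero[OF ab] G.amap_HZero[OF F.omap_Obj[OF ab(1)] F.omap_Obj[OF ab(2)]]
      by (simp add: comp_func_def Hom_def)
  qed
qed

section \<open>Transport of commutative monoids along product preserving functors\<close>

locale ufp_functor = fp_functor C D F for C D :: "'a ucat" and F :: "'a ufunc"
begin

sublocale S: ufp_category C by unfold_locales
sublocale T: ufp_category D by unfold_locales

abbreviation transport :: "'a univ \<Rightarrow> 'a univ" where "transport \<equiv> omap (cMon_map C D F)"

lemma transport_eq:
  assumes "M \<in> cMon_Obj C"
  shows "transport M = Triple (omap F (t1 M)) (amap F (t2 M) \<cdot>\<^bsub>D\<^esub> comparison_inv C D F [t1 M, t1 M])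
    (amap F (t3 M) \<cdot>\<^bsub>D\<^esub> comparison_inv C D F [])"
  using assms by (simp add: cMon_map_def Let_def)

lemma t1_transport: "M \<in> cMon_Obj C \<Longrightarrow> t1 (transport M) = omap F (t1 M)"
  by (simp add: transport_eq)

lemma image_product: "set xs \<subseteq> Obj C \<Longrightarrow>
    is_product D (map (omap F) xs) (omap F (prod_ob C xs)) (map (amap F) (projs C xs))"
  by (rule preserves_products[OF src.chosen_is_product])

lemma comparison_inv:
  assumes "set xs \<subseteq> Obj C"
  shows "comparison_inv C D F xs \<in> Hom D (prod_ob D (map (omap F) xs)) (omap F (prod_ob C xs))"
    and "\<And>i. i < length xs \<Longrightarrow> amap F (projs C xs ! i) \<cdot>\<^bsub>D\<^esub> comparison_inv C D F xs = projs D (map (omap F) xs) ! i"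
proof -
  have "set (map (omap F) xs) \<subseteq> Obj D" using assms omap_Obj by auto
  then have "is_cone D (map (omap F) xs) (prod_ob D (map (omap F) xs)) (projs D (map (omap F) xs))"
    using tgt.chosen_is_product by (auto simp: is_product_def)
  note m = tgt.mediator_unique[OF image_product[OF assms] this]
  show "comparison_inv C D F xs \<in> Hom D (prod_ob D (map (omap F) xs)) (omap F (prod_ob C xs))"
    unfolding comparison_inv_def by (rule m)
  show "amap F (projs C xs ! i) \<cdot>\<^bsub>D\<^esub> comparison_inv C D F xs = projs D (map (omap F) xs) ! i"
    if "i < length xs" for i
    using m(2)[of i] that src.is_productD(3)[OF src.chosen_is_product[OF assms]] by (simp add: comparison_inv_def)
qed

lemma transport_ops:
  assumes M: "M \<in> cMon_Obj C"
  shows "t2 (transport M) \<in> Hom D (prod_ob D [t1 (transport M), t1 (transport M)]) (t1 (transport M))"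
    and "t3 (transport M) \<in> Hom D (prod_ob D []) (t1 (transport M))"
proof -
  note m = S.cMon_Obj_laws(1-3)[OF M]
  have X: "set [t1 M, t1 M] \<subseteq> Obj C" "set [] \<subseteq> Obj C" using m by auto
  show "t2 (transport M) \<in> Hom D (prod_ob D [t1 (transport M), t1 (transport M)]) (t1 (transport M))"
    using tgt.Comp_Hom[OF comparison_inv(1)[OF X(1)] amap_Hom[OF m(2)]] by (simp add: transport_eq[OF M])
  show "t3 (transport M) \<in> Hom D (prod_ob D []) (t1 (transport M))"
    using tgt.Comp_Hom[OF comparison_inv(1)[OF X(2)] amap_Hom[OF m(3)]] by (simp add: transport_eq[OF M])
qed

text \<open>Composition with \<open>comparison_inv\<close> turns the tuple of the images into the
  image of the tuple, so \<open>F\<close> commutes with the operations on elements. Only stages and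
  elements in the image of \<open>F\<close> are covered.\<close>

lemma amap_gm:
  assumes M: "M \<in> cMon_Obj C" and a: "a \<in> Hom C c (t1 M)" and b: "b \<in> Hom C c (t1 M)"
  shows "amap F (gm C M c a b) = gm D (transport M) (omap F c) (amap F a) (amap F b)"
proof -
  let ?X = "t1 M"
  note m = S.cMon_Obj_laws(1-3)[OF M]
  have X: "set [?X, ?X] \<subseteq> Obj C" using m by auto
  note t = src.pair_Hom[OF a b] and q = comparison_inv[OF X, simplified]
  note Fa = amap_Hom[OF a] and Fb = amap_Hom[OF b]
  note T = tgt.pair_Hom[OF Fa Fb]
  note p = src.proj2_Hom[OF m(1) m(1)]
  \<comment> \<open>The images of the projections form a product diagram and hence separate arrows
    into the image of the product.\<close>
  have "comparison_inv C D F [?X, ?X] \<cdot>\<^bsub>D\<^esub> tuple D [omap F ?X, omap F ?X] (omap F c) [amap F a, amap F b] =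
      amap F (tuple C [?X, ?X] c [a, b])"
  proof (rule tgt.product_ext[OF image_product[OF X]])
    show "amap F (tuple C [?X, ?X] c [a, b]) \<in> Hom D (omap F c) (omap F (prod_ob C [?X, ?X]))"
      using t by (rule amap_Hom)
    show "comparison_inv C D F [?X, ?X] \<cdot>\<^bsub>D\<^esub> tuple D [omap F ?X, omap F ?X] (omap F c) [amap F a, amap F b]
        \<in> Hom D (omap F c) (omap F (prod_ob C [?X, ?X]))"
      using T q(1) by (rule tgt.Comp_Hom)
    fix i assume "i < length (map (omap F) [?X, ?X])"
    then have i: "i = 0 \<or> i = Suc 0" by auto
    have l: "length (projs C [?X, ?X]) = 2" using src.is_productD(3)[OF src.chosen_is_product[OF X]] by simp
    have "amap F (projs C [?X, ?X] ! i) \<cdot>\<^bsub>D\<^esub> (comparison_inv C D F [?X, ?X] \<cdot>\<^bsub>D\<^esub>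
        tuple D [omap F ?X, omap F ?X] (omap F c) [amap F a, amap F b]) =
        (amap F (projs C [?X, ?X] ! i) \<cdot>\<^bsub>D\<^esub> comparison_inv C D F [?X, ?X]) \<cdot>\<^bsub>D\<^esub>
        tuple D [omap F ?X, omap F ?X] (omap F c) [amap F a, amap F b]"
      using i tgt.Comp_assoc[OF T q(1) amap_Hom[OF p(1)]] tgt.Comp_assoc[OF T q(1) amap_Hom[OF p(2)]] by auto
    also have "\<dots> = amap F ([a, b] ! i)"
      using i q(2)[of i] tgt.pair_proj[OF Fa Fb] by auto
    also have "\<dots> = amap F (projs C [?X, ?X] ! i) \<cdot>\<^bsub>D\<^esub> amap F (tuple C [?X, ?X] c [a, b])"
      using i amap_Comp[OF t p(1)] amap_Comp[OF t p(2)] src.pair_proj[OF a b] by auto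
    finally show "map (amap F) (projs C [?X, ?X]) ! i \<cdot>\<^bsub>D\<^esub> (comparison_inv C D F [?X, ?X] \<cdot>\<^bsub>D\<^esub>
        tuple D [omap F ?X, omap F ?X] (omap F c) [amap F a, amap F b]) =
        map (amap F) (projs C [?X, ?X]) ! i \<cdot>\<^bsub>D\<^esub> amap F (tuple C [?X, ?X] c [a, b])"
      using l i by auto
  qed
  then show ?thesis
    using tgt.Comp_assoc[OF T q(1) amap_Hom[OF m(2)]] amap_Comp[OF t m(2)] by (simp add: gmult_def transport_eq[OF M])
qed

lemma amap_gu:
  assumes M: "M \<in> cMon_Obj C" and c: "c \<in> Obj C"
  shows "amap F (gu C M c) = gu D (transport M) (omap F c)"
proof -
  have X: "set [] \<subseteq> Obj C" by simp
  note m = S.cMon_Obj_laws(3)[OF M]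
  note t = src.terminal_Hom[OF c] and T = tgt.terminal_Hom[OF omap_Obj[OF c]]
  note q = comparison_inv(1)[OF X, simplified]
  have "comparison_inv C D F [] \<cdot>\<^bsub>D\<^esub> tuple D [] (omap F c) [] = amap F (tuple C [] c [])"
    using image_product[OF X]
    by (intro tgt.terminal_unique[OF _ tgt.Comp_Hom[OF T q] amap_Hom[OF t]]) simp
  then show ?thesis
    using tgt.Comp_assoc[OF T q amap_Hom[OF m]] amap_Comp[OF t m] by (simp add: gunit_def transport_eq[OF M])
qed

text \<open>Reaches the elements that \<open>amap_gm\<close> misses: any pair of elements of
  \<open>omap F X\<close> arises from the images of the projections by composing with one arrow
  \<open>t\<close>.\<close>

lemma mediator_pair:
  assumes "X \<in> Obj C" "f \<in> Hom D c (omap F X)" "g \<in> Hom D c (omap F X)"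
  obtains t where "t \<in> Hom D c (omap F (prod_ob C [X, X]))"
    "amap F (projs C [X, X] ! 0) \<cdot>\<^bsub>D\<^esub> t = f" "amap F (projs C [X, X] ! Suc 0) \<cdot>\<^bsub>D\<^esub> t = g"
proof -
  have X: "set [X, X] \<subseteq> Obj C" using assms by auto
  have l: "length (projs C [X, X]) = 2" using src.is_productD(3)[OF src.chosen_is_product[OF X]] by simp
  have "is_cone D (map (omap F) [X, X]) c [f, g]" using tgt.cone2I[OF assms(2,3)] by simp
  note t = tgt.mediator_unique[OF image_product[OF X] this]
  show thesis using that[OF t(1)] t(2)[of 0] t(2)[of 1] l by simp
qed

text \<open>\<open>amap_gm\<close> transfers associativity and commutativity from the projections in
  \<open>C\<close> to their images in \<open>D\<close>, and every tuple of elements arises from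
  those images by composition.\<close>

lemma transport_Obj:
  assumes M: "M \<in> cMon_Obj C"
  shows "transport M \<in> cMon_Obj D"
proof -
  let ?X = "t1 M"
  note X = S.cMon_Obj_laws(1)[OF M] and FX = t1_transport[OF M]
  note H = tgt.gmult_Hom[OF transport_ops(1)[OF M]] and comp = tgt.gmult_comp[OF transport_ops(1)[OF M]]
  have "comm_monoid_object D (t1 (transport M)) (t2 (transport M)) (t3 (transport M))"
  proof (rule tgt.comm_monoid_objectI)
    show "t1 (transport M) \<in> Obj D" using X omap_Obj FX by simp
    show "t2 (transport M) \<in> Hom D (prod_ob D [t1 (transport M), t1 (transport M)]) (t1 (transport M))"
      "t3 (transport M) \<in> Hom D (prod_ob D []) (t1 (transport M))" using transport_ops[OF M] .
    show "gm D (transport M) c (gm D (transport M) c f g) h = gm D (transport M) c f (gm D (transport M) c g h)"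
      if "f \<in> Hom D c (t1 (transport M))" "g \<in> Hom D c (t1 (transport M))" "h \<in> Hom D c (t1 (transport M))" for c f g h
    proof -
      have fgh: "f \<in> Hom D c (omap F ?X)" "g \<in> Hom D c (omap F ?X)" "h \<in> Hom D c (omap F ?X)"
        using that FX by simp_all
      have X3: "set [?X, ?X, ?X] \<subseteq> Obj C" using X by auto
      let ?P = "prod_ob C [?X, ?X, ?X]" and ?p = "projs C [?X, ?X, ?X]"
      have l: "length ?p = 3" using src.is_productD(3)[OF src.chosen_is_product[OF X3]] by simp
      have "is_cone D (map (omap F) [?X, ?X, ?X]) c [f, g, h]" using tgt.cone3I[OF fgh] by simp
      note t = tgt.mediator_unique[OF image_product[OF X3] this]
      obtain t where t: "t \<in> Hom D c (omap F ?P)"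
        "amap F (?p ! 0) \<cdot>\<^bsub>D\<^esub> t = f" "amap F (?p ! Suc 0) \<cdot>\<^bsub>D\<^esub> t = g" "amap F (?p ! Suc (Suc 0)) \<cdot>\<^bsub>D\<^esub> t = h"
        using t(1) t(2)[of 0] t(2)[of 1] t(2)[of "Suc (Suc 0)"] l by simp
      note p = src.proj3_Hom[OF X X X]
      note Fp = amap_Hom[OF p(1), folded FX] amap_Hom[OF p(2), folded FX] amap_Hom[OF p(3), folded FX]
      have "gm D (transport M) c (gm D (transport M) c f g) h =
          gm D (transport M) (omap F ?P) (gm D (transport M) (omap F ?P) (amap F (?p ! 0)) (amap F (?p ! Suc 0))) (amap F (?p ! Suc (Suc 0))) \<cdot>\<^bsub>D\<^esub> t"
        using comp[OF H[OF Fp(1,2)] Fp(3) t(1)] comp[OF Fp(1,2) t(1)] t(2-4) by simp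
      also have "\<dots> = amap F (gm C M ?P (gm C M ?P (?p ! 0) (?p ! Suc 0)) (?p ! Suc (Suc 0))) \<cdot>\<^bsub>D\<^esub> t"
        using amap_gm[OF M p(1,2)] amap_gm[OF M S.gm_Hom[OF M p(1,2)] p(3)] by simp
      also have "\<dots> = amap F (gm C M ?P (?p ! 0) (gm C M ?P (?p ! Suc 0) (?p ! Suc (Suc 0)))) \<cdot>\<^bsub>D\<^esub> t"
        using S.cMon_Obj_laws(4)[OF M p] by simp
      also have "\<dots> = gm D (transport M) (omap F ?P) (amap F (?p ! 0)) (gm D (transport M) (omap F ?P) (amap F (?p ! Suc 0)) (amap F (?p ! Suc (Suc 0)))) \<cdot>\<^bsub>D\<^esub> t"
        using amap_gm[OF M p(2,3)] amap_gm[OF M p(1) S.gm_Hom[OF M p(2,3)]] by simp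
      also have "\<dots> = gm D (transport M) c f (gm D (transport M) c g h)"
        using comp[OF Fp(1) H[OF Fp(2,3)] t(1)] comp[OF Fp(2,3) t(1)] t(2-4) by simp
      finally show ?thesis .
    qed
    show "gm D (transport M) c f g = gm D (transport M) c g f"
      if "f \<in> Hom D c (t1 (transport M))" "g \<in> Hom D c (t1 (transport M))" for c f g
    proof -
      have fg: "f \<in> Hom D c (omap F ?X)" "g \<in> Hom D c (omap F ?X)" using that FX by simp_all
      let ?P = "prod_ob C [?X, ?X]" and ?p = "projs C [?X, ?X]"
      from mediator_pair[OF X fg] obtain t where t: "t \<in> Hom D c (omap F ?P)"
        "amap F (?p ! 0) \<cdot>\<^bsub>D\<^esub> t = f" "amap F (?p ! Suc 0) \<cdot>\<^bsub>D\<^esub> t = g" .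
      note p = src.proj2_Hom[OF X X]
      note Fp = amap_Hom[OF p(1), folded FX] amap_Hom[OF p(2), folded FX]
      have "gm D (transport M) c f g = amap F (gm C M ?P (?p ! 0) (?p ! Suc 0)) \<cdot>\<^bsub>D\<^esub> t"
        using comp[OF Fp t(1)] t(2,3) amap_gm[OF M p] by simp
      also have "\<dots> = amap F (gm C M ?P (?p ! Suc 0) (?p ! 0)) \<cdot>\<^bsub>D\<^esub> t"
        using S.cMon_Obj_laws(5)[OF M p] by simp
      also have "\<dots> = gm D (transport M) c g f"
        using comp[OF Fp(2,1) t(1)] t(2,3) amap_gm[OF M p(2,1)] by simp
      finally show ?thesis .
    qed
    show "gm D (transport M) c (gu D (transport M) c) f = f" if f: "f \<in> Hom D c (t1 (transport M))" for c f
    proof -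
      \<comment> \<open>For the unit law the generic element is the identity, which \<open>F\<close>
        preserves; composing with \<open>f\<close> gives the general case.\<close>
      note I = src.Ident_Hom[OF X]
      note FI = amap_Hom[OF I, folded FX]
      have "gm C M ?X (gu C M ?X) (Ident C ?X) = Ident C ?X" by (rule S.cMon_Obj_laws(6)[OF M I])
      then have "gm D (transport M) (t1 (transport M)) (gu D (transport M) (t1 (transport M))) (amap F (Ident C ?X)) = amap F (Ident C ?X)"
        using amap_gm[OF M S.gu_Hom[OF M X] I] amap_gu[OF M X] FX by simp
      moreover have "amap F (Ident C ?X) = Ident D (t1 (transport M))" using amap_Ident[OF X] FX by simp
      ultimately have e: "gm D (transport M) (t1 (transport M)) (gu D (transport M) (t1 (transport M))) (Ident D (t1 (transport M))) = Ident D (t1 (transport M))"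
        by simp
      have O: "t1 (transport M) \<in> Obj D" using X omap_Obj FX by simp
      show ?thesis
        using comp[OF tgt.gunit_Hom[OF transport_ops(2)[OF M] O] tgt.Ident_Hom[OF O] f] e
          tgt.Comp_Ident_left[OF f] tgt.gunit_comp[OF transport_ops(2)[OF M] f] by simp
    qed
  qed
  then show ?thesis by (auto simp: cMon_Obj_def transport_eq[OF M])
qed

text \<open>The images of the projections form a product diagram in \<open>D\<close>, so by
  \<open>mult_eqI\<close> the values there fix the multiplication. Transports are identified by this
  criterion without computing comparison arrows.\<close>

lemma transport_unique:
  assumes M: "M \<in> cMon_Obj C" and N: "N \<in> cMon_Obj D" and "t1 N = omap F (t1 M)"
    and m: "gm D N (omap F (prod_ob C [t1 M, t1 M])) (amap F (projs C [t1 M, t1 M] ! 0)) (amap F (projs C [t1 M, t1 M] ! Suc 0))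
      = amap F (t2 M)"
    and u: "gu D N (omap F (prod_ob C [])) = amap F (t3 M)"
  shows "N = transport M"
proof (rule T.cMon_Obj_eqI[OF N transport_Obj[OF M]])
  let ?X = "t1 M"
  note X = S.cMon_Obj_laws(1)[OF M]
  have X2: "set [?X, ?X] \<subseteq> Obj C" using X by auto
  show e: "t1 N = t1 (transport M)" using assms(3) t1_transport[OF M] by simp
  note N' = T.cMon_Obj_laws[OF N, unfolded e]
  have l: "length (projs C [?X, ?X]) = 2" using src.is_productD(3)[OF src.chosen_is_product[OF X2]] by simp
  note p = src.proj2_Hom[OF X X]
  have eqm: "gm D N (omap F (prod_ob C [?X, ?X])) (amap F (projs C [?X, ?X] ! 0)) (amap F (projs C [?X, ?X] ! Suc 0))
    = gm D (transport M) (omap F (prod_ob C [?X, ?X])) (amap F (projs C [?X, ?X] ! 0)) (amap F (projs C [?X, ?X] ! Suc 0))"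
    using m amap_gm[OF M p] src.gmult_projs[OF S.cMon_Obj_laws(2)[OF M]] by simp
  have "is_product D [t1 (transport M), t1 (transport M)] (omap F (prod_ob C [?X, ?X])) (map (amap F) (projs C [?X, ?X]))"
    using image_product[OF X2] t1_transport[OF M] by simp
  from tgt.mult_eqI[OF N'(2) transport_ops(1)[OF M] this] show "t2 N = t2 (transport M)"
    using eqm l e by simp
  have "is_product D [] (omap F (prod_ob C [])) (map (amap F) (projs C []))"
    using image_product[of "[]"] by simp
  from tgt.unit_eqI[OF N'(3) transport_ops(2)[OF M] this] show "t3 N = t3 (transport M)"
    using u amap_gu[OF M, of "prod_ob C []"] src.gunit_terminal[OF S.cMon_Obj_laws(3)[OF M]]
      src.Hom_Obj(1)[OF S.cMon_Obj_laws(3)[OF M]] by simp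
qed

text \<open>As in \<open>transport_Obj\<close>, the equation is carried over from the projections in
  \<open>C\<close> and then composed with the arrow \<open>t\<close> that yields \<open>a\<close>
  and \<open>b\<close>.\<close>

lemma transport_mhom:
  assumes f: "f \<in> mhom C M N" and M: "M \<in> cMon_Obj C" and N: "N \<in> cMon_Obj C"
  shows "amap F f \<in> mhom D (transport M) (transport N)"
proof (rule T.mhomI)
  let ?X = "t1 M"
  note f' = S.mhomD[OF f]
  note FX = t1_transport[OF M] and FY = t1_transport[OF N] and X = S.cMon_Obj_laws(1)[OF M]
  note Ff = amap_Hom[OF f'(1), folded FX FY]
  show "amap F f \<in> Hom D (t1 (transport M)) (t1 (transport N))" by fact
  show "amap F f \<cdot>\<^bsub>D\<^esub> gm D (transport M) c a b = gm D (transport N) c (amap F f \<cdot>\<^bsub>D\<^esub> a) (amap F f \<cdot>\<^bsub>D\<^esub> b)"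
    if "a \<in> Hom D c (t1 (transport M))" "b \<in> Hom D c (t1 (transport M))" for c a b
  proof -
    have ab: "a \<in> Hom D c (omap F ?X)" "b \<in> Hom D c (omap F ?X)" using that FX by simp_all
    let ?P = "prod_ob C [?X, ?X]" and ?p = "projs C [?X, ?X]"
    from mediator_pair[OF X ab] obtain t where t: "t \<in> Hom D c (omap F ?P)"
      "amap F (?p ! 0) \<cdot>\<^bsub>D\<^esub> t = a" "amap F (?p ! Suc 0) \<cdot>\<^bsub>D\<^esub> t = b" .
    note p = src.proj2_Hom[OF X X]
    note Fp = amap_Hom[OF p(1), folded FX] amap_Hom[OF p(2), folded FX]
    note fp = src.Comp_Hom[OF p(1) f'(1)] src.Comp_Hom[OF p(2) f'(1)]
    note Ffp = amap_Hom[OF fp(1), folded FY] amap_Hom[OF fp(2), folded FY]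
    note g = S.gm_Hom[OF M p]
    have Fc: "amap F (f \<cdot>\<^bsub>C\<^esub> x) \<cdot>\<^bsub>D\<^esub> t = amap F f \<cdot>\<^bsub>D\<^esub> (amap F x \<cdot>\<^bsub>D\<^esub> t)" if x: "x \<in> Hom C ?P ?X" for x
      using amap_Comp[OF x f'(1)] tgt.Comp_assoc[OF t(1) amap_Hom[OF x] amap_Hom[OF f'(1)]] by simp
    have "amap F f \<cdot>\<^bsub>D\<^esub> gm D (transport M) c a b = amap F f \<cdot>\<^bsub>D\<^esub> (amap F (gm C M ?P (?p ! 0) (?p ! Suc 0)) \<cdot>\<^bsub>D\<^esub> t)"
      using T.gm_comp[OF transport_Obj[OF M] Fp t(1)] amap_gm[OF M p] t(2,3) by simp
    also have "\<dots> = amap F (gm C N ?P (f \<cdot>\<^bsub>C\<^esub> (?p ! 0)) (f \<cdot>\<^bsub>C\<^esub> (?p ! Suc 0))) \<cdot>\<^bsub>D\<^esub> t"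
      using Fc[OF g] f'(2)[OF p] by simp
    also have "\<dots> = gm D (transport N) c (amap F (f \<cdot>\<^bsub>C\<^esub> (?p ! 0)) \<cdot>\<^bsub>D\<^esub> t) (amap F (f \<cdot>\<^bsub>C\<^esub> (?p ! Suc 0)) \<cdot>\<^bsub>D\<^esub> t)"
      using amap_gm[OF N fp] T.gm_comp[OF transport_Obj[OF N] Ffp t(1)] by simp
    also have "\<dots> = gm D (transport N) c (amap F f \<cdot>\<^bsub>D\<^esub> a) (amap F f \<cdot>\<^bsub>D\<^esub> b)"
      using Fc[OF p(1)] Fc[OF p(2)] t(2,3) by simp
    finally show ?thesis .
  qed
  show "amap F f \<cdot>\<^bsub>D\<^esub> gu D (transport M) c = gu D (transport N) c" if c: "c \<in> Obj D" for c
  proof -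
    let ?I = "prod_ob C []"
    have I: "?I \<in> Obj C" using src.Hom_Obj(1)[OF S.cMon_Obj_laws(3)[OF M]] .
    have "is_product D [] (omap F ?I) (map (amap F) (projs C []))" using image_product[of "[]"] by simp
    note t = tgt.mediator_unique(1)[OF this tgt.cone0I[OF c]]
    note g = S.gu_Hom[OF M I]
    have "amap F f \<cdot>\<^bsub>D\<^esub> amap F (gu C M ?I) = amap F (gu C N ?I)"
      using amap_Comp[OF g f'(1)] f'(3)[OF I] by simp
    then show ?thesis
      using T.gu_comp[OF transport_Obj[OF M] t] T.gu_comp[OF transport_Obj[OF N] t] amap_gu[OF M I] amap_gu[OF N I]
        tgt.Comp_assoc[OF t amap_Hom[OF g] amap_Hom[OF f'(1)]] by simp
  qed
qed

lemma cMon_map_amap: "f \<in> Hom (cMon C) M N \<Longrightarrow> amap (cMon_map C D F) f = Triple (transport M) (amap F (t2 f)) (transport N)"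
  by (elim S.Hom_cMonE) (simp add: cMon_map_def Let_def S.cMon_Arr_iff)

lemma cMon_map_functor: "cat_functor (cMon C) (cMon D) (cMon_map C D F)"
proof
  show "transport a \<in> Obj (cMon D)" if "a \<in> Obj (cMon C)" for a using that transport_Obj by simp
  show H: "amap (cMon_map C D F) f \<in> Hom (cMon D) (transport a) (transport b)" if "f \<in> Hom (cMon C) a b" for f a b
    using that transport_Obj transport_mhom by (simp add: cMon_map_amap) (auto simp: S.Hom_cMon intro!: T.Hom_cMonI)
  show "amap (cMon_map C D F) (Ident (cMon C) a) = Ident (cMon D) (transport a)" if "a \<in> Obj (cMon C)" for a
  proof -
    have "Ident (cMon C) a \<in> Hom (cMon C) a a" using that S.cM.Ident_Hom by simp
    then show ?thesis using that amap_Ident[OF S.cMon_Obj_laws(1)] by (simp add: cMon_map_amap transport_Obj t1_transport)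
  qed
  show "amap (cMon_map C D F) (g \<cdot>\<^bsub>cMon C\<^esub> f) = amap (cMon_map C D F) g \<cdot>\<^bsub>cMon D\<^esub> amap (cMon_map C D F) f"
    if fg: "f \<in> Hom (cMon C) a b" "g \<in> Hom (cMon C) b c" for f g a b c
    using T.cMon_Comp[OF H[OF fg(1)] H[OF fg(2)]] fg S.cM.Comp_Hom[OF fg]
    by (simp add: cMon_map_amap[of _ a b] cMon_map_amap[of _ b c] cMon_map_amap[of _ a c] S.cMon_Comp[of _ a b])
      (auto elim!: S.Hom_cMonE intro!: amap_Comp)
qed (simp_all add: cMon_map_def Let_def)

lemma cMon_map_additive: "additive_functor (cMon C) (cMon D) (cMon_map C D F)"
proof -
  interpret M: cat_functor "cMon C" "cMon D" "cMon_map C D F" by (rule cMon_map_functor)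
  interpret PC: preadditive_category "cMon C" by (rule S.preadditive_cMon)
  interpret PD: preadditive_category "cMon D" by (rule T.preadditive_cMon)
  show ?thesis
  proof
    show "amap (cMon_map C D F) (HAdd (cMon C) f g) = HAdd (cMon D) (amap (cMon_map C D F) f) (amap (cMon_map C D F) g)"
      if fg: "f \<in> Hom (cMon C) a b" "g \<in> Hom (cMon C) a b" for f g a b
      using T.cMon_HAdd[OF M.amap_Hom[OF fg(1)] M.amap_Hom[OF fg(2)]] fg PC.HAdd_Hom[OF fg]
      by (simp add: cMon_map_amap[of _ a b] S.cMon_HAdd[of _ a b])
        (auto elim!: S.Hom_cMonE simp: t1_transport amap_gm)
    show "amap (cMon_map C D F) (HZero (cMon C) a b) = HZero (cMon D) (transport a) (transport b)"
      if "a \<in> Obj (cMon C)" "b \<in> Obj (cMon C)" for a b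
      using PC.HZero_Hom[OF that] that
      by (simp add: cMon_map_amap[of _ a b] S.cMon_HZero T.cMon_HZero transport_Obj t1_transport amap_gu S.cMon_Obj_laws(1))
  qed
qed

end

section \<open>The forgetful functor, and functoriality of the transport\<close>

definition cMon_forget :: "'a ucat \<Rightarrow> 'a ufunc" where
  "cMon_forget C = \<lparr>omap = (\<lambda>M\<in>cMon_Obj C. t1 M), amap = (\<lambda>f\<in>cMon_Arr C. t2 f)\<rparr>"

context ufp_category
begin

lemma cMon_forget_Hom: "f \<in> Hom (cMon C) M N \<Longrightarrow> amap (cMon_forget C) f = t2 f"
  by (simp add: cMon_forget_def Hom_def)

lemma cMon_forget_functor: "cat_functor (cMon C) C (cMon_forget C)"
proof
  show "omap (cMon_forget C) a \<in> Obj C" if "a \<in> Obj (cMon C)" for a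
    using that cMon_Obj_laws(1) by (simp add: cMon_forget_def)
  show "amap (cMon_forget C) f \<in> Hom C (omap (cMon_forget C) a) (omap (cMon_forget C) b)"
    if "f \<in> Hom (cMon C) a b" for f a b
    using that by (simp add: cMon_forget_Hom) (auto elim!: Hom_cMonE simp: cMon_forget_def)
  show "amap (cMon_forget C) (Ident (cMon C) a) = Ident C (omap (cMon_forget C) a)" if "a \<in> Obj (cMon C)" for a
    using that cMon_forget_Hom[OF cM.Ident_Hom[OF that]] by (simp add: cMon_forget_def)
  show "amap (cMon_forget C) (g \<cdot>\<^bsub>cMon C\<^esub> f) = amap (cMon_forget C) g \<cdot> amap (cMon_forget C) f"
    if fg: "f \<in> Hom (cMon C) a b" "g \<in> Hom (cMon C) b c" for f g a b c
    using cMon_forget_Hom[OF cM.Comp_Hom[OF fg]] fg by (simp add: cMon_forget_Hom[of _ a b] cMon_forget_Hom[of _ b c] cMon_Comp[of _ a b])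
qed (simp_all add: cMon_forget_def)

text \<open>\<open>cMon_product\<close> supplies for each family one product whose underlying
  diagram is a product, which is enough by \<open>fp_functorI\<close>.\<close>

lemma cMon_forget_fp: "fp_functor (cMon C) C (cMon_forget C)"
proof -
  interpret U: cat_functor "cMon C" C "cMon_forget C" by (rule cMon_forget_functor)
  interpret A: additive_category "cMon C" by (rule additive_cMon)
  show ?thesis
  proof (rule U.fp_functorI)
    fix Ms assume Ms: "set Ms \<subseteq> Obj (cMon C)"
    then obtain N Qs where P: "is_product (cMon C) Ms N Qs" "is_product C (map t1 Ms) (t1 N) (map t2 Qs)"
      using cMon_product[of Ms] by auto
    note D = cM.is_productD[OF P(1)]
    have "map (omap (cMon_forget C)) Ms = map t1 Ms" using Ms by (auto simp: cMon_forget_def)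
    moreover have "map (amap (cMon_forget C)) Qs = map t2 Qs"
      using D(3) cMon_forget_Hom[OF D(4)] by (auto simp: in_set_conv_nth)
    moreover have "omap (cMon_forget C) N = t1 N" using D(2) by (simp add: cMon_forget_def)
    ultimately show "\<exists>N Qs. is_product (cMon C) Ms N Qs \<and>
        is_product C (map (omap (cMon_forget C)) Ms) (omap (cMon_forget C) N) (map (amap (cMon_forget C)) Qs)"
      using P by metis
  qed unfold_locales
qed

lemma cMon_map_id: "cMon_map C C (id_func C) = id_func (cMon C)"
proof -
  interpret I: ufp_functor C C "id_func C"
    unfolding ufp_functor_def by (rule id_func_fp_functor) unfold_locales
  note P = preadditive_cMon
  have id: "amap (id_func C) f = f" if "f \<in> Hom C a b" for f a b
    using HomD[OF that] by (simp add: id_func_def)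
  have ob: "I.transport M = M" if M: "M \<in> cMon_Obj C" for M
  proof -
    note p = proj2_Hom[OF cMon_Obj_laws(1)[OF M] cMon_Obj_laws(1)[OF M]]
    show ?thesis
    proof (rule I.transport_unique[OF M M, symmetric])
      show "t1 M = omap (id_func C) (t1 M)" using cMon_Obj_laws(1)[OF M] by (simp add: id_func_def)
      show "gm C M (omap (id_func C) (prod_ob C [t1 M, t1 M])) (amap (id_func C) (projs C [t1 M, t1 M] ! 0))
          (amap (id_func C) (projs C [t1 M, t1 M] ! Suc 0)) = amap (id_func C) (t2 M)"
        using id[OF p(1)] id[OF p(2)] Hom_Obj(1)[OF p(1)] gmult_projs[OF cMon_Obj_laws(2)[OF M]] id[OF cMon_Obj_laws(2)[OF M]]
        by (simp add: id_func_def)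
      show "gu C M (omap (id_func C) (prod_ob C [])) = amap (id_func C) (t3 M)"
        using id[OF cMon_Obj_laws(3)[OF M]] Hom_Obj(1)[OF cMon_Obj_laws(3)[OF M]] gunit_terminal[OF cMon_Obj_laws(3)[OF M]]
        by (simp add: id_func_def)
    qed
  qed
  show ?thesis
  proof (rule functor_eqI[OF I.cMon_map_functor id_func_functor[OF category_cMon]])
    show "I.transport M = omap (id_func (cMon C)) M" if "M \<in> Obj (cMon C)" for M
      using ob that by (simp add: id_func_def)
    show "amap (cMon_map C C (id_func C)) f = amap (id_func (cMon C)) f" if "f \<in> Hom (cMon C) M N" for f M N
      using that I.cMon_map_amap[OF that] cM.id_func_apply(2)[OF that] by (elim Hom_cMonE) (simp add: ob id)
  qed
qed

end

text \<open>The transport in two steps has the values at the images of the projections that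
  \<open>transport_unique\<close> asks for, so it is the transport along the composite, whatever
  products were chosen.\<close>

lemma cMon_map_comp:
  assumes "fp_functor C D F" "fp_functor D E G"
  shows "cMon_map C E (comp_func C G F) = comp_func (cMon C) (cMon_map D E G) (cMon_map C D F)"
proof -
  interpret F: ufp_functor C D F using assms(1) by (simp add: ufp_functor_def)
  interpret G: ufp_functor D E G using assms(2) by (simp add: ufp_functor_def)
  interpret H: ufp_functor C E "comp_func C G F"
    unfolding ufp_functor_def using assms by (rule comp_func_fp_functor)
  have am: "amap (comp_func C G F) f = amap G (amap F f)" if "f \<in> Hom C a b" for f a b
    using F.src.HomD[OF that] by (simp add: comp_func_def)
  have om: "omap (comp_func C G F) a = omap G (omap F a)" if "a \<in> Obj C" for a
    using that by (simp add: comp_func_def)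
  have ob: "H.transport M = G.transport (F.transport M)" if M: "M \<in> cMon_Obj C" for M
  proof (rule H.transport_unique[OF M, symmetric])
    note FM = F.transport_Obj[OF M]
    note X = F.S.cMon_Obj_laws(1)[OF M] and p = F.src.proj2_Hom[OF F.S.cMon_Obj_laws(1)[OF M] F.S.cMon_Obj_laws(1)[OF M]]
    note Fp = F.amap_Hom[OF p(1), folded F.t1_transport[OF M]] F.amap_Hom[OF p(2), folded F.t1_transport[OF M]]
    show "G.transport (F.transport M) \<in> cMon_Obj E" by (rule G.transport_Obj[OF FM])
    show "t1 (G.transport (F.transport M)) = omap (comp_func C G F) (t1 M)"
      using om[OF X] by (simp add: F.t1_transport[OF M] G.t1_transport[OF FM])
    show "gm E (G.transport (F.transport M)) (omap (comp_func C G F) (prod_ob C [t1 M, t1 M]))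
        (amap (comp_func C G F) (projs C [t1 M, t1 M] ! 0)) (amap (comp_func C G F) (projs C [t1 M, t1 M] ! Suc 0)) =
        amap (comp_func C G F) (t2 M)"
      using G.amap_gm[OF FM Fp] F.amap_gm[OF M p] F.src.gmult_projs[OF F.S.cMon_Obj_laws(2)[OF M]]
      by (simp add: am[OF p(1)] am[OF p(2)] am[OF F.S.cMon_Obj_laws(2)[OF M]] om[OF F.src.Hom_Obj(1)[OF p(1)]])
    have I: "prod_ob C [] \<in> Obj C" using F.src.Hom_Obj(1)[OF F.S.cMon_Obj_laws(3)[OF M]] .
    show "gu E (G.transport (F.transport M)) (omap (comp_func C G F) (prod_ob C [])) = amap (comp_func C G F) (t3 M)"
      using G.amap_gu[OF FM F.omap_Obj[OF I]] F.amap_gu[OF M I] F.src.gunit_terminal[OF F.S.cMon_Obj_laws(3)[OF M]]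
      by (simp add: am[OF F.S.cMon_Obj_laws(3)[OF M]] om[OF I])
  qed
  show ?thesis
  proof (rule functor_eqI[OF H.cMon_map_functor comp_func_functor[OF F.cMon_map_functor G.cMon_map_functor]])
    show "H.transport M = omap (comp_func (cMon C) (cMon_map D E G) (cMon_map C D F)) M" if "M \<in> Obj (cMon C)" for M
      using that ob by (simp add: comp_func_def)
    show "amap (cMon_map C E (comp_func C G F)) f = amap (comp_func (cMon C) (cMon_map D E G) (cMon_map C D F)) f"
      if f: "f \<in> Hom (cMon C) M N" for f M N
    proof -
      interpret FF: cat_functor "cMon C" "cMon D" "cMon_map C D F" by (rule F.cMon_map_functor)
      have "t2 f \<in> Hom C (t1 M) (t1 N)" "M \<in> cMon_Obj C" "N \<in> cMon_Obj C"
        using f by (auto elim!: F.S.Hom_cMonE)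
      then show ?thesis
        using H.cMon_map_amap[OF f] F.cMon_map_amap[OF f] G.cMon_map_amap[OF FF.amap_Hom[OF f]]
        by (simp add: ob am F.S.cM.comp_func_apply(2)[OF f])
    qed
  qed
qed

text \<open>Naturality of the forgetful functor, the counit of the adjunction to come.\<close>

lemma cMon_forget_natural:
  assumes "fp_functor C D F"
  shows "comp_func (cMon C) (cMon_forget D) (cMon_map C D F) = comp_func (cMon C) F (cMon_forget C)"
proof -
  interpret F: ufp_functor C D F using assms(1) by (simp add: ufp_functor_def)
  interpret FF: cat_functor "cMon C" "cMon D" "cMon_map C D F" by (rule F.cMon_map_functor)
  show ?thesis
  proof (rule functor_eqI[OF comp_func_functor[OF F.cMon_map_functor F.T.cMon_forget_functor]
        comp_func_functor[OF F.S.cMon_forget_functor F.cat_functor_axioms]])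
    show "omap (comp_func (cMon C) (cMon_forget D) (cMon_map C D F)) M = omap (comp_func (cMon C) F (cMon_forget C)) M"
      if "M \<in> Obj (cMon C)" for M
      using that by (simp add: comp_func_def cMon_forget_def F.transport_Obj F.t1_transport)
    show "amap (comp_func (cMon C) (cMon_forget D) (cMon_map C D F)) f = amap (comp_func (cMon C) F (cMon_forget C)) f"
      if f: "f \<in> Hom (cMon C) M N" for f M N
      using F.S.cM.HomD[OF f] F.T.cMon_forget_Hom[OF FF.amap_Hom[OF f]] F.cMon_map_amap[OF f] F.S.cMon_forget_Hom[OF f]
      by (simp add: comp_func_def)
  qed
qed

section \<open>Biproducts\<close>

definition hsum :: "('o, 'm, 'z) acat_scheme \<Rightarrow> 'o \<Rightarrow> 'o \<Rightarrow> 'm list \<Rightarrow> 'm" where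
  "hsum A a b fs = foldr (HAdd A) fs (HZero A a b)"

lemma hsum_simps [simp]:
  "hsum A a b [] = HZero A a b" "hsum A a b (f # fs) = HAdd A f (hsum A a b fs)"
  by (simp_all add: hsum_def)

text \<open>\<open>js\<close> lists the injections. For the empty family the sum condition says that
  the identity of \<open>p\<close> is zero, that is, that \<open>p\<close> is a zero object.\<close>

definition is_biproduct ::
  "('o, 'm, 'z) acat_scheme \<Rightarrow> 'o list \<Rightarrow> 'o \<Rightarrow> 'm list \<Rightarrow> 'm list \<Rightarrow> bool" where
  "is_biproduct A xs p ps js \<longleftrightarrow> set xs \<subseteq> Obj A \<and> p \<in> Obj A \<and>
     length ps = length xs \<and> length js = length xs \<and>
     (\<forall>i<length xs. ps ! i \<in> Hom A p (xs ! i) \<and> js ! i \<in> Hom A (xs ! i) p) \<and>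
     (\<forall>i<length xs. \<forall>k<length xs. (ps ! i) \<cdot>\<^bsub>A\<^esub> (js ! k) =
        (if k = i then Ident A (xs ! k) else HZero A (xs ! k) (xs ! i))) \<and>
     hsum A p p (map (\<lambda>i. (js ! i) \<cdot>\<^bsub>A\<^esub> (ps ! i)) [0..<length xs]) = Ident A p"

section \<open>Finite sums of arrows, and products as biproducts\<close>

context preadditive_category
begin

lemma HAdd_comm: "\<lbrakk>f \<in> Hom A a b; g \<in> Hom A a b\<rbrakk> \<Longrightarrow> HAdd A f g = HAdd A g f"
  using comm_monoid.m_comm[OF hom_comm_monoid[of a b], of f g] Hom_Obj by (simp add: hom_monoid_def)

lemma HAdd_assoc: "\<lbrakk>f \<in> Hom A a b; g \<in> Hom A a b; h \<in> Hom A a b\<rbrakk> \<Longrightarrow>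
    HAdd A (HAdd A f g) h = HAdd A f (HAdd A g h)"
  using monoid.m_assoc[OF comm_monoid.axioms(1)[OF hom_comm_monoid[of a b]], of f g h] Hom_Obj
  by (simp add: hom_monoid_def)

lemma HAdd_zero_left: "f \<in> Hom A a b \<Longrightarrow> HAdd A (HZero A a b) f = f"
  using monoid.l_one[OF comm_monoid.axioms(1)[OF hom_comm_monoid[of a b]], of f] Hom_Obj
  by (simp add: hom_monoid_def)

lemma HAdd_zero_right: "f \<in> Hom A a b \<Longrightarrow> HAdd A f (HZero A a b) = f"
  using monoid.r_one[OF comm_monoid.axioms(1)[OF hom_comm_monoid[of a b]], of f] Hom_Obj
  by (simp add: hom_monoid_def)

lemma hsum_Hom: "\<lbrakk>set fs \<subseteq> Hom A a b; a \<in> Obj A; b \<in> Obj A\<rbrakk> \<Longrightarrow> hsum A a b fs \<in> Hom A a b"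
  by (induction fs) (auto intro: HZero_Hom HAdd_Hom)

lemma Comp_hsum:
  assumes "set fs \<subseteq> Hom A a b" "a \<in> Obj A" "h \<in> Hom A b c"
  shows "h \<cdot> hsum A a b fs = hsum A a c (map (\<lambda>f. h \<cdot> f) fs)"
  using assms(1)
proof (induction fs)
  case Nil
  show ?case using Comp_HZero_right[OF assms(2,3)] by simp
next
  case (Cons f fs)
  then show ?case
    using Comp_HAdd_right[of f a b "hsum A a b fs" h c] hsum_Hom[of fs a b] assms(2,3) Hom_Obj(1)[OF assms(3)] by simp
qed

lemma hsum_Comp:
  assumes "set fs \<subseteq> Hom A a b" "b \<in> Obj A" "k \<in> Hom A d a"
  shows "hsum A a b fs \<cdot> k = hsum A d b (map (\<lambda>f. f \<cdot> k) fs)"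
  using assms(1)
proof (induction fs)
  case Nil
  show ?case using Comp_HZero_left[OF assms(3,2)] by simp
next
  case (Cons f fs)
  then show ?case
    using Comp_HAdd_left[of k d a f b "hsum A a b fs"] hsum_Hom[of fs a b] assms(2,3) Hom_Obj(2)[OF assms(3)] by simp
qed

lemma hsum_zero:
  assumes "\<And>k. k \<in> set ks \<Longrightarrow> f k = HZero A a b" "a \<in> Obj A" "b \<in> Obj A"
  shows "hsum A a b (map f ks) = HZero A a b"
  using assms(1) by (induction ks) (simp_all add: HAdd_zero_left[OF HZero_Hom[OF assms(2,3)]])

text \<open>Collapses a sum against a Kronecker delta, which occurs whenever a projection is
  composed with a sum over the injections.\<close>

lemma hsum_single:
  assumes "distinct ks" "i \<in> set ks" "f i \<in> Hom A a b" "\<And>k. \<lbrakk>k \<in> set ks; k \<noteq> i\<rbrakk> \<Longrightarrow> f k = HZero A a b"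
  shows "hsum A a b (map f ks) = f i"
  using assms(1,2,4)
proof (induction ks)
  case (Cons k ks)
  note O = Hom_Obj[OF assms(3)]
  show ?case
  proof (cases "k = i")
    case True
    then have "hsum A a b (map f ks) = HZero A a b" using Cons.prems O by (intro hsum_zero) auto
    then show ?thesis using True HAdd_zero_right[OF assms(3)] by simp
  next
    case False
    then have "hsum A a b (map f ks) = f i" using Cons by simp
    then show ?thesis using False Cons.prems HAdd_zero_left[OF assms(3)] by simp
  qed
qed simp

text \<open>The injections give the mediating arrow explicitly, and the decomposition of the
  identity gives its uniqueness.\<close>

lemma is_product_if_is_biproduct:
  assumes "is_biproduct A xs p ps js"
  shows "is_product A xs p ps"
proof -
  let ?n = "length xs"
  have xs: "set xs \<subseteq> Obj A" and p: "p \<in> Obj A" and l: "length ps = ?n" "length js = ?n"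
    and ps: "\<And>i. i < ?n \<Longrightarrow> ps ! i \<in> Hom A p (xs ! i)"
    and js: "\<And>i. i < ?n \<Longrightarrow> js ! i \<in> Hom A (xs ! i) p"
    and orth: "\<And>i k. \<lbrakk>i < ?n; k < ?n\<rbrakk> \<Longrightarrow> (ps ! i) \<cdot> (js ! k) = (if k = i then Ident A (xs ! k) else HZero A (xs ! k) (xs ! i))"
    and sum: "hsum A p p (map (\<lambda>i. (js ! i) \<cdot> (ps ! i)) [0..<?n]) = Ident A p"
    using assms by (simp_all add: is_biproduct_def)
  show ?thesis
  proof (rule is_productI[OF xs p l(1) ps])
    fix c
    show "\<exists>h. h \<in> Hom A c p \<and> (\<forall>i<?n. ps ! i \<cdot> h = fs ! i)" if "is_cone A xs c fs" for fs
    proof -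
      have c: "c \<in> Obj A" and fs: "\<And>i. i < ?n \<Longrightarrow> fs ! i \<in> Hom A c (xs ! i)"
        using that by (simp_all add: is_cone_def)
      \<comment> \<open>The mediating arrow is the sum of the components, each followed by its
        injection.\<close>
      let ?g = "map (\<lambda>i. (js ! i) \<cdot> (fs ! i)) [0..<?n]"
      have g: "set ?g \<subseteq> Hom A c p" using Comp_Hom[OF fs js] by auto
      have "ps ! i \<cdot> hsum A c p ?g = fs ! i" if i: "i < ?n" for i
      proof -
        have e: "ps ! i \<cdot> ((js ! k) \<cdot> (fs ! k)) = (if k = i then fs ! i else HZero A c (xs ! i))" if k: "k < ?n" for k
          using Comp_assoc[OF fs[OF k] js[OF k] ps[OF i], symmetric] orth[OF i k] Comp_Ident_left[OF fs[OF k]]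
            Comp_HZero_left[OF fs[OF k], of "xs ! i"] Hom_Obj(2)[OF ps[OF i]]
          by (cases "k = i") simp_all
        have "ps ! i \<cdot> hsum A c p ?g = hsum A c (xs ! i) (map (\<lambda>k. ps ! i \<cdot> ((js ! k) \<cdot> (fs ! k))) [0..<?n])"
          using Comp_hsum[OF g c ps[OF i]] by (simp add: comp_def)
        also have "\<dots> = ps ! i \<cdot> ((js ! i) \<cdot> (fs ! i))"
          by (rule hsum_single) (use i e fs[OF i] in auto)
        finally show ?thesis using e[OF i] by simp
      qed
      then show ?thesis using hsum_Hom[OF g c p] by blast
    qed
    show "h = h'" if h: "h \<in> Hom A c p" "h' \<in> Hom A c p" and eq: "\<And>i. i < ?n \<Longrightarrow> ps ! i \<cdot> h = ps ! i \<cdot> h'" for h h'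
    proof -
      have jp: "set (map (\<lambda>i. (js ! i) \<cdot> (ps ! i)) [0..<?n]) \<subseteq> Hom A p p"
        using Comp_Hom[OF ps js] by auto
      \<comment> \<open>Decomposing the identity of \<open>p\<close> expresses an arrow into
        \<open>p\<close> by its components.\<close>
      have e: "k = hsum A c p (map (\<lambda>i. (js ! i) \<cdot> ((ps ! i) \<cdot> k)) [0..<?n])" if k: "k \<in> Hom A c p" for k
      proof -
        have "k = Ident A p \<cdot> k" using Comp_Ident_left[OF k] by simp
        also have "\<dots> = hsum A c p (map (\<lambda>f. f \<cdot> k) (map (\<lambda>i. (js ! i) \<cdot> (ps ! i)) [0..<?n]))"
          unfolding sum[symmetric] by (rule hsum_Comp[OF jp p k])
        also have "map (\<lambda>f. f \<cdot> k) (map (\<lambda>i. (js ! i) \<cdot> (ps ! i)) [0..<?n]) = map (\<lambda>i. (js ! i) \<cdot> ((ps ! i) \<cdot> k)) [0..<?n]"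
          using Comp_assoc[OF k ps js] by auto
        finally show ?thesis .
      qed
      have "map (\<lambda>i. (js ! i) \<cdot> ((ps ! i) \<cdot> h)) [0..<?n] = map (\<lambda>i. (js ! i) \<cdot> ((ps ! i) \<cdot> h')) [0..<?n]"
        using eq by simp
      with e[OF h(1)] e[OF h(2)] show ?thesis by simp
    qed
  qed
qed

text \<open>The injection \<open>j k\<close> mediates the cone that is the identity at
  \<open>k\<close> and zero elsewhere; the decomposition of the identity is checked on the
  projections.\<close>

lemma product_is_biproduct:
  assumes P: "is_product A xs p ps"
  obtains js where "is_biproduct A xs p ps js"
proof -
  let ?n = "length xs"
  note D = is_productD[OF P]
  have x: "xs ! i \<in> Obj A" if "i < ?n" for i using D(1) that by auto
  let ?fs = "\<lambda>k. map (\<lambda>i. if k = i then Ident A (xs ! k) else HZero A (xs ! k) (xs ! i)) [0..<?n]"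
  define j where "j k = mediator A p ps (xs ! k) (?fs k)" for k
  define js where "js = map j [0..<?n]"
  have c: "is_cone A xs (xs ! k) (?fs k)" if "k < ?n" for k
    using x that by (auto simp: is_cone_def intro: Ident_Hom HZero_Hom)
  have js: "js ! k \<in> Hom A (xs ! k) p" if "k < ?n" for k
    using mediator_unique(1)[OF P c[OF that]] that by (simp add: js_def j_def)
  have orth: "ps ! i \<cdot> (js ! k) = (if k = i then Ident A (xs ! k) else HZero A (xs ! k) (xs ! i))"
    if "i < ?n" "k < ?n" for i k
    using mediator_unique(2)[OF P c[OF that(2)] that(1)] that by (simp add: js_def j_def)
  have jp: "set (map (\<lambda>i. (js ! i) \<cdot> (ps ! i)) [0..<?n]) \<subseteq> Hom A p p"
    using Comp_Hom[OF D(4) js] by auto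
  have "hsum A p p (map (\<lambda>i. (js ! i) \<cdot> (ps ! i)) [0..<?n]) = Ident A p"
  proof (rule product_ext[OF P hsum_Hom[OF jp D(2,2)] Ident_Hom[OF D(2)]])
    fix i assume i: "i < ?n"
    have e: "ps ! i \<cdot> ((js ! k) \<cdot> (ps ! k)) = (if k = i then ps ! i else HZero A p (xs ! i))" if k: "k < ?n" for k
      using Comp_assoc[OF D(4)[OF k] js[OF k] D(4)[OF i], symmetric] orth[OF i k] Comp_Ident_left[OF D(4)[OF k]]
        Comp_HZero_left[OF D(4)[OF k] x[OF i]] by (cases "k = i") simp_all
    have "ps ! i \<cdot> hsum A p p (map (\<lambda>i. (js ! i) \<cdot> (ps ! i)) [0..<?n]) =
        hsum A p (xs ! i) (map (\<lambda>k. ps ! i \<cdot> ((js ! k) \<cdot> (ps ! k))) [0..<?n])"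
      using Comp_hsum[OF jp D(2) D(4)[OF i]] by (simp add: comp_def)
    also have "\<dots> = ps ! i \<cdot> ((js ! i) \<cdot> (ps ! i))"
      by (rule hsum_single) (use i e D(4)[OF i] in auto)
    finally show "ps ! i \<cdot> hsum A p p (map (\<lambda>i. (js ! i) \<cdot> (ps ! i)) [0..<?n]) = ps ! i \<cdot> Ident A p"
      using e[OF i] Comp_Ident_right[OF D(4)[OF i]] by simp
  qed
  then have "is_biproduct A xs p ps js"
    using D js orth by (auto simp: is_biproduct_def js_def)
  then show ?thesis by (rule that)
qed

text \<open>The zero arrow is the only arrow into a terminal object. This accounts both for zeros
  under product preserving functors and for the units of monoids in an additive category.\<close>

lemma terminal_arrow_zero:
  assumes T: "is_product A [] t ps" and f: "f \<in> Hom A t b" and g: "g \<in> Hom A a t"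
  shows "f \<cdot> g = HZero A a b"
proof -
  note O = Hom_Obj[OF f] Hom_Obj[OF g]
  have "g = HZero A a t" by (rule terminal_unique[OF T g HZero_Hom[OF O(3,4)]])
  then show ?thesis using Comp_HZero_right[OF O(3) f] by simp
qed

end

context additive_functor
begin

lemma amap_hsum:
  assumes "set fs \<subseteq> Hom A a b" "a \<in> Obj A" "b \<in> Obj A"
  shows "amap F (hsum A a b fs) = hsum B (omap F a) (omap F b) (map (amap F) fs)"
  using assms(1) by (induction fs) (simp_all add: amap_HZero assms amap_HAdd[of _ a b] src.hsum_Hom)

lemma preserves_biproduct:
  assumes "is_biproduct A xs p ps js"
  shows "is_biproduct B (map (omap F) xs) (omap F p) (map (amap F) ps) (map (amap F) js)"
proof -
  let ?n = "length xs"
  have xs: "set xs \<subseteq> Obj A" and p: "p \<in> Obj A" and l: "length ps = ?n" "length js = ?n"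
    and ps: "\<And>i. i < ?n \<Longrightarrow> ps ! i \<in> Hom A p (xs ! i)"
    and js: "\<And>i. i < ?n \<Longrightarrow> js ! i \<in> Hom A (xs ! i) p"
    and orth: "\<And>i k. \<lbrakk>i < ?n; k < ?n\<rbrakk> \<Longrightarrow> (ps ! i) \<cdot>\<^bsub>A\<^esub> (js ! k) = (if k = i then Ident A (xs ! k) else HZero A (xs ! k) (xs ! i))"
    and sum: "hsum A p p (map (\<lambda>i. (js ! i) \<cdot>\<^bsub>A\<^esub> (ps ! i)) [0..<?n]) = Ident A p"
    using assms by (simp_all add: is_biproduct_def)
  have x: "xs ! i \<in> Obj A" if "i < ?n" for i using xs that by auto
  have "amap F (ps ! i) \<cdot>\<^bsub>B\<^esub> amap F (js ! k) =
      (if k = i then Ident B (omap F (xs ! k)) else HZero B (omap F (xs ! k)) (omap F (xs ! i)))"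
    if ik: "i < ?n" "k < ?n" for i k
    using amap_Comp[OF js[OF ik(2)] ps[OF ik(1)], symmetric] orth[OF ik] x ik by (simp add: amap_Ident amap_HZero)
  moreover have "hsum B (omap F p) (omap F p)
      (map (\<lambda>i. map (amap F) js ! i \<cdot>\<^bsub>B\<^esub> map (amap F) ps ! i) [0..<?n]) = Ident B (omap F p)"
  proof -
    have "set (map (\<lambda>i. (js ! i) \<cdot>\<^bsub>A\<^esub> (ps ! i)) [0..<?n]) \<subseteq> Hom A p p" using src.Comp_Hom[OF ps js] by auto
    note amap_hsum[OF this p p]
    moreover have "map (amap F) (map (\<lambda>i. (js ! i) \<cdot>\<^bsub>A\<^esub> (ps ! i)) [0..<?n]) =
        map (\<lambda>i. map (amap F) js ! i \<cdot>\<^bsub>B\<^esub> map (amap F) ps ! i) [0..<?n]"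
      using amap_Comp[OF ps js] l by simp
    ultimately show ?thesis unfolding sum amap_Ident[OF p] by (simp only:)
  qed
  ultimately show ?thesis
    using xs p l ps js unfolding is_biproduct_def by (auto simp: omap_Obj amap_Hom)
qed

lemma additive_preserves_product:
  assumes "is_product A xs p ps"
  shows "is_product B (map (omap F) xs) (omap F p) (map (amap F) ps)"
  using src.product_is_biproduct[OF assms] preserves_biproduct tgt.is_product_if_is_biproduct by metis

end

section \<open>Additive functors versus product preserving functors\<close>

lemma additive_functor_fp:
  assumes "additive_functor A B F" "fp_category A" "fp_category B"
  shows "fp_functor A B F"
proof -
  interpret additive_functor A B F by fact
  interpret fA: fp_category A by fact
  interpret fB: fp_category B by fact
  show ?thesis by unfold_locales (rule additive_preserves_product)
qed

text \<open>Checked on the projections, where one of the summands contributes zero.\<close>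

lemma (in additive_category) pair_split:
  assumes f: "f \<in> Hom A c X" and g: "g \<in> Hom A c Y"
  shows "tuple A [X, Y] c [f, g] =
    HAdd A (tuple A [X, Y] c [f, HZero A c Y]) (tuple A [X, Y] c [HZero A c X, g])"
proof -
  note O = Hom_Obj[OF f] Hom_Obj[OF g]
  note z = HZero_Hom[OF O(1,2)] HZero_Hom[OF O(1,4)]
  note t = pair_Hom[OF f g] pair_Hom[OF f z(2)] pair_Hom[OF z(1) g]
  note p = proj2_Hom[OF O(2,4)]
  show ?thesis
    using Comp_HAdd_right[OF t(2,3) p(1)] Comp_HAdd_right[OF t(2,3) p(2)]
    by (intro pair_ext[OF O(2,4) t(1) HAdd_Hom[OF t(2,3)]])
      (simp_all add: pair_proj[OF f g] pair_proj[OF f z(2)] pair_proj[OF z(1) g] HAdd_zero_left HAdd_zero_right f g)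
qed

text \<open>The sum of \<open>f\<close> and \<open>g\<close> is the sum of the two projections of
  the square of \<open>b\<close>, composed with the tuple of \<open>f\<close> and \<open>g\<close>;
  so it is enough that \<open>F\<close> preserves that one sum. Zero arrows are preserved because
  they factor through a terminal object.\<close>

lemma fp_functor_additive:
  assumes "additive_category A" "additive_category B" "fp_functor A B F"
  shows "additive_functor A B F"
proof -
  interpret A: additive_category A by fact
  interpret B: additive_category B by fact
  interpret F: fp_functor A B F by fact
  have zero: "amap F (HZero A a b) = HZero B (omap F a) (omap F b)" if ab: "a \<in> Obj A" "b \<in> Obj A" for a b
  proof -
    let ?t = "prod_ob A []"
    have T: "is_product A [] ?t (projs A [])" by (rule A.chosen_is_product) simp
    note t = A.is_productD(2)[OF T]
    note z = A.HZero_Hom[OF ab(1) t] A.HZero_Hom[OF t ab(2)]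
    have "HZero A a b = HZero A ?t b \<cdot>\<^bsub>A\<^esub> HZero A a ?t"
      using A.terminal_arrow_zero[OF T z(2,1)] by simp
    then have "amap F (HZero A a b) = amap F (HZero A ?t b) \<cdot>\<^bsub>B\<^esub> amap F (HZero A a ?t)"
      using F.amap_Comp[OF z] by simp
    also have "\<dots> = HZero B (omap F a) (omap F b)"
      using F.preserves_products[OF T] B.terminal_arrow_zero[OF _ F.amap_Hom[OF z(2)] F.amap_Hom[OF z(1)]] by simp
    finally show ?thesis .
  qed
  have "amap F (HAdd A f g) = HAdd B (amap F f) (amap F g)" if f: "f \<in> Hom A a b" and g: "g \<in> Hom A a b" for f g a b
  proof -
    have b: "b \<in> Obj A" using A.Hom_Obj f by blast
    let ?P = "prod_ob A [b, b]" and ?p = "projs A [b, b] ! 0" and ?q = "projs A [b, b] ! Suc 0"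
    have P: "is_product A [b, b] ?P (projs A [b, b])" by (rule A.chosen_is_product) (use b in simp)
    note p = A.proj2_Hom[OF b b] and I = A.Ident_Hom[OF b] and z = A.HZero_Hom[OF b b]
    \<comment> \<open>The two injections into the square of \<open>b\<close>.\<close>
    let ?i = "tuple A [b, b] b [Ident A b, HZero A b b]" and ?j = "tuple A [b, b] b [HZero A b b, Ident A b]"
    note i = A.pair_Hom[OF I z] and j = A.pair_Hom[OF z I]
    note pi = A.pair_proj[OF I z] and pj = A.pair_proj[OF z I]
    let ?d = "HAdd A ?p ?q"
    note d = A.HAdd_Hom[OF p]
    have di: "?d \<cdot>\<^bsub>A\<^esub> ?i = Ident A b" "?d \<cdot>\<^bsub>A\<^esub> ?j = Ident A b"
      using A.Comp_HAdd_left[OF i p] A.Comp_HAdd_left[OF j p] pi pj A.HAdd_zero_left[OF I] A.HAdd_zero_right[OF I]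
      by simp_all
    note Fp = F.amap_Hom[OF p(1)] F.amap_Hom[OF p(2)] and Fi = F.amap_Hom[OF i] and Fj = F.amap_Hom[OF j]
      and Fd = F.amap_Hom[OF d]
    note ip = B.Comp_Hom[OF Fp(1) Fi] and jq = B.Comp_Hom[OF Fp(2) Fj]
    \<comment> \<open>The decomposition of the identity of the square, with \<open>F\<close> applied
      to each factor. As \<open>F\<close> is not yet known to preserve sums, its being the identity
      is checked anew on the images of the projections.\<close>
    let ?e = "HAdd B (amap F ?i \<cdot>\<^bsub>B\<^esub> amap F ?p) (amap F ?j \<cdot>\<^bsub>B\<^esub> amap F ?q)"
    have e: "?e \<in> Hom B (omap F ?P) (omap F ?P)" using ip jq by (rule B.HAdd_Hom)
    have Fcomp: "amap F k \<cdot>\<^bsub>B\<^esub> ?e = HAdd B (amap F (k \<cdot>\<^bsub>A\<^esub> ?i) \<cdot>\<^bsub>B\<^esub> amap F ?p) (amap F (k \<cdot>\<^bsub>A\<^esub> ?j) \<cdot>\<^bsub>B\<^esub> amap F ?q)"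
      if k: "k \<in> Hom A ?P b" for k
      using B.Comp_HAdd_right[OF ip jq F.amap_Hom[OF k]] F.amap_Comp[OF i k] F.amap_Comp[OF j k]
        B.Comp_assoc[OF Fp(1) Fi F.amap_Hom[OF k]] B.Comp_assoc[OF Fp(2) Fj F.amap_Hom[OF k]] by simp
    note Fb = F.omap_Obj[OF b]
    have "?e = Ident B (omap F ?P)"
    proof (rule B.product_ext[OF F.preserves_products[OF P] e])
      show "Ident B (omap F ?P) \<in> Hom B (omap F ?P) (omap F ?P)" using Fi B.Hom_Obj B.Ident_Hom by blast
      have l: "length (projs A [b, b]) = 2" using A.is_productD(3)[OF P] by simp
      fix n assume "n < length (map (omap F) [b, b])"
      then have n: "n = 0 \<or> n = Suc 0" by auto
      have "amap F ?p \<cdot>\<^bsub>B\<^esub> ?e = amap F ?p" "amap F ?q \<cdot>\<^bsub>B\<^esub> ?e = amap F ?q"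
        using Fcomp[OF p(1)] Fcomp[OF p(2)] F.amap_Ident[OF b]
          B.Comp_Ident_left[OF Fp(1)] B.Comp_Ident_left[OF Fp(2)]
          B.Comp_HZero_left[OF Fp(1) Fb] B.Comp_HZero_left[OF Fp(2) Fb]
          B.HAdd_zero_left[OF Fp(2)] B.HAdd_zero_right[OF Fp(1)]
        by (simp_all add: pi pj zero[OF b b])
      then show "map (amap F) (projs A [b, b]) ! n \<cdot>\<^bsub>B\<^esub> ?e = map (amap F) (projs A [b, b]) ! n \<cdot>\<^bsub>B\<^esub> Ident B (omap F ?P)"
        using n l B.Comp_Ident_right[OF Fp(1)] B.Comp_Ident_right[OF Fp(2)] by auto
    qed
    \<comment> \<open>The codiagonal \<open>?d\<close> restricts to the identity along both
      injections, so composing its image with \<open>?e\<close> leaves the sum of the images of the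
      projections.\<close>
    then have Fd_eq: "amap F ?d = HAdd B (amap F ?p) (amap F ?q)"
      using Fcomp[OF d] di F.amap_Ident[OF b] B.Comp_Ident_right[OF Fd]
        B.Comp_Ident_left[OF Fp(1)] B.Comp_Ident_left[OF Fp(2)] by simp
    let ?t = "tuple A [b, b] a [f, g]"
    note t = A.pair_Hom[OF f g] and pt = A.pair_proj[OF f g]
    have "HAdd A f g = ?d \<cdot>\<^bsub>A\<^esub> ?t" using A.Comp_HAdd_left[OF t p] pt by simp
    then have "amap F (HAdd A f g) = amap F ?d \<cdot>\<^bsub>B\<^esub> amap F ?t" using F.amap_Comp[OF t d] by simp
    also have "\<dots> = HAdd B (amap F f) (amap F g)"
      using B.Comp_HAdd_left[OF F.amap_Hom[OF t] Fp] F.amap_Comp[OF t p(1)] F.amap_Comp[OF t p(2)] pt Fd_eq by simp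
    finally show ?thesis .
  qed
  then show ?thesis using zero by unfold_locales
qed

text \<open>Finite products do not see the enrichment, so the identity is a product preserving
  functor from \<open>A\<close> to \<open>B\<close> and hence additive: both enrichments have the
  same sums and zeros. This is the injectivity of the inclusion on objects.\<close>

lemma additive_structure_unique:
  fixes A B :: "('o, 'm) acat"
  assumes "additive_category A" "additive_category B" and eq: "cat.truncate A = cat.truncate B"
  shows "A = B"
proof -
  interpret A: additive_category A by fact
  interpret B: additive_category B by fact
  have sel: "Obj A = Obj B" "Arr A = Arr B" "Dom A = Dom B" "Cod A = Cod B" "Ident A = Ident B" "Comp A = Comp B"
    using eq by (simp_all add: cat.truncate_def)
  then have Hom: "Hom A = Hom B" by (simp add: Hom_def fun_eq_iff)
  have "fp_functor A A (id_func A)" by (rule id_func_fp_functor) unfold_locales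
  then have "fp_functor A (cat.truncate B) (id_func A)" unfolding eq[symmetric] by simp
  then have "additive_functor A B (id_func A)" using assms by (intro fp_functor_additive) simp_all
  then interpret I: additive_functor A B "id_func A" .
  have "HAdd A f g = HAdd B f g" for f g
  proof (cases "f \<in> Arr A \<and> g \<in> Arr A \<and> Dom A f = Dom A g \<and> Cod A f = Cod A g")
    case True
    then have fg: "f \<in> Hom A (Dom A f) (Cod A f)" "g \<in> Hom A (Dom A f) (Cod A f)" by (simp_all add: Hom_def)
    show ?thesis using I.amap_HAdd[OF fg] A.id_func_apply(2)[OF fg(1)] A.id_func_apply(2)[OF fg(2)]
        A.id_func_apply(2)[OF A.HAdd_Hom[OF fg]] by simp
  next
    case False
    have "\<not> (f \<in> Arr B \<and> g \<in> Arr B \<and> Dom B f = Dom B g \<and> Cod B f = Cod B g)" using False unfolding sel .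
    then show ?thesis using A.HAdd_ext[OF False] B.HAdd_ext by simp
  qed
  moreover have "HZero A a b = HZero B a b" for a b
  proof (cases "a \<in> Obj A \<and> b \<in> Obj A")
    case True
    then show ?thesis
      using I.amap_HZero[of a b] A.id_func_apply(2)[OF A.HZero_Hom[of a b]] by (simp add: A.id_func_apply(1))
  next
    case False
    then have "\<not> (a \<in> Obj B \<and> b \<in> Obj B)" unfolding sel .
    then show ?thesis using A.HZero_ext[OF False] B.HZero_ext by simp
  qed
  ultimately show ?thesis using sel by (intro acat.equality) (simp_all add: fun_eq_iff)
qed

section \<open>Additive categories as categories of commutative monoids\<close>

text \<open>The choice operator is applied to the same predicate, since \<open>is_product\<close>
  ignores the enrichment.\<close>

lemma truncate_products [simp]:
  "prod_ob (cat.truncate A) = prod_ob A" "projs (cat.truncate A) = projs A"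
  "tuple (cat.truncate A) = tuple A"
proof -
  have ch: "chosen_product (cat.truncate A) = chosen_product A"
    by (simp add: chosen_product_def fun_eq_iff)
  show 1: "prod_ob (cat.truncate A) = prod_ob A" "projs (cat.truncate A) = projs A"
    by (simp_all add: prod_ob_def projs_def ch fun_eq_iff)
  show "tuple (cat.truncate A) = tuple A"
    by (simp add: tuple_def mediator_def 1 fun_eq_iff)
qed

lemma gmult_truncate [simp]: "gmult (cat.truncate A) = gmult A"
  by (simp add: gmult_def fun_eq_iff)

lemma gunit_truncate [simp]: "gunit (cat.truncate A) = gunit A"
  by (simp add: gunit_def fun_eq_iff)

lemma comp_func_truncate [simp]: "comp_func (cat.truncate A) = comp_func A"
  by (simp add: comp_func_def fun_eq_iff)

lemma id_func_truncate [simp]: "id_func (cat.truncate A) = id_func A"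
  by (simp add: id_func_def)

section \<open>The isomorphism of an additive category with its category of commutative
  monoids\<close>

definition unit_ob :: "'a uacat \<Rightarrow> 'a univ \<Rightarrow> 'a univ" where
  "unit_ob A X = Triple X (HAdd A (projs A [X, X] ! 0) (projs A [X, X] ! Suc 0)) (HZero A (prod_ob A []) X)"

definition cMon_unit :: "'a uacat \<Rightarrow> 'a ufunc" where
  "cMon_unit A = \<lparr>omap = (\<lambda>X\<in>Obj A. unit_ob A X),
     amap = (\<lambda>f\<in>Arr A. Triple (unit_ob A (Dom A f)) f (unit_ob A (Cod A f)))\<rparr>"

locale uadditive_category = additive_category A for A :: "'a uacat" (structure)
begin

abbreviation T where "T \<equiv> cat.truncate A"

text \<open>The rewrites restate the theory of monoid objects in the underlying category over
  \<open>A\<close> itself, so that it can be combined with the enrichment.\<close>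

sublocale T: ufp_category T
  rewrites "Hom T = Hom A" and "Obj T = Obj A" and "Comp T = Comp A" and "Ident T = Ident A"
    and "gmult T = gmult A" and "gunit T = gunit A" and "prod_ob T = prod_ob A" and "projs T = projs A"
  by (simp_all add: ufp_category_def) unfold_locales

lemma t1_unit_ob [simp]: "t1 (unit_ob A X) = X"
  by (simp add: unit_ob_def)

text \<open>The operation on elements is the sum of arrows; its naturality in the stage is the
  distributivity of composition over sums, so \<open>gmult_representable\<close> applies.\<close>

lemma unit_ob_ops:
  assumes X: "X \<in> Obj A"
  shows "t2 (unit_ob A X) \<in> Hom A (prod_ob A [X, X]) X" and "t3 (unit_ob A X) \<in> Hom A (prod_ob A []) X"
    and "\<And>c f g. \<lbrakk>f \<in> Hom A c X; g \<in> Hom A c X\<rbrakk> \<Longrightarrow> gmult A X (t2 (unit_ob A X)) c f g = HAdd A f g"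
    and "\<And>c. c \<in> Obj A \<Longrightarrow> gunit A (t3 (unit_ob A X)) c = HZero A c X"
proof -
  have m: "t2 (unit_ob A X) = HAdd A (projs A [X, X] ! 0) (projs A [X, X] ! Suc 0)"
    and e: "t3 (unit_ob A X) = HZero A (prod_ob A []) X" by (simp_all add: unit_ob_def)
  have nat: "HAdd A f g \<cdot> h = HAdd A (f \<cdot> h) (g \<cdot> h)"
    if "f \<in> Hom A c X" "g \<in> Hom A c X" "h \<in> Hom A d c" for c d f g h
    using that by (intro Comp_HAdd_left)
  show "t2 (unit_ob A X) \<in> Hom A (prod_ob A [X, X]) X"
    by (rule gmult_representable(1)[where op = "\<lambda>c. HAdd A", OF X _ _ m]) (fact HAdd_Hom nat)+
  show "gmult A X (t2 (unit_ob A X)) c f g = HAdd A f g" if "f \<in> Hom A c X" "g \<in> Hom A c X" for c f g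
    by (rule gmult_representable(2)[where op = "\<lambda>c. HAdd A", OF X _ _ m]) (fact HAdd_Hom nat that)+
  have natz: "HZero A c X \<cdot> h = HZero A d X" if "h \<in> Hom A d c" for c d h
    by (rule Comp_HZero_left[OF that X])
  have z: "HZero A c X \<in> Hom A c X" if "c \<in> Obj A" for c using that X by (rule HZero_Hom)
  show "t3 (unit_ob A X) \<in> Hom A (prod_ob A []) X"
    by (rule gunit_representable(1)[where z = "\<lambda>c. HZero A c X", OF _ _ e]) (fact z natz)+
  show "gunit A (t3 (unit_ob A X)) c = HZero A c X" if "c \<in> Obj A" for c
    by (rule gunit_representable(2)[where z = "\<lambda>c. HZero A c X", OF _ _ e]) (fact z natz that)+
qed

lemma unit_ob_Obj:
  assumes X: "X \<in> Obj A"
  shows "unit_ob A X \<in> cMon_Obj T"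
proof -
  note ops = unit_ob_ops[OF X]
  have "comm_monoid_object T X (t2 (unit_ob A X)) (t3 (unit_ob A X))"
    using ops Hom_Obj
    by (intro T.comm_monoid_objectI)
      (simp_all add: X HAdd_Hom HAdd_assoc HAdd_comm HAdd_zero_left HZero_Hom)
  then show ?thesis by (auto simp: cMon_Obj_def unit_ob_def)
qed

text \<open>The Eckmann-Hilton argument: \<open>(f, g) = (f, 0) + (0, g)\<close>, and any arrow that factors
  through the terminal object is zero.\<close>

lemma unit_ob_unique:
  assumes M: "M \<in> cMon_Obj T"
  shows "M = unit_ob A (t1 M)"
proof -
  let ?X = "t1 M"
  note X = T.cMon_Obj_laws(1)[OF M] and m = T.cMon_Obj_laws(2)[OF M] and e = T.cMon_Obj_laws(3)[OF M]
  have gu: "gunit A (t3 M) c = HZero A c ?X" if c: "c \<in> Obj A" for c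
    unfolding gunit_def
    by (rule terminal_arrow_zero[OF chosen_is_product[of "[]"] e terminal_Hom[OF c]]) simp
  have gm: "gmult A ?X (t2 M) c f g = HAdd A f g" if f: "f \<in> Hom A c ?X" and g: "g \<in> Hom A c ?X" for c f g
  proof -
    have c: "c \<in> Obj A" using Hom_Obj f by blast
    note z = HZero_Hom[OF c X]
    have "gmult A ?X (t2 M) c f g =
        HAdd A (gmult A ?X (t2 M) c f (HZero A c ?X)) (gmult A ?X (t2 M) c (HZero A c ?X) g)"
      unfolding gmult_def pair_split[OF f g] by (rule Comp_HAdd_right[OF pair_Hom[OF f z] pair_Hom[OF z g] m])
    then show ?thesis using T.cMon_Obj_laws(6)[OF M g] T.cMon_Obj_laws(7)[OF M f] gu[OF c] by simp
  qed
  have I: "prod_ob A [] \<in> Obj A" using Hom_Obj e by blast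
  have "t2 M = t2 (unit_ob A ?X)" "t3 M = t3 (unit_ob A ?X)"
    using gm[OF proj2_Hom[OF X X]] gu[OF I] gmult_projs[OF m] gunit_terminal[OF e] by (simp_all add: unit_ob_def)
  then show ?thesis using T.cMon_Obj_eqI[OF M unit_ob_Obj[OF X]] by simp
qed

lemma mhom_unit_ob:
  assumes "f \<in> Hom A X Y"
  shows "f \<in> mhom T (unit_ob A X) (unit_ob A Y)"
proof -
  note O = Hom_Obj[OF assms]
  show ?thesis
    using assms unit_ob_ops[OF O(1)] unit_ob_ops[OF O(2)] Comp_Hom[OF _ assms]
    by (intro T.mhomI) (simp_all add: Comp_HAdd_right[OF _ _ assms] Comp_HZero_right[OF _ assms])
qed

lemma cMon_unit_apply:
  "X \<in> Obj A \<Longrightarrow> omap (cMon_unit A) X = unit_ob A X"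
  "f \<in> Hom A X Y \<Longrightarrow> amap (cMon_unit A) f = Triple (unit_ob A X) f (unit_ob A Y)"
  by (simp_all add: cMon_unit_def Hom_def)

lemma unit_arr_Hom: "f \<in> Hom A X Y \<Longrightarrow> Triple (unit_ob A X) f (unit_ob A Y) \<in> Hom (cMon T) (unit_ob A X) (unit_ob A Y)"
  using Hom_Obj by (intro T.Hom_cMonI mhom_unit_ob unit_ob_Obj) blast+

lemma cMon_unit_additive: "additive_functor A (cMon T) (cMon_unit A)"
proof -
  interpret C: preadditive_category "cMon T" by (rule T.preadditive_cMon)
  show ?thesis
  proof
    show "omap (cMon_unit A) a \<in> Obj (cMon T)" if "a \<in> Obj A" for a
      using that unit_ob_Obj by (simp add: cMon_unit_apply)
    show "amap (cMon_unit A) f \<in> Hom (cMon T) (omap (cMon_unit A) a) (omap (cMon_unit A) b)"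
      if "f \<in> Hom A a b" for f a b
      using that Hom_Obj[OF that] unit_arr_Hom[OF that] by (simp add: cMon_unit_apply)
    show "amap (cMon_unit A) (Ident A a) = Ident (cMon T) (omap (cMon_unit A) a)" if "a \<in> Obj A" for a
      using that unit_ob_Obj[OF that] cMon_unit_apply(2)[OF Ident_Hom[OF that]] by (simp add: cMon_unit_apply)
    show "amap (cMon_unit A) (g \<cdot> f) = amap (cMon_unit A) g \<cdot>\<^bsub>cMon T\<^esub> amap (cMon_unit A) f"
      if fg: "f \<in> Hom A a b" "g \<in> Hom A b c" for f g a b c
      using T.cMon_Comp[OF unit_arr_Hom[OF fg(1)] unit_arr_Hom[OF fg(2)]]
      by (simp add: cMon_unit_apply(2)[OF fg(1)] cMon_unit_apply(2)[OF fg(2)] cMon_unit_apply(2)[OF Comp_Hom[OF fg]])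
    show "amap (cMon_unit A) (HAdd A f g) = HAdd (cMon T) (amap (cMon_unit A) f) (amap (cMon_unit A) g)"
      if fg: "f \<in> Hom A a b" "g \<in> Hom A a b" for f g a b
      using T.cMon_HAdd[OF unit_arr_Hom[OF fg(1)] unit_arr_Hom[OF fg(2)]] unit_ob_ops(3)[OF Hom_Obj(2)[OF fg(1)] fg]
      by (simp add: cMon_unit_apply(2)[OF fg(1)] cMon_unit_apply(2)[OF fg(2)] cMon_unit_apply(2)[OF HAdd_Hom[OF fg]])
    show "amap (cMon_unit A) (HZero A a b) = HZero (cMon T) (omap (cMon_unit A) a) (omap (cMon_unit A) b)"
      if ab: "a \<in> Obj A" "b \<in> Obj A" for a b
      using T.cMon_HZero[OF unit_ob_Obj[OF ab(1)] unit_ob_Obj[OF ab(2)]] unit_ob_ops(4)[OF ab(2,1)]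
      by (simp add: cMon_unit_apply(1) ab cMon_unit_apply(2)[OF HZero_Hom[OF ab]])
  qed (simp_all add: cMon_unit_def)
qed

lemma forget_unit: "comp_func A (cMon_forget T) (cMon_unit A) = id_func A"
proof -
  interpret E: additive_functor A "cMon T" "cMon_unit A" by (rule cMon_unit_additive)
  have U: "cat_functor (cMon T) A (cMon_forget T)" using T.cMon_forget_functor by simp
  show ?thesis
  proof (rule functor_eqI[OF comp_func_functor[OF E.cat_functor_axioms U] id_func_functor[OF category_axioms]])
    show "omap (comp_func A (cMon_forget T) (cMon_unit A)) a = omap (id_func A) a" if "a \<in> Obj A" for a
      using that unit_ob_Obj[OF that] by (simp add: comp_func_apply id_func_apply cMon_unit_apply cMon_forget_def)
    show "amap (comp_func A (cMon_forget T) (cMon_unit A)) f = amap (id_func A) f" if f: "f \<in> Hom A a b" for f a b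
      using T.cMon_forget_Hom[OF unit_arr_Hom[OF f]]
      by (simp add: comp_func_apply(2)[OF f] id_func_apply(2)[OF f] cMon_unit_apply(2)[OF f])
  qed
qed

lemma unit_forget: "comp_func (cMon T) (cMon_unit A) (cMon_forget T) = id_func (cMon T)"
proof -
  interpret E: additive_functor A "cMon T" "cMon_unit A" by (rule cMon_unit_additive)
  have U: "cat_functor (cMon T) A (cMon_forget T)" using T.cMon_forget_functor by simp
  show ?thesis
  proof (rule functor_eqI[OF comp_func_functor[OF U E.cat_functor_axioms] id_func_functor[OF T.category_cMon]])
    show "omap (comp_func (cMon T) (cMon_unit A) (cMon_forget T)) M = omap (id_func (cMon T)) M"
      if "M \<in> Obj (cMon T)" for M
      using that T.cMon_Obj_laws(1)[of M] unit_ob_unique[of M]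
      by (simp add: T.cM.comp_func_apply T.cM.id_func_apply cMon_unit_apply cMon_forget_def)
    show "amap (comp_func (cMon T) (cMon_unit A) (cMon_forget T)) f = amap (id_func (cMon T)) f"
      if f: "f \<in> Hom (cMon T) M N" for f M N
    proof -
      have "t2 f \<in> Hom A (t1 M) (t1 N)" "f = Triple M (t2 f) N" "M \<in> cMon_Obj T" "N \<in> cMon_Obj T"
        using f by (auto elim!: T.Hom_cMonE)
      then show ?thesis
        using T.cMon_forget_Hom[OF f] unit_ob_unique[of M] unit_ob_unique[of N]
        by (simp add: T.cM.comp_func_apply(2)[OF f] T.cM.id_func_apply(2)[OF f] cMon_unit_apply(2))
    qed
  qed
qed

lemma cMon_forget_additive: "additive_functor (cMon T) A (cMon_forget T)"
proof (rule fp_functor_additive[OF T.additive_cMon])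
  show "fp_functor (cMon T) A (cMon_forget T)" using T.cMon_forget_fp by simp
qed unfold_locales

end

section \<open>Functors into the category of commutative monoids\<close>

lemma (in cat_functor) comp_func_assoc:
  "comp_func A H (comp_func A G F) = comp_func A (comp_func B H G) F"
proof -
  have "(\<lambda>a\<in>Obj A. omap H (omap (comp_func A G F) a)) = (\<lambda>a\<in>Obj A. omap (comp_func B H G) (omap F a))"
    by (rule restrict_ext) (simp add: comp_func_def omap_Obj)
  moreover have "(\<lambda>f\<in>Arr A. amap H (amap (comp_func A G F) f)) = (\<lambda>f\<in>Arr A. amap (comp_func B H G) (amap F f))"
  proof (rule restrict_ext)
    fix f assume f: "f \<in> Arr A"
    note F = amap_Hom[OF src.Arr_Hom[OF f]]
    show "amap H (amap (comp_func A G F) f) = amap (comp_func B H G) (amap F f)"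
      by (simp add: src.comp_func_apply(2)[OF src.Arr_Hom[OF f]] tgt.comp_func_apply(2)[OF F])
  qed
  ultimately show ?thesis by (simp add: comp_func_def[of A H] comp_func_def[of A _ F])
qed

lemma (in cat_functor) comp_func_id:
  "comp_func A F (id_func A) = F" "comp_func A (id_func B) F = F"
proof -
  have fA: "f \<in> Arr A" if "f \<in> Hom A a b" for f a b using src.HomD[OF that] by simp
  show "comp_func A F (id_func A) = F"
    by (rule functor_eqI[OF comp_func_functor[OF id_func_functor[OF src.category_axioms] cat_functor_axioms] cat_functor_axioms])
      (simp_all add: src.comp_func_apply src.id_func_apply)
  show "comp_func A (id_func B) F = F"
    by (rule functor_eqI[OF comp_func_functor[OF cat_functor_axioms id_func_functor[OF tgt.category_axioms]] cat_functor_axioms])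
      (simp_all add: src.comp_func_apply tgt.id_func_apply omap_Obj tgt.id_func_apply(2)[OF amap_Hom])
qed

text \<open>An additive functor to \<open>cMon C\<close> is determined by its composite with the forgetful functor,
  because the monoid structure on the image of \<open>X\<close> is the image of that of \<open>X\<close> itself.\<close>

lemma additive_functor_to_cMon:
  assumes A: "additive_category A" and C: "fp_category C" and G: "additive_functor A (cMon C) G"
  shows "G = comp_func A (cMon_map (cat.truncate A) C (comp_func A (cMon_forget C) G)) (cMon_unit A)"
    and "fp_functor A C (comp_func A (cMon_forget C) G)"
proof -
  interpret A: uadditive_category A using A by (simp add: uadditive_category_def)
  interpret C: ufp_category C using C by (simp add: ufp_category_def)
  interpret CA: additive_category "cMon C" by (rule C.additive_cMon)
  interpret G: additive_functor A "cMon C" G by fact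
  let ?F = "comp_func A (cMon_forget C) G"
  have fpG: "fp_functor A (cMon C) G"
    by (rule additive_functor_fp[OF G]) unfold_locales
  show fpF: "fp_functor A C ?F"
    by (rule comp_func_fp_functor[OF fpG C.cMon_forget_fp])
  interpret F: ufp_functor A.T C ?F using fpF by (simp add: ufp_functor_def)
  interpret E: additive_functor A "cMon A.T" "cMon_unit A" by (rule A.cMon_unit_additive)
  have Fa: "omap ?F a = t1 (omap G a)" if "a \<in> Obj A" for a
    using that G.omap_Obj[OF that] by (simp add: A.comp_func_apply cMon_forget_def)
  have Ff: "amap ?F f = t2 (amap G f)" if "f \<in> Hom A a b" for f a b
    using C.cMon_forget_Hom[OF G.amap_Hom[OF that]] by (simp add: A.comp_func_apply(2)[OF that])
  have ob: "omap G a = F.transport (unit_ob A a)" if a: "a \<in> Obj A" for a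
  proof (rule F.transport_unique[OF A.unit_ob_Obj[OF a]], unfold truncate_products A.t1_unit_ob)
    note p = A.proj2_Hom[OF a a] and I = A.is_productD(2)[OF A.chosen_is_product[of "[]"]]
    have P: "prod_ob A [a, a] \<in> Obj A" using p A.Hom_Obj by blast
    show "omap G a \<in> cMon_Obj C" using G.omap_Obj[OF a] by simp
    show "t1 (omap G a) = omap ?F a" using Fa[OF a] by simp
    show "gm C (omap G a) (omap ?F (prod_ob A [a, a])) (amap ?F (projs A [a, a] ! 0)) (amap ?F (projs A [a, a] ! Suc 0)) =
        amap ?F (t2 (unit_ob A a))"
      using G.amap_HAdd[OF p] C.cMon_HAdd[OF G.amap_Hom[OF p(1)] G.amap_Hom[OF p(2)]]
      by (simp add: unit_ob_def Ff[OF A.HAdd_Hom[OF p]] Ff[OF p(1)] Ff[OF p(2)] Fa[OF P])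
    show "gu C (omap G a) (omap ?F (prod_ob A [])) = amap ?F (t3 (unit_ob A a))"
      using G.amap_HZero[OF I a] C.cMon_HZero[of "omap G (prod_ob A [])" "omap G a"] G.omap_Obj[OF I] G.omap_Obj[OF a]
      by (simp add: unit_ob_def Ff[OF A.HZero_Hom[OF I a]] Fa[OF I])
  qed
  show "G = comp_func A (cMon_map A.T C ?F) (cMon_unit A)"
  proof (rule functor_eqI[OF G.cat_functor_axioms comp_func_functor[OF E.cat_functor_axioms F.cMon_map_functor]])
    show "omap G a = omap (comp_func A (cMon_map A.T C ?F) (cMon_unit A)) a" if "a \<in> Obj A" for a
      using ob[OF that] that by (simp add: A.comp_func_apply A.cMon_unit_apply)
    show "amap G f = amap (comp_func A (cMon_map A.T C ?F) (cMon_unit A)) f" if f: "f \<in> Hom A a b" for f a b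
    proof -
      note O = A.Hom_Obj[OF f]
      have "amap G f = Triple (omap G a) (t2 (amap G f)) (omap G b)"
        using G.amap_Hom[OF f] unfolding C.Hom_cMon by simp
      then show ?thesis
        using F.cMon_map_amap[OF A.unit_arr_Hom[OF f]] ob[OF O(1)] ob[OF O(2)] Ff[OF f]
        by (simp add: A.comp_func_apply(2)[OF f] A.cMon_unit_apply(2)[OF f])
    qed
  qed
qed

text \<open>The other half of the bijection. \<open>cMon_forget_natural\<close> moves the forgetful
  functor past \<open>cMon_map\<close>, where \<open>forget_unit\<close> cancels it against the
  unit.\<close>

lemma fp_functor_lift:
  assumes A: "additive_category A" and C: "fp_category C" and F: "fp_functor A C F"
  shows "additive_functor A (cMon C) (comp_func A (cMon_map (cat.truncate A) C F) (cMon_unit A))"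
    and "comp_func A (cMon_forget C) (comp_func A (cMon_map (cat.truncate A) C F) (cMon_unit A)) = F"
proof -
  interpret A: uadditive_category A using A by (simp add: uadditive_category_def)
  interpret F: ufp_functor A.T C F using F by (simp add: ufp_functor_def)
  interpret E: additive_functor A "cMon A.T" "cMon_unit A" by (rule A.cMon_unit_additive)
  interpret U: cat_functor "cMon A.T" A "cMon_forget A.T"
    using A.T.cMon_forget_functor by simp
  interpret F': fp_functor A C F by fact
  show "additive_functor A (cMon C) (comp_func A (cMon_map A.T C F) (cMon_unit A))"
    by (rule comp_func_additive[OF A.cMon_unit_additive F.cMon_map_additive])
  have "comp_func A (cMon_forget C) (comp_func A (cMon_map A.T C F) (cMon_unit A)) =
      comp_func A (comp_func (cMon A.T) F (cMon_forget A.T)) (cMon_unit A)"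
    unfolding E.comp_func_assoc using cMon_forget_natural[of A.T C F] F by simp
  also have "\<dots> = comp_func A F (comp_func A (cMon_forget A.T) (cMon_unit A))"
    by (rule E.comp_func_assoc[symmetric])
  also have "\<dots> = F" unfolding A.forget_unit by (rule F'.comp_func_id)
  finally show "comp_func A (cMon_forget C) (comp_func A (cMon_map A.T C F) (cMon_unit A)) = F" .
qed

section \<open>The coreflection\<close>

lemma Hom_category_of_categories:
  "f \<in> Hom (category_of_categories K P) A B \<longleftrightarrow> A \<in> K \<and> B \<in> K \<and> (\<exists>F. f = (A, F, B) \<and> P A B F)"
  by (auto simp: Hom_def category_of_categories_def Let_def)

lemma Obj_category_of_categories [simp]: "Obj (category_of_categories K P) = K"
  by (simp add: category_of_categories_def Let_def)

lemma Ident_category_of_categories: "A \<in> K \<Longrightarrow> Ident (category_of_categories K P) A = (A, id_func A, A)"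
  by (simp add: category_of_categories_def Let_def)

lemma Comp_category_of_categories:
  "\<lbrakk>A \<in> K; B \<in> K; C \<in> K; P A B F; P B C G\<rbrakk> \<Longrightarrow>
    (B, G, C) \<cdot>\<^bsub>category_of_categories K P\<^esub> (A, F, B) = (A, comp_func A G F, C)"
  by (simp add: category_of_categories_def Let_def)

lemma category_of_categories_category:
  assumes "\<And>A. A \<in> K \<Longrightarrow> category A"
    and func: "\<And>A B F. P A B F \<Longrightarrow> cat_functor A B F"
    and id: "\<And>A. A \<in> K \<Longrightarrow> P A A (id_func A)"
    and comp: "\<And>A B C F G. \<lbrakk>P A B F; P B C G\<rbrakk> \<Longrightarrow> P A C (comp_func A G F)"
  shows "category (category_of_categories K P)"
proof
  let ?C = "category_of_categories K P"
  show "Dom ?C f \<in> Obj ?C" "Cod ?C f \<in> Obj ?C" if "f \<in> Arr ?C" for f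
    using that by (auto simp: category_of_categories_def Let_def)
  show "Ident ?C a \<in> Hom ?C a a" if "a \<in> Obj ?C" for a
    using that id by (simp add: Ident_category_of_categories Hom_category_of_categories)
  show "g \<cdot>\<^bsub>?C\<^esub> f \<in> Hom ?C a c" if "f \<in> Hom ?C a b" "g \<in> Hom ?C b c" for f g a b c
    using that comp by (auto simp: Hom_category_of_categories Comp_category_of_categories)
  show "Ident ?C b \<cdot>\<^bsub>?C\<^esub> f = f" "f \<cdot>\<^bsub>?C\<^esub> Ident ?C a = f" if "f \<in> Hom ?C a b" for f a b
    using that id cat_functor.comp_func_id[OF func]
    by (auto simp: Hom_category_of_categories Comp_category_of_categories Ident_category_of_categories)
  show "(h \<cdot>\<^bsub>?C\<^esub> g) \<cdot>\<^bsub>?C\<^esub> f = h \<cdot>\<^bsub>?C\<^esub> (g \<cdot>\<^bsub>?C\<^esub> f)"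
    if "f \<in> Hom ?C a b" "g \<in> Hom ?C b c" "h \<in> Hom ?C c d" for f g h a b c d
  proof -
    obtain F G H where FGH: "P a b F" "P b c G" "P c d H"
      and eq: "f = (a, F, b)" "g = (b, G, c)" "h = (c, H, d)" "a \<in> K" "b \<in> K" "c \<in> K" "d \<in> K"
      using \<open>f \<in> Hom ?C a b\<close> \<open>g \<in> Hom ?C b c\<close> \<open>h \<in> Hom ?C c d\<close>
      by (auto simp: Hom_category_of_categories)
    have "comp_func a H (comp_func a G F) = comp_func a (comp_func b H G) F"
      by (rule cat_functor.comp_func_assoc[OF func[OF FGH(1)]])
    then show ?thesis
      by (simp add: eq FGH comp[OF FGH(1,2)] comp[OF FGH(2,3)] Comp_category_of_categories)
  qed
  show "Dom ?C \<in> extensional (Arr ?C)" "Cod ?C \<in> extensional (Arr ?C)" "Ident ?C \<in> extensional (Obj ?C)"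
    by (simp_all add: category_of_categories_def Let_def)
  show "g \<cdot>\<^bsub>?C\<^esub> f = undefined" if "\<not> (f \<in> Arr ?C \<and> g \<in> Arr ?C \<and> Cod ?C f = Dom ?C g)" for f g
    using that by (cases f, cases g) (auto simp: category_of_categories_def Let_def)
qed

lemma category_fpCat: "category fpCat"
  unfolding fpCat_def
proof (rule category_of_categories_category)
  show "category A" if "A \<in> {C. fp_category C}" for A :: "'a ucat"
    using that by (simp add: fp_category_def)
  show "cat_functor A B F" if "fp_functor A B F" for A B :: "'a ucat" and F
    using that by (simp add: fp_functor_def)
qed (simp_all add: id_func_fp_functor comp_func_fp_functor)

lemma category_AddCat: "category AddCat"
  unfolding AddCat_def
proof (rule category_of_categories_category)
  show "category A" "additive_functor A A (id_func A)" if "A \<in> {A. additive_category A}" for A :: "'a uacat"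
    using that id_func_additive[of A] by (simp_all add: additive_category_def preadditive_category_def)
  show "cat_functor A B F" if "additive_functor A B F" for A B :: "'a uacat" and F
    using that by (simp add: additive_functor_def)
qed (simp_all add: comp_func_additive)

lemma Obj_fpCat [simp]: "Obj fpCat = {C. fp_category C}"
  by (simp add: fpCat_def)

lemma Obj_AddCat [simp]: "Obj AddCat = {A. additive_category A}"
  by (simp add: AddCat_def)

lemma Hom_fpCat: "f \<in> Hom fpCat C D \<longleftrightarrow> (\<exists>F. f = (C, F, D) \<and> fp_functor C D F)"
  unfolding fpCat_def Hom_category_of_categories by (auto simp: fp_functor_def)

lemma Hom_AddCat: "f \<in> Hom AddCat A B \<longleftrightarrow>
    additive_category A \<and> additive_category B \<and> (\<exists>F. f = (A, F, B) \<and> additive_functor A B F)"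
  unfolding AddCat_def Hom_category_of_categories by auto

lemma Comp_fpCat: "\<lbrakk>fp_functor C D F; fp_functor D E G\<rbrakk> \<Longrightarrow> (D, G, E) \<cdot>\<^bsub>fpCat\<^esub> (C, F, D) = (C, comp_func C G F, E)"
  unfolding fpCat_def by (rule Comp_category_of_categories) (auto simp: fp_functor_def)

lemma Comp_AddCat:
  "\<lbrakk>additive_category A; additive_category B; additive_category C; additive_functor A B F; additive_functor B C G\<rbrakk> \<Longrightarrow>
    (B, G, C) \<cdot>\<^bsub>AddCat\<^esub> (A, F, B) = (A, comp_func A G F, C)"
  unfolding AddCat_def by (rule Comp_category_of_categories) auto

lemma Ident_fpCat: "fp_category C \<Longrightarrow> Ident fpCat C = (C, id_func C, C)"
  unfolding fpCat_def by (rule Ident_category_of_categories) simp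

lemma Ident_AddCat: "additive_category A \<Longrightarrow> Ident AddCat A = (A, id_func A, A)"
  unfolding AddCat_def by (rule Ident_category_of_categories) simp

lemma additive_category_fp: "additive_category A \<Longrightarrow> fp_category A"
  by (simp add: additive_category_def)

section \<open>The inclusion of additive categories in finite product categories\<close>

lemma additive_iff_fp_functor:
  assumes "additive_category A" "additive_category B"
  shows "additive_functor A B F \<longleftrightarrow> fp_functor A B F"
  using assms additive_functor_fp fp_functor_additive additive_category_fp by metis

lemma inclusion_ob: "additive_category A \<Longrightarrow> omap inclusion A = cat.truncate A"
  by (simp add: inclusion_def)

lemma inclusion_arr:
  "\<lbrakk>additive_category A; additive_category B; additive_functor A B F\<rbrakk> \<Longrightarrow>
    amap inclusion (A, F, B) = (cat.truncate A, F, cat.truncate B)"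
  using Hom_AddCat[of "(A, F, B)" A B] by (auto simp: inclusion_def Hom_def)

lemma inclusion_functor: "cat_functor AddCat fpCat inclusion"
proof (intro cat_functor.intro category_AddCat category_fpCat cat_functor_axioms.intro)
  show "omap inclusion a \<in> Obj fpCat" if "a \<in> Obj AddCat" for a :: "'a uacat"
    using that additive_category_fp by (simp add: inclusion_ob)
  show "amap inclusion f \<in> Hom fpCat (omap inclusion a) (omap inclusion b)" if "f \<in> Hom AddCat a b"
    for a b :: "'a uacat" and f
    using that by (auto simp: Hom_AddCat Hom_fpCat inclusion_ob inclusion_arr additive_iff_fp_functor[symmetric])
  show "amap inclusion (Ident AddCat a) = Ident fpCat (omap inclusion a)" if "a \<in> Obj AddCat" for a :: "'a uacat"
  proof -
    have a: "additive_category a" using that by simp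
    then have "additive_functor a a (id_func a)" by (intro id_func_additive) (simp add: additive_category_def)
    then show ?thesis using a additive_category_fp[OF a]
      by (simp add: inclusion_ob inclusion_arr Ident_AddCat Ident_fpCat)
  qed
  show "amap inclusion (g \<cdot>\<^bsub>AddCat\<^esub> f) = amap inclusion g \<cdot>\<^bsub>fpCat\<^esub> amap inclusion f"
    if "f \<in> Hom AddCat a b" "g \<in> Hom AddCat b c" for a b c :: "'a uacat" and f g
    using that
    by (auto simp: Hom_AddCat Comp_AddCat inclusion_arr comp_func_additive additive_iff_fp_functor Comp_fpCat
      comp_func_fp_functor)
qed (simp_all add: inclusion_def)

lemma inclusion_full: "full_functor AddCat fpCat inclusion"
  unfolding full_functor_def
proof (intro ballI subsetI)
  fix A B :: "'a uacat" and f
  assume AB: "A \<in> Obj AddCat" "B \<in> Obj AddCat" and "f \<in> Hom fpCat (omap inclusion A) (omap inclusion B)"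
  then obtain F where F: "f = (cat.truncate A, F, cat.truncate B)" "fp_functor A B F"
    by (auto simp: Hom_fpCat inclusion_ob)
  then have "additive_functor A B F" using AB by (simp add: additive_iff_fp_functor)
  then show "f \<in> amap inclusion ` Hom AddCat A B"
    using AB F by (intro image_eqI[of _ _ "(A, F, B)"]) (simp_all add: inclusion_arr Hom_AddCat)
qed

lemma inclusion_faithful: "faithful_functor AddCat inclusion"
  unfolding faithful_functor_def by (auto simp: inj_on_def Hom_AddCat inclusion_arr)

lemma inclusion_inj: "inj_on (omap inclusion) (Obj AddCat)"
  using additive_structure_unique by (auto simp: inj_on_def inclusion_ob)

section \<open>The commutative monoids construction as a functor\<close>

lemma additive_cMon: "fp_category C \<Longrightarrow> additive_category (cMon C)"
  using ufp_category.additive_cMon by (simp add: ufp_category_def)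

lemma cMon_map_additive: "fp_functor C D F \<Longrightarrow> additive_functor (cMon C) (cMon D) (cMon_map C D F)"
  using ufp_functor.cMon_map_additive by (simp add: ufp_functor_def)

lemma cMon_functor_ob: "fp_category C \<Longrightarrow> omap cMon_functor C = cMon C"
  by (simp add: cMon_functor_def)

lemma cMon_functor_arr: "fp_functor C D F \<Longrightarrow> amap cMon_functor (C, F, D) = (cMon C, cMon_map C D F, cMon D)"
  using Hom_fpCat[of "(C, F, D)" C D] by (simp add: cMon_functor_def Hom_def)

lemma fp_functorD: "fp_functor C D F \<Longrightarrow> fp_category C" "fp_functor C D F \<Longrightarrow> fp_category D"
  by (simp_all add: fp_functor_def)

lemma cMon_functor_functor: "cat_functor fpCat AddCat cMon_functor"
proof (intro cat_functor.intro category_AddCat category_fpCat cat_functor_axioms.intro)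
  show "omap cMon_functor a \<in> Obj AddCat" if "a \<in> Obj fpCat" for a :: "'a ucat"
    using that additive_cMon by (simp add: cMon_functor_ob)
  show "amap cMon_functor f \<in> Hom AddCat (omap cMon_functor a) (omap cMon_functor b)" if "f \<in> Hom fpCat a b"
    for a b :: "'a ucat" and f
  proof -
    obtain F where F: "f = (a, F, b)" "fp_functor a b F" using \<open>f \<in> Hom fpCat a b\<close> by (auto simp: Hom_fpCat)
    then show ?thesis
      using fp_functorD[OF F(2)]
      by (simp add: Hom_AddCat cMon_functor_arr cMon_functor_ob additive_cMon cMon_map_additive)
  qed
  show "amap cMon_functor (Ident fpCat a) = Ident AddCat (omap cMon_functor a)" if "a \<in> Obj fpCat" for a :: "'a ucat"
    using that ufp_category.cMon_map_id[of a]
    by (simp add: Ident_fpCat Ident_AddCat cMon_functor_arr cMon_functor_ob additive_cMon id_func_fp_functor ufp_category_def)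
  show "amap cMon_functor (g \<cdot>\<^bsub>fpCat\<^esub> f) = amap cMon_functor g \<cdot>\<^bsub>AddCat\<^esub> amap cMon_functor f"
    if "f \<in> Hom fpCat a b" "g \<in> Hom fpCat b c" for a b c :: "'a ucat" and f g
  proof -
    obtain F G where FG: "f = (a, F, b)" "g = (b, G, c)" "fp_functor a b F" "fp_functor b c G"
      using \<open>f \<in> Hom fpCat a b\<close> \<open>g \<in> Hom fpCat b c\<close> by (auto simp: Hom_fpCat)
    have "additive_category (cMon a)" "additive_category (cMon b)" "additive_category (cMon c)"
      using FG by (auto intro: additive_cMon dest: fp_functorD)
    then show ?thesis
      using FG comp_func_fp_functor[OF FG(3,4)] cMon_map_comp[OF FG(3,4)]
      by (simp add: Comp_fpCat cMon_functor_arr Comp_AddCat cMon_map_additive)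
  qed
qed (simp_all add: cMon_functor_def)

text \<open>The transpose of \<open>F\<close> under the adjunction.\<close>

definition cMon_lift :: "'a uacat \<Rightarrow> 'a ucat \<Rightarrow> 'a ufunc \<Rightarrow> 'a ufunc" where
  "cMon_lift A C F = comp_func A (cMon_map (cat.truncate A) C F) (cMon_unit A)"

text \<open>Hom sets are matched by composition with the forgetful functor:
  \<open>additive_functor_to_cMon\<close> and \<open>fp_functor_lift\<close> say that lifting and
  forgetting are mutually inverse.\<close>

lemma cMon_adjunction: "right_adjoint AddCat fpCat inclusion cMon_functor"
proof -
  \<comment> \<open>Arrows of both categories are triples carrying their ends, so the bijection and
    its inverse also replace the ends.\<close>
  let ?\<phi> = "\<lambda>A C (L, F, C'). (A, cMon_lift A C F, cMon C)"
  let ?\<psi> = "\<lambda>A C (A', G, C'). (cat.truncate A, comp_func A (cMon_forget C) G, C)"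
  note toC = additive_functor_to_cMon[folded cMon_lift_def] and lift = fp_functor_lift[folded cMon_lift_def]
  have bij: "bij_betw (?\<phi> A C) (Hom fpCat (omap inclusion A) C) (Hom AddCat A (omap cMon_functor C))"
    if A: "A \<in> Obj AddCat" and C: "C \<in> Obj fpCat" for A :: "'a uacat" and C
  proof -
    have A': "additive_category A" and C': "fp_category C" using A C by simp_all
    note C'' = additive_cMon[OF C']
    show ?thesis
    proof (rule bij_betw_byWitness[of _ "?\<psi> A C"])
      show "\<forall>f\<in>Hom fpCat (omap inclusion A) C. ?\<psi> A C (?\<phi> A C f) = f"
        using lift(2)[OF A' C'] by (auto simp: inclusion_ob A' Hom_fpCat)
      show "\<forall>g\<in>Hom AddCat A (omap cMon_functor C). ?\<phi> A C (?\<psi> A C g) = g"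
        using toC(1)[OF A' C'] by (auto simp: cMon_functor_ob C' Hom_AddCat)
      show "?\<phi> A C ` Hom fpCat (omap inclusion A) C \<subseteq> Hom AddCat A (omap cMon_functor C)"
        using lift(1)[OF A' C'] by (auto simp: inclusion_ob cMon_functor_ob A' C' C'' Hom_AddCat Hom_fpCat)
      show "?\<psi> A C ` Hom AddCat A (omap cMon_functor C) \<subseteq> Hom fpCat (omap inclusion A) C"
        using toC(2)[OF A' C'] by (auto simp: inclusion_ob cMon_functor_ob A' C' Hom_AddCat Hom_fpCat)
    qed
  qed
  have nat: "?\<phi> A' C' (g \<cdot>\<^bsub>fpCat\<^esub> h \<cdot>\<^bsub>fpCat\<^esub> amap inclusion f) = amap cMon_functor g \<cdot>\<^bsub>AddCat\<^esub> ?\<phi> A C h \<cdot>\<^bsub>AddCat\<^esub> f"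
    if "A \<in> Obj AddCat" "A' \<in> Obj AddCat" "C \<in> Obj fpCat" "C' \<in> Obj fpCat"
      and f: "f \<in> Hom AddCat A' A" and g: "g \<in> Hom fpCat C C'" and h: "h \<in> Hom fpCat (omap inclusion A) C"
    for A A' :: "'a uacat" and C C' f g h
  proof -
    have A: "additive_category A" and A': "additive_category A'" and C: "fp_category C" and C': "fp_category C'"
      using that by simp_all
    obtain F where F: "f = (A', F, A)" "additive_functor A' A F" using f by (auto simp: Hom_AddCat)
    obtain G where G: "g = (C, G, C')" "fp_functor C C' G" using g by (auto simp: Hom_fpCat)
    obtain H where H: "h = (cat.truncate A, H, C)" "fp_functor A C H" using h A by (auto simp: Hom_fpCat inclusion_ob)
    have fpF: "fp_functor A' A F" using F A A' additive_iff_fp_functor by blast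
    note HF = comp_func_fp_functor[OF fpF H(2)]
    note RG = cMon_map_additive[OF G(2)] and LH = lift(1)[OF A C H(2)]
    note LHF = comp_func_additive[OF F(2) LH]
    \<comment> \<open>An additive functor into \<open>cMon C'\<close> is recovered from its
      composite with the forgetful functor, so the naturality equation is proved after
      forgetting.\<close>
    let ?K = "comp_func A' (cMon_map C C' G) (comp_func A' (cMon_lift A C H) F)"
    have K: "additive_functor A' (cMon C') ?K" by (rule comp_func_additive[OF LHF RG])
    interpret F: additive_functor A' A F by (rule F)
    interpret LH: additive_functor A "cMon C" "cMon_lift A C H" by (rule LH)
    interpret LHF: additive_functor A' "cMon C" "comp_func A' (cMon_lift A C H) F" by (rule LHF)
    have "comp_func A' (cMon_forget C') ?K =
        comp_func A' (comp_func (cMon C) G (cMon_forget C)) (comp_func A' (cMon_lift A C H) F)"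
      unfolding LHF.comp_func_assoc cMon_forget_natural[OF G(2)] ..
    also have "\<dots> = comp_func A' G (comp_func A' (comp_func A (cMon_forget C) (cMon_lift A C H)) F)"
      using LHF.comp_func_assoc[of G "cMon_forget C"] F.comp_func_assoc[of "cMon_forget C" "cMon_lift A C H"]
      by simp
    also have "\<dots> = comp_func A' G (comp_func A' H F)" unfolding lift(2)[OF A C H(2)] ..
    finally have "?K = cMon_lift A' C' (comp_func A' G (comp_func A' H F))"
      using toC(1)[OF A' C' K] by simp
    then show ?thesis
      using F(1) G(1) H(1) A A' HF fpF additive_cMon[OF C] additive_cMon[OF C'] RG LH LHF F(2) G(2) H(2)
      by (simp add: inclusion_arr Comp_fpCat cMon_functor_arr Comp_AddCat)
  qed
  show ?thesis
    unfolding right_adjoint_def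
    by (intro conjI inclusion_functor cMon_functor_functor exI[of _ ?\<phi>] ballI bij nat)
qed

section \<open>Equivalences\<close>

lemma naturally_isomorphic_refl:
  assumes "cat_functor A B F"
  shows "naturally_isomorphic A B F F"
proof -
  interpret cat_functor A B F by fact
  have "is_iso B (omap F a) (omap F a) (Ident B (omap F a))" if "a \<in> Obj A" for a
    using tgt.Ident_Hom[OF omap_Obj[OF that]] tgt.Comp_Ident_left[OF tgt.Ident_Hom[OF omap_Obj[OF that]]]
    by (auto simp: is_iso_def)
  moreover have "Ident B (omap F b) \<cdot>\<^bsub>B\<^esub> amap F f = amap F f \<cdot>\<^bsub>B\<^esub> Ident B (omap F a)" if "f \<in> Hom A a b" for f a b
    using amap_Hom[OF that] by (simp add: tgt.Comp_Ident_left tgt.Comp_Ident_right)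
  ultimately show ?thesis
    unfolding naturally_isomorphic_def by (intro exI[of _ "\<lambda>a. Ident B (omap F a)"]) blast
qed

lemma (in category) naturally_isomorphic_idD:
  assumes "naturally_isomorphic C C (comp_func C G F) (id_func C)"
  shows "\<exists>\<tau>. (\<forall>a\<in>Obj C. is_iso C (omap G (omap F a)) a (\<tau> a)) \<and>
    (\<forall>a b. \<forall>f\<in>Hom C a b. \<tau> b \<cdot> amap G (amap F f) = f \<cdot> \<tau> a)"
proof -
  obtain \<tau> where \<tau>: "\<forall>a\<in>Obj C. is_iso C (omap (comp_func C G F) a) (omap (id_func C) a) (\<tau> a)"
    "\<forall>a\<in>Obj C. \<forall>b\<in>Obj C. \<forall>f\<in>Hom C a b. \<tau> b \<cdot> amap (comp_func C G F) f = amap (id_func C) f \<cdot> \<tau> a"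
    using assms unfolding naturally_isomorphic_def by blast
  show ?thesis
  proof (intro exI conjI ballI allI)
    show "is_iso C (omap G (omap F a)) a (\<tau> a)" if "a \<in> Obj C" for a
      using \<tau>(1) that by (simp add: comp_func_apply id_func_apply)
    show "\<tau> b \<cdot> amap G (amap F f) = f \<cdot> \<tau> a" if "f \<in> Hom C a b" for f a b
    proof -
      have "\<tau> b \<cdot> amap (comp_func C G F) f = amap (id_func C) f \<cdot> \<tau> a"
        using \<tau>(2) that Hom_Obj[OF that] by blast
      then show ?thesis by (simp add: comp_func_apply(2)[OF that] id_func_apply(2)[OF that])
    qed
  qed
qed

text \<open>Naturality writes the composite of \<open>f\<close> with \<open>\<tau> a\<close> in
  terms of \<open>amap G (amap F f)\<close>, and the isomorphism \<open>\<tau> a\<close> can be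
  cancelled.\<close>

lemma inj_on_amap_if_left_inverse:
  assumes F: "cat_functor A B F" and G: "cat_functor B A G"
    and iso: "naturally_isomorphic A A (comp_func A G F) (id_func A)" and ab: "a \<in> Obj A" "b \<in> Obj A"
  shows "inj_on (amap F) (Hom A a b)"
proof (rule inj_onI)
  interpret A: category A using F by (simp add: cat_functor_def)
  fix f g assume f: "f \<in> Hom A a b" and g: "g \<in> Hom A a b" and eq: "amap F f = amap F g"
  obtain \<tau> where \<tau>: "\<forall>a\<in>Obj A. is_iso A (omap G (omap F a)) a (\<tau> a)"
      and nat': "\<forall>a b. \<forall>f\<in>Hom A a b. \<tau> b \<cdot>\<^bsub>A\<^esub> amap G (amap F f) = f \<cdot>\<^bsub>A\<^esub> \<tau> a"
      using A.naturally_isomorphic_idD[OF iso] by blast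
    have nat: "\<tau> b \<cdot>\<^bsub>A\<^esub> amap G (amap F f) = f \<cdot>\<^bsub>A\<^esub> \<tau> a" if "f \<in> Hom A a b" for f a b
      using nat' that by blast
  obtain j where t: "\<tau> a \<in> Hom A (omap G (omap F a)) a" and j: "j \<in> Hom A a (omap G (omap F a))" "\<tau> a \<cdot>\<^bsub>A\<^esub> j = Ident A a"
    using \<tau> ab(1) unfolding is_iso_def by blast
  have "k = (k \<cdot>\<^bsub>A\<^esub> \<tau> a) \<cdot>\<^bsub>A\<^esub> j" if "k \<in> Hom A a b" for k
    unfolding A.Comp_assoc[OF j(1) t that] j(2) A.Comp_Ident_right[OF that] ..
  from this[OF f] this[OF g] show "f = g" unfolding nat[OF f, symmetric] nat[OF g, symmetric] eq by (rule trans[OF _ sym])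
qed

lemma equivalence_fully_faithful:
  assumes F: "cat_functor A B F" and G: "cat_functor B A G"
    and GF: "naturally_isomorphic A A (comp_func A G F) (id_func A)"
    and FG: "naturally_isomorphic B B (comp_func B F G) (id_func B)"
    and ab: "a \<in> Obj A" "b \<in> Obj A"
  shows "bij_betw (amap F) (Hom A a b) (Hom B (omap F a) (omap F b))"
proof (rule bij_betw_imageI)
  interpret F: cat_functor A B F by fact
  interpret G: cat_functor B A G by fact
  show "inj_on (amap F) (Hom A a b)" using F G GF ab by (rule inj_on_amap_if_left_inverse)
  show "amap F ` Hom A a b = Hom B (omap F a) (omap F b)"
  proof (intro equalityI subsetI)
    fix h assume h: "h \<in> Hom B (omap F a) (omap F b)"
    obtain \<tau> where \<tau>: "\<forall>a\<in>Obj A. is_iso A (omap G (omap F a)) a (\<tau> a)"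
      and nat': "\<forall>a b. \<forall>f\<in>Hom A a b. \<tau> b \<cdot>\<^bsub>A\<^esub> amap G (amap F f) = f \<cdot>\<^bsub>A\<^esub> \<tau> a"
      using F.src.naturally_isomorphic_idD[OF GF] by blast
    have nat: "\<tau> b \<cdot>\<^bsub>A\<^esub> amap G (amap F f) = f \<cdot>\<^bsub>A\<^esub> \<tau> a" if "f \<in> Hom A a b" for f a b
      using nat' that by blast
    obtain j where ta: "\<tau> a \<in> Hom A (omap G (omap F a)) a" and j: "j \<in> Hom A a (omap G (omap F a))" "j \<cdot>\<^bsub>A\<^esub> \<tau> a = Ident A (omap G (omap F a))"
      using \<tau> ab(1) unfolding is_iso_def by blast
    obtain k where tb: "\<tau> b \<in> Hom A (omap G (omap F b)) b" and k: "k \<in> Hom A b (omap G (omap F b))" "k \<cdot>\<^bsub>A\<^esub> \<tau> b = Ident A (omap G (omap F b))"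
      using \<tau> ab(2) unfolding is_iso_def by blast
    note Gh = G.amap_Hom[OF h]
    \<comment> \<open>The preimage of \<open>h\<close>: its image under \<open>G\<close>, conjugated
      by the natural isomorphism.\<close>
    define f where "f = (\<tau> b \<cdot>\<^bsub>A\<^esub> amap G h) \<cdot>\<^bsub>A\<^esub> j"
    note th = F.src.Comp_Hom[OF Gh tb]
    have f: "f \<in> Hom A a b" unfolding f_def by (rule F.src.Comp_Hom[OF j(1) th])
    note GFf = G.amap_Hom[OF F.amap_Hom[OF f]]
    have cancel: "x = k \<cdot>\<^bsub>A\<^esub> (\<tau> b \<cdot>\<^bsub>A\<^esub> x)" if "x \<in> Hom A (omap G (omap F a)) (omap G (omap F b))" for x
      unfolding F.src.Comp_assoc[OF that tb k(1), symmetric] k(2) F.src.Comp_Ident_left[OF that] ..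
    have "\<tau> b \<cdot>\<^bsub>A\<^esub> amap G (amap F f) = \<tau> b \<cdot>\<^bsub>A\<^esub> amap G h"
      unfolding nat[OF f] unfolding f_def F.src.Comp_assoc[OF ta j(1) th] j(2) F.src.Comp_Ident_right[OF th] ..
    then have "amap G (amap F f) = amap G h" using cancel[OF GFf] cancel[OF Gh] by (simp only:)
    \<comment> \<open>\<open>G\<close> is faithful too, by the same lemma with \<open>F\<close> and
      \<open>G\<close> exchanged.\<close>
    then have "amap F f = h"
      using inj_on_amap_if_left_inverse[OF G F FG F.omap_Obj[OF ab(1)] F.omap_Obj[OF ab(2)]] F.amap_Hom[OF f] h
      by (auto dest: inj_onD)
    then show "h \<in> amap F ` Hom A a b" using f by blast
  qed (auto intro: F.amap_Hom)
qed

section \<open>Fully faithful functors: reflecting products and pulling back enrichments\<close>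

locale fully_faithful_functor = cat_functor A B F
  for A :: "('o, 'm, 'y) cat_scheme" and B :: "('p, 'n, 'z) cat_scheme" and F :: "('o, 'm, 'p, 'n) func" +
  assumes fully_faithful: "\<lbrakk>a \<in> Obj A; b \<in> Obj A\<rbrakk> \<Longrightarrow> bij_betw (amap F) (Hom A a b) (Hom B (omap F a) (omap F b))"
begin

lemma amap_cancel: "\<lbrakk>f \<in> Hom A a b; g \<in> Hom A a b; amap F f = amap F g\<rbrakk> \<Longrightarrow> f = g"
  using fully_faithful[of a b] src.Hom_Obj by (auto simp: bij_betw_def dest: inj_onD)

lemma amap_surj:
  assumes "h \<in> Hom B (omap F a) (omap F b)" "a \<in> Obj A" "b \<in> Obj A"
  obtains f where "f \<in> Hom A a b" "amap F f = h"
proof -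
  have "h \<in> amap F ` Hom A a b" using fully_faithful[OF assms(2,3)] assms(1) by (simp add: bij_betw_def)
  then show thesis using that by blast
qed

text \<open>Cones are sent to \<open>B\<close>, and the mediating arrows found there lift uniquely
  to \<open>A\<close>.\<close>

lemma reflects_products:
  assumes xs: "set xs \<subseteq> Obj A" and a: "a \<in> Obj A" and l: "length qs = length xs"
    and qs: "\<And>k. k < length xs \<Longrightarrow> qs ! k \<in> Hom A a (xs ! k)"
    and P: "is_product B (map (omap F) xs) (omap F a) (map (amap F) qs)"
  shows "is_product A xs a qs"
proof (rule src.is_productI[OF xs a l qs])
  let ?n = "length xs"
  fix c
  show "\<exists>h. h \<in> Hom A c a \<and> (\<forall>i<?n. qs ! i \<cdot>\<^bsub>A\<^esub> h = fs ! i)" if "is_cone A xs c fs" for fs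
  proof -
    have c: "c \<in> Obj A" and lf: "length fs = ?n" and fs: "\<And>i. i < ?n \<Longrightarrow> fs ! i \<in> Hom A c (xs ! i)"
      using that by (simp_all add: is_cone_def)
    have "is_cone B (map (omap F) xs) (omap F c) (map (amap F) fs)"
      using c lf fs by (simp add: is_cone_def omap_Obj amap_Hom)
    note m = tgt.mediator_unique[OF P this]
    obtain h where h: "h \<in> Hom A c a" "amap F h = mediator B (omap F a) (map (amap F) qs) (omap F c) (map (amap F) fs)"
      using amap_surj[OF m(1) c a] .
    have "qs ! i \<cdot>\<^bsub>A\<^esub> h = fs ! i" if i: "i < ?n" for i
      using m(2)[of i] i l lf h(2) amap_Comp[OF h(1) qs[OF i]]
      by (intro amap_cancel[OF src.Comp_Hom[OF h(1) qs[OF i]] fs[OF i]]) simp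
    then show ?thesis using h(1) by blast
  qed
  show "h = h'" if h: "h \<in> Hom A c a" "h' \<in> Hom A c a" and eq: "\<And>i. i < ?n \<Longrightarrow> qs ! i \<cdot>\<^bsub>A\<^esub> h = qs ! i \<cdot>\<^bsub>A\<^esub> h'" for h h'
  proof (rule amap_cancel[OF h tgt.product_ext[OF P amap_Hom[OF h(1)] amap_Hom[OF h(2)]]])
    fix i assume "i < length (map (omap F) xs)"
    then have i: "i < ?n" by simp
    show "map (amap F) qs ! i \<cdot>\<^bsub>B\<^esub> amap F h = map (amap F) qs ! i \<cdot>\<^bsub>B\<^esub> amap F h'"
      using i l amap_Comp[OF h(1) qs[OF i]] amap_Comp[OF h(2) qs[OF i]] eq[OF i] by simp
  qed
qed

text \<open>The product of the images in \<open>B\<close> is isomorphic to the image of some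
  \<open>a\<close>. Its projections, moved along this isomorphism, lift to \<open>A\<close> by
  fullness, and products are reflected.\<close>

lemma fp_category_if_essentially_surjective:
  assumes B: "fp_category B" and ess: "\<And>y. y \<in> Obj B \<Longrightarrow> \<exists>a\<in>Obj A. \<exists>i. is_iso B (omap F a) y i"
  shows "fp_category A"
proof
  interpret fB: fp_category B by fact
  fix xs assume xs: "set xs \<subseteq> Obj A"
  let ?n = "length xs"
  have "set (map (omap F) xs) \<subseteq> Obj B" using xs omap_Obj by auto
  then obtain p ps where P: "is_product B (map (omap F) xs) p ps" using fB.has_products by blast
  note D = tgt.is_productD[OF P]
  obtain a i j where a: "a \<in> Obj A" and ij: "i \<in> Hom B (omap F a) p" "j \<in> Hom B p (omap F a)"
    "j \<cdot>\<^bsub>B\<^esub> i = Ident B (omap F a)" "i \<cdot>\<^bsub>B\<^esub> j = Ident B p"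
    using ess[OF D(2)] by (auto simp: is_iso_def)
  have "\<exists>q. q \<in> Hom A a (xs ! k) \<and> amap F q = ps ! k \<cdot>\<^bsub>B\<^esub> i" if k: "k < ?n" for k
  proof -
    have "ps ! k \<cdot>\<^bsub>B\<^esub> i \<in> Hom B (omap F a) (omap F (xs ! k))" using tgt.Comp_Hom[OF ij(1) D(4)] k by simp
    moreover have "xs ! k \<in> Obj A" using xs k by auto
    ultimately show ?thesis using amap_surj[OF _ a] by metis
  qed
  then obtain q where q: "\<And>k. k < ?n \<Longrightarrow> q k \<in> Hom A a (xs ! k) \<and> amap F (q k) = ps ! k \<cdot>\<^bsub>B\<^esub> i" by metis
  have "is_product A xs a (map q [0..<?n])"
    by (rule reflects_products[OF xs a _ _ tgt.is_product_iso[OF P ij]]) (use q in simp_all)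
  then show "\<exists>p ps. is_product A xs p ps" by blast
qed

end

text \<open>An equivalence of bare categories gives \<open>A\<close> no enrichment, so one is taken
  from \<open>B\<close>: for fully faithful \<open>F\<close>, \<open>inv_into\<close> inverts
  \<open>amap F\<close> on each hom set.\<close>

definition pullback_enrichment ::
  "('o, 'm) cat \<Rightarrow> ('p, 'n) acat \<Rightarrow> ('o, 'm, 'p, 'n) func \<Rightarrow> ('o, 'm) acat" where
  "pullback_enrichment A B F =
     \<lparr>Obj = Obj A, Arr = Arr A, Dom = Dom A, Cod = Cod A, Ident = Ident A, Comp = Comp A,
      HAdd = (\<lambda>f g. if f \<in> Arr A \<and> g \<in> Arr A \<and> Dom A f = Dom A g \<and> Cod A f = Cod A g
        then inv_into (Hom A (Dom A f) (Cod A f)) (amap F) (HAdd B (amap F f) (amap F g)) else undefined),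
      HZero = (\<lambda>a b. if a \<in> Obj A \<and> b \<in> Obj A
        then inv_into (Hom A a b) (amap F) (HZero B (omap F a) (omap F b)) else undefined)\<rparr>"

text \<open>Since \<open>amap F\<close> is injective on hom sets and takes the new sums, zeros and
  the composites to those of \<open>B\<close>, the equational axioms can be checked in
  \<open>B\<close>.\<close>

lemma pullback_enrichment_preadditive:
  fixes A :: "('o, 'm) cat" and B :: "('p, 'n) acat"
  assumes "fully_faithful_functor A B F" "preadditive_category B"
  shows "preadditive_category (pullback_enrichment A B F)" and "cat.truncate (pullback_enrichment A B F) = A"
proof -
  interpret fully_faithful_functor A B F by fact
  interpret B: preadditive_category B by fact
  let ?A = "pullback_enrichment A B F"
  show trunc: "cat.truncate ?A = A"
    by (simp add: cat.truncate_def pullback_enrichment_def)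
  have sel: "Obj ?A = Obj A" "Arr ?A = Arr A" "Dom ?A = Dom A" "Cod ?A = Cod A" "Ident ?A = Ident A" "Comp ?A = Comp A"
    by (simp_all add: pullback_enrichment_def)
  have Hom: "Hom ?A = Hom A" by (simp add: Hom_def fun_eq_iff sel)
  have inv: "inv_into (Hom A a b) (amap F) h \<in> Hom A a b \<and> amap F (inv_into (Hom A a b) (amap F) h) = h"
    if "h \<in> Hom B (omap F a) (omap F b)" "a \<in> Obj A" "b \<in> Obj A" for a b h
    using that fully_faithful[OF that(2,3)] by (simp add: bij_betw_def inv_into_into f_inv_into_f)
  have add: "HAdd ?A f g \<in> Hom A a b" and Fadd: "amap F (HAdd ?A f g) = HAdd B (amap F f) (amap F g)"
    if "f \<in> Hom A a b" "g \<in> Hom A a b" for f g a b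
  proof -
    have "HAdd ?A f g = inv_into (Hom A a b) (amap F) (HAdd B (amap F f) (amap F g))"
      using that by (simp add: pullback_enrichment_def Hom_def)
    then show "HAdd ?A f g \<in> Hom A a b" "amap F (HAdd ?A f g) = HAdd B (amap F f) (amap F g)"
      using inv[OF B.HAdd_Hom[OF amap_Hom[OF that(1)] amap_Hom[OF that(2)]]] src.Hom_Obj[OF that(1)] by simp_all
  qed
  have zero: "HZero ?A a b \<in> Hom A a b" and Fzero: "amap F (HZero ?A a b) = HZero B (omap F a) (omap F b)"
    if "a \<in> Obj A" "b \<in> Obj A" for a b
    using inv[OF B.HZero_Hom[OF omap_Obj[OF that(1)] omap_Obj[OF that(2)]] that] that
    by (simp_all add: pullback_enrichment_def)
  note FC = amap_Comp and FH = amap_Hom and cmp = src.Comp_Hom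
  show "preadditive_category ?A"
  proof (intro preadditive_category.intro preadditive_category_axioms.intro; (unfold Hom sel)?)
    show "category ?A" using src.category_axioms trunc category_truncate[of ?A] by simp
    show "comm_monoid (hom_monoid ?A a b)" if ab: "a \<in> Obj A" "b \<in> Obj A" for a b
    proof (rule comm_monoidI; simp only: hom_monoid_def monoid.select_convs partial_object.select_convs Hom)
      show c: "HAdd ?A x y \<in> Hom A a b" if "x \<in> Hom A a b" "y \<in> Hom A a b" for x y using that by (rule add)
      show z: "HZero ?A a b \<in> Hom A a b" using ab by (rule zero)
      show "HAdd ?A (HAdd ?A x y) z = HAdd ?A x (HAdd ?A y z)"
        if "x \<in> Hom A a b" "y \<in> Hom A a b" "z \<in> Hom A a b" for x y z
        using that c B.HAdd_assoc[OF FH[OF that(1)] FH[OF that(2)] FH[OF that(3)]]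
        by (intro amap_cancel[of _ a b]) (simp_all add: Fadd[of _ a b])
      show "HAdd ?A (HZero ?A a b) x = x" if "x \<in> Hom A a b" for x
        using that c z B.HAdd_zero_left[OF FH[OF that]]
        by (intro amap_cancel[of _ a b]) (simp_all add: Fadd[of _ a b] Fzero ab)
      show "HAdd ?A x y = HAdd ?A y x" if "x \<in> Hom A a b" "y \<in> Hom A a b" for x y
        using that c B.HAdd_comm[OF FH[OF that(1)] FH[OF that(2)]]
        by (intro amap_cancel[of _ a b]) (simp_all add: Fadd[of _ a b])
    qed
    show "HAdd ?A g h \<cdot>\<^bsub>A\<^esub> f = HAdd ?A (g \<cdot>\<^bsub>A\<^esub> f) (h \<cdot>\<^bsub>A\<^esub> f)"
      if f: "f \<in> Hom A a b" and g: "g \<in> Hom A b c" and h: "h \<in> Hom A b c" for f g h a b c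
      using FC[OF f add[OF g h]] FC[OF f g] FC[OF f h] Fadd[OF g h] Fadd[OF cmp[OF f g] cmp[OF f h]]
        B.Comp_HAdd_left[OF FH[OF f] FH[OF g] FH[OF h]]
      by (intro amap_cancel[OF cmp[OF f add[OF g h]] add[OF cmp[OF f g] cmp[OF f h]]]) simp
    show "h \<cdot>\<^bsub>A\<^esub> HAdd ?A f g = HAdd ?A (h \<cdot>\<^bsub>A\<^esub> f) (h \<cdot>\<^bsub>A\<^esub> g)"
      if f: "f \<in> Hom A a b" and g: "g \<in> Hom A a b" and h: "h \<in> Hom A b c" for f g h a b c
      using FC[OF add[OF f g] h] FC[OF f h] FC[OF g h] Fadd[OF f g] Fadd[OF cmp[OF f h] cmp[OF g h]]
        B.Comp_HAdd_right[OF FH[OF f] FH[OF g] FH[OF h]]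
      by (intro amap_cancel[OF cmp[OF add[OF f g] h] add[OF cmp[OF f h] cmp[OF g h]]]) simp
    show "HZero ?A b c \<cdot>\<^bsub>A\<^esub> f = HZero ?A a c" if f: "f \<in> Hom A a b" and c: "c \<in> Obj A" for f a b c
    proof -
      note O = src.Hom_Obj[OF f]
      show ?thesis
        using FC[OF f zero[OF O(2) c]] Fzero[OF O(2) c] Fzero[OF O(1) c] B.Comp_HZero_left[OF FH[OF f] omap_Obj[OF c]]
        by (intro amap_cancel[OF cmp[OF f zero[OF O(2) c]] zero[OF O(1) c]]) simp
    qed
    show "h \<cdot>\<^bsub>A\<^esub> HZero ?A a b = HZero ?A a c" if a: "a \<in> Obj A" and h: "h \<in> Hom A b c" for a h b c
    proof -
      note O = src.Hom_Obj[OF h]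
      show ?thesis
        using FC[OF zero[OF a O(1)] h] Fzero[OF a O(1)] Fzero[OF a O(2)] B.Comp_HZero_right[OF omap_Obj[OF a] FH[OF h]]
        by (intro amap_cancel[OF cmp[OF zero[OF a O(1)] h] zero[OF a O(2)]]) simp
    qed
    show "HAdd ?A f g = undefined" if "\<not> (f \<in> Arr A \<and> g \<in> Arr A \<and> Dom A f = Dom A g \<and> Cod A f = Cod A g)" for f g
      using that by (auto simp: pullback_enrichment_def)
    show "HZero ?A a b = undefined" if "\<not> (a \<in> Obj A \<and> b \<in> Obj A)" for a b
      using that by (auto simp: pullback_enrichment_def)
  qed
qed

lemma equivalence_fp_category:
  assumes F: "cat_functor A B F" and G: "cat_functor B A G"
    and GF: "naturally_isomorphic A A (comp_func A G F) (id_func A)"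
    and FG: "naturally_isomorphic B B (comp_func B F G) (id_func B)"
    and B: "fp_category B"
  shows "fully_faithful_functor A B F" and "fp_category A"
proof -
  interpret F: cat_functor A B F by fact
  interpret G: cat_functor B A G by fact
  show "fully_faithful_functor A B F"
    by unfold_locales (rule equivalence_fully_faithful[OF F G GF FG])
  then interpret fully_faithful_functor A B F .
  \<comment> \<open>Essential surjectivity is witnessed by the components of the second natural
    isomorphism.\<close>
  have "is_iso B (omap F (omap G y)) y i" if "y \<in> Obj B" "is_iso B (omap (comp_func B F G) y) (omap (id_func B) y) i" for y i
    using that by (simp add: F.tgt.comp_func_apply F.tgt.id_func_apply)
  then show "fp_category A"
    using FG G.omap_Obj unfolding naturally_isomorphic_def
    by (intro fp_category_if_essentially_surjective[OF B]) blast
qed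

text \<open>\<open>cMon_unit\<close> and the forgetful functor are inverse on the nose, so
  identities serve as the natural isomorphisms.\<close>

lemma additive_category_equivalent_cMon:
  fixes A :: "'a uacat"
  assumes "additive_category A"
  shows "additively_equivalent A (cMon (cat.truncate A))" and "equivalent_categories A (cMon (cat.truncate A))"
proof -
  interpret A: uadditive_category A using assms by (simp add: uadditive_category_def)
  let ?E = "cMon_unit A" and ?U = "cMon_forget A.T"
  have E: "additive_functor A (cMon A.T) ?E" by (rule A.cMon_unit_additive)
  have U: "additive_functor (cMon A.T) A ?U" by (rule A.cMon_forget_additive)
  have "naturally_isomorphic A A (comp_func A ?U ?E) (id_func A)"
    unfolding A.forget_unit by (rule naturally_isomorphic_refl[OF id_func_functor[OF A.category_axioms]])
  moreover have "naturally_isomorphic (cMon A.T) (cMon A.T) (comp_func (cMon A.T) ?E ?U) (id_func (cMon A.T))"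
    unfolding A.unit_forget by (rule naturally_isomorphic_refl[OF id_func_functor[OF A.T.category_cMon]])
  ultimately show "additively_equivalent A (cMon A.T)" "equivalent_categories A (cMon A.T)"
    using E U unfolding additively_equivalent_def equivalent_categories_def additive_functor_def by blast+
qed

lemma equivalent_categories_truncate [simp]: "equivalent_categories (cat.truncate A) B = equivalent_categories A B"
  by (simp add: equivalent_categories_def naturally_isomorphic_def is_iso_def)

text \<open>Being of the form \<open>cMon C\<close> up to equivalence can be read for enriched or
  for bare categories, and both readings are included. In the bare one the enrichment exists by
  \<open>pullback_enrichment\<close> and is unique by
  \<open>additive_structure_unique\<close>.\<close>

theorem corollary4p20:
  shows
    "full_functor AddCat fpCat
       (inclusion :: ('a uacat, 'a uacat \<times> 'a ufunc \<times> 'a uacat,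
                      'a ucat, 'a ucat \<times> 'a ufunc \<times> 'a ucat) func)
     \<and> faithful_functor AddCat
       (inclusion :: ('a uacat, 'a uacat \<times> 'a ufunc \<times> 'a uacat,
                      'a ucat, 'a ucat \<times> 'a ufunc \<times> 'a ucat) func)
     \<and> inj_on (omap inclusion) (Obj (AddCat :: ('a uacat, 'a uacat \<times> 'a ufunc \<times> 'a uacat) cat))
     \<and> right_adjoint AddCat fpCat
       (inclusion :: ('a uacat, 'a uacat \<times> 'a ufunc \<times> 'a uacat,
                      'a ucat, 'a ucat \<times> 'a ufunc \<times> 'a ucat) func) cMon_functor
     \<and> (\<forall>A :: 'a uacat. preadditive_category A \<longrightarrow>
          (additive_category A \<longleftrightarrow>
             (\<exists>C :: 'a ucat. fp_category C \<and> additively_equivalent A (cMon C))))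
     \<and> (\<forall>A :: 'a ucat. category A \<longrightarrow>
          ((\<exists>A' :: 'a uacat. additive_category A' \<and> cat.truncate A' = A) \<longleftrightarrow>
             (\<exists>C :: 'a ucat. fp_category C \<and> equivalent_categories A (cMon C))))"
proof (intro conjI allI impI inclusion_full inclusion_faithful inclusion_inj cMon_adjunction)
  fix A :: "'a uacat" assume A: "preadditive_category A"
  show "additive_category A \<longleftrightarrow> (\<exists>C :: 'a ucat. fp_category C \<and> additively_equivalent A (cMon C))"
  proof
    assume "additive_category A"
    then show "\<exists>C :: 'a ucat. fp_category C \<and> additively_equivalent A (cMon C)"
      using additive_category_equivalent_cMon(1)[of A] additive_category_fp[of A]
      \<comment> \<open>The underlying category of \<open>A\<close> itself serves as
        \<open>C\<close>.\<close>
      by (intro exI[of _ "cat.truncate A"]) simp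
  next
    assume "\<exists>C :: 'a ucat. fp_category C \<and> additively_equivalent A (cMon C)"
    then obtain C :: "'a ucat" and F G where "fp_category (cMon C)"
      "additive_functor A (cMon C) F" "additive_functor (cMon C) A G"
      "naturally_isomorphic A A (comp_func A G F) (id_func A)"
      "naturally_isomorphic (cMon C) (cMon C) (comp_func (cMon C) F G) (id_func (cMon C))"
      using additive_cMon additive_category_fp unfolding additively_equivalent_def by metis
    \<comment> \<open>\<open>A\<close> is preadditive by hypothesis, so only finite products have to
      come across the equivalence.\<close>
    then have "fp_category A"
      unfolding additive_functor_def by (intro equivalence_fp_category(2)[of A "cMon C" F G]) simp_all
    then show "additive_category A" using A by (simp add: additive_category_def)
  qed
next
  fix A :: "'a ucat" assume A: "category A"
  show "(\<exists>A' :: 'a uacat. additive_category A' \<and> cat.truncate A' = A) \<longleftrightarrow>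
      (\<exists>C :: 'a ucat. fp_category C \<and> equivalent_categories A (cMon C))"
  proof
    assume "\<exists>A' :: 'a uacat. additive_category A' \<and> cat.truncate A' = A"
    then show "\<exists>C :: 'a ucat. fp_category C \<and> equivalent_categories A (cMon C)"
      using additive_category_equivalent_cMon(2) additive_category_fp
      by (metis equivalent_categories_truncate fp_category_truncate)
  next
    assume "\<exists>C :: 'a ucat. fp_category C \<and> equivalent_categories A (cMon C)"
    then obtain C :: "'a ucat" and F G where C: "additive_category (cMon C)" and
      FG: "cat_functor A (cMon C) F" "cat_functor (cMon C) A G"
      "naturally_isomorphic A A (comp_func A G F) (id_func A)"
      "naturally_isomorphic (cMon C) (cMon C) (comp_func (cMon C) F G) (id_func (cMon C))"
      using additive_cMon unfolding equivalent_categories_def by metis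
    note ff = equivalence_fp_category[OF FG additive_category_fp[OF C]]
    let ?A = "pullback_enrichment A (cMon C) F"
    have "preadditive_category ?A" and trunc: "cat.truncate ?A = A"
      using pullback_enrichment_preadditive[OF ff(1)] C by (simp_all add: additive_category_def)
    moreover have "fp_category ?A" using ff(2) fp_category_truncate[of ?A] trunc by simp
    ultimately show "\<exists>A' :: 'a uacat. additive_category A' \<and> cat.truncate A' = A"
      by (intro exI[of _ ?A]) (simp add: additive_category_def)
  qed
qed

end
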